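(* Let $P_1,\dots,P_n$ be p-values (random variables in $[0,1]$) and let $\boldsymbol\omega=(\omega_1,\dots,\omega_n)$ be non-random weights with $\omega_i>0$ and $\sum_{i=1}^n\omega_i=n$. Let $I_{\mathbf P}$ be the set of dominating signals of $\mathbf P=(P_1,\dots,P_n)$. Suppose that: (i) each $P_i$ is continuously distributed; (ii) the vector $(1-P_1,\dots,1-P_n)$ has an MRV copula; (iii) for any distinct $i,j\in I_{\mathbf P}$, $\lim_{t\downarrow0}\mathbb{P}(P_i<t)/\mathbb{P}(P_j<t)$ exists in $(0,\infty)$; and for at least one $i\in I_{\mathbf P}$ there exists $F_0\in\mathscr{R}_{-1}$ such that the distribution of $Q_{F_0}(1-P_i)$ belongs to $\mathscr{R}_{-\beta}$ for some $0<\beta\le1$. Let $\gamma>0$ and $F\in\mathscr{R}^*_{-\gamma}$. Then the weighted heavy-tailed combination test is asymptotically at least as powerful as the weighted Bonferroni test: $$\lim_{\alpha\downarrow0}\frac{\mathbb{P}\left(P_{\mathrm{comb}}^{F,\boldsymbol\omega}\le\alpha\right)}{\mathbb{P}\left(P_{\mathrm{bon}}^{\boldsymbol\omega}\le\alpha\right)}\ge1.$$ Moreover, the inequality is strict if and only if the set $I_{\mathbf P}=\{i_1,\dots,i_S\}$ has at least two elements and the subvector $(1-P_{i_1},\dots,1-P_{i_S})$ is not asymptotically independent.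
   Context: The number $n$ of p-values is fixed; $\mathbb{P}$ is probability under the true configuration of hypotheses. For a CDF $F$, $\overline F=1-F$ and $Q_F(t)=\inf\{x\in\mathbb{R}:F(x)\ge t\}$ for $t\in(0,1)$; when the support of $F$ is $[c,\infty)$ set $Q_F(0)=c$. For $\gamma>0$, $\mathscr{R}_{-\gamma}$ is the class of CDFs $F$ with $\lim_{x\to\infty}\overline F(xy)/\overline F(x)=y^{-\gamma}$ for all $y>0$. $\mathscr{R}^*_{-\gamma}$ is the class of $F\in\mathscr{R}_{-\gamma}$ that are continuous and strictly increasing on their support, with support $[c,\infty)$ for some $c\in\mathbb{R}$. Weighted heavy-tailed combination test: for $F\in\mathscr{R}^*_{-\gamma}$, with $x^+=\max(0,x)$, $$\bar X_{n,\boldsymbol\omega}=\frac1n\sum_{i=1}^n Q_F\left((1-P_i/\omega_i)^+\right),\qquad P_{\mathrm{comb}}^{F,\boldsymbol\omega}=\min\left(1,\,n^{1-\gamma}\,\overline F(\bar X_{n,\boldsymbol\omega})\right).$$ Weighted Bonferroni test: $P_{\mathrm{bon}}^{\boldsymbol\omega}=\min\left(1,\,n\min_{i=1,\dots,n}P_i/\omega_i\right)$. Dominating signals: write $P_i\succ P_j$ if $\lim_{t\downarrow0}\mathbb{P}(P_i<t)/\mathbb{P}(P_j<t)=0$. Then $I_{\mathbf P}=\{i\in\{1,\dots,n\}:\text{there is no } j\in\{1,\dots,n\}\text{ with }P_i\succ P_j\}$. MRV copula: for an $n$-dimensional copula $C$ let $D(u_1,\dots,u_n)=1-C(1-u_1,\dots,1-u_n)$.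 $C$ is an MRV copula if for some (real-valued) function $\ell$, $\lim_{s\downarrow0}s^{-1}D(sv_1,\dots,sv_n)=\ell(v_1,\dots,v_n)$ for all $v_1,\dots,v_n\ge0$. Equivalently, there is a copula $C^*$ (the limiting copula) with $\lim_{t\to\infty}C(u_1^{1/t},\dots,u_n^{1/t})^t=C^*(u_1,\dots,u_n)$ for all $u\in[0,1]^n$. The same definitions apply in any dimension. A random vector with continuous marginals is asymptotically independent if its copula is MRV with limiting copula equal to the product copula $u_1\cdots u_n$ (equivalently $\ell(v_1,\dots,v_n)=v_1+\dots+v_n$). *)

theory Defs
  imports "HOL-Probability.Probability"
begin

section \<open>Distribution functions, quantiles and regular variation\<close>

definition is_cdf :: "(real \<Rightarrow> real) \<Rightarrow> bool" where
  "is_cdf F \<longleftrightarrow> (\<exists>N. real_distribution N \<and> F = cdf N)"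

definition cdf_support :: "(real \<Rightarrow> real) \<Rightarrow> real set" where
  "cdf_support F = {x. \<forall>e>0. F (x - e) < F (x + e)}"

text \<open>
  Only arguments in the half-open interval from 0 to 1 are meaningful. At 0 the quantile is the left
  end point of the support; if the support is not of the form \<open>{c..}\<close>, that value is arbitrary.
  At 1 (and for \<open>F\<close> with unbounded support) the infimum of the empty set gives an arbitrary real
  where one would expect infinity. In the uses below these junk values only matter on null
  events, since the p-values are continuously distributed.
\<close>
definition quantile :: "(real \<Rightarrow> real) \<Rightarrow> real \<Rightarrow> real" where
  "quantile F t = (if t = 0 then (THE c. cdf_support F = {c..}) else Inf {x. F x \<ge> t})"

text \<open>
  \<open>RV \<gamma>\<close> is the class of distribution functions whose tail is regularly varying at infinity with
  index \<open>-\<gamma>\<close>. Because the limit is positive, the division convention \<open>x / 0 = 0\<close> is harmless: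
  the limit forces \<open>F x \<noteq> 1\<close> for all large \<open>x\<close>.
\<close>
definition RV :: "real \<Rightarrow> (real \<Rightarrow> real) set" where
  "RV \<gamma> = {F. is_cdf F \<and>
     (\<forall>y>0. ((\<lambda>x. (1 - F (x * y)) / (1 - F x)) \<longlongrightarrow> y powr (- \<gamma>)) at_top)}"

definition RV_star :: "real \<Rightarrow> (real \<Rightarrow> real) set" where
  "RV_star \<gamma> = {F \<in> RV \<gamma>. \<exists>c. cdf_support F = {c..} \<and> continuous_on {c..} F \<and> strict_mono_on {c..} F}"


section \<open>Combination tests\<close>

definition comb_stat :: "nat \<Rightarrow> (real \<Rightarrow> real) \<Rightarrow> (nat \<Rightarrow> real) \<Rightarrow> (nat \<Rightarrow> real) \<Rightarrow> real" where
  "comb_stat n F w p = (1 / real n) * (\<Sum>i=1..n. quantile F (max 0 (1 - p i / w i)))"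

text \<open>The parameter \<open>\<gamma>\<close> is the tail index of \<open>F\<close>, as in \<open>F \<in> RV_star \<gamma>\<close>.\<close>
definition p_comb :: "nat \<Rightarrow> real \<Rightarrow> (real \<Rightarrow> real) \<Rightarrow> (nat \<Rightarrow> real) \<Rightarrow> (nat \<Rightarrow> real) \<Rightarrow> real" where
  "p_comb n \<gamma> F w p = min 1 (real n powr (1 - \<gamma>) * (1 - F (comb_stat n F w p)))"

definition p_bon :: "nat \<Rightarrow> (nat \<Rightarrow> real) \<Rightarrow> (nat \<Rightarrow> real) \<Rightarrow> real" where
  "p_bon n w p = min 1 (real n * (MIN i\<in>{1..n}. p i / w i))"


section \<open>Dominating signals\<close>

text \<open>
  The first conjunct says that the quotient is defined for all small \<open>t\<close>. Without it, the
  convention \<open>x / 0 = 0\<close> would make \<open>succ_signal M X Y\<close> true for every \<open>X\<close> as soon as \<open>Y\<close> is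
  bounded away from 0, so a single such variable would empty the set of dominating signals.
\<close>
definition succ_signal :: "'a measure \<Rightarrow> ('a \<Rightarrow> real) \<Rightarrow> ('a \<Rightarrow> real) \<Rightarrow> bool" where
  "succ_signal M X Y \<longleftrightarrow>
     (\<forall>t>0. \<P>(x in M. Y x < t) \<noteq> 0) \<and>
     ((\<lambda>t. \<P>(x in M. X x < t) / \<P>(x in M. Y x < t)) \<longlongrightarrow> 0) (at_right 0)"

definition dominating_signals :: "'a measure \<Rightarrow> nat \<Rightarrow> (nat \<Rightarrow> 'a \<Rightarrow> real) \<Rightarrow> nat set" where
  "dominating_signals M n P = {i \<in> {1..n}. \<not> (\<exists>j\<in>{1..n}. succ_signal M (P i) (P j))}"


section \<open>Copulas\<close>

text \<open>
  Copulas are indexed by a finite set \<open>I\<close> of coordinates, so that they also apply to subvectors.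
  A copula is a distribution function with standard uniform marginals, restricted to the unit cube:
  its values outside the cube are not constrained and never used.
\<close>
definition unit_cube :: "'i set \<Rightarrow> ('i \<Rightarrow> real) set" where
  "unit_cube I = {u. \<forall>i\<in>I. u i \<in> {0..1}}"

definition copula :: "'i set \<Rightarrow> (('i \<Rightarrow> real) \<Rightarrow> real) \<Rightarrow> bool" where
  "copula I C \<longleftrightarrow>
     (\<exists>N. prob_space N \<and> sets N = sets (Pi\<^sub>M I (\<lambda>_. borel)) \<and>
        (\<forall>i\<in>I. distr N borel (\<lambda>x. x i) = uniform_measure lborel {0..1}) \<and>
        (\<forall>u\<in>unit_cube I. C u = \<P>(x in N. \<forall>i\<in>I. x i \<le> u i)))"

text \<open>For continuous marginals, \<open>C\<close> is uniquely determined on the unit cube (Sklar).\<close>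
definition copula_of ::
  "'a measure \<Rightarrow> 'i set \<Rightarrow> ('i \<Rightarrow> 'a \<Rightarrow> real) \<Rightarrow> (('i \<Rightarrow> real) \<Rightarrow> real) \<Rightarrow> bool" where
  "copula_of M I X C \<longleftrightarrow> copula I C \<and>
     (\<forall>x. \<P>(a in M. \<forall>i\<in>I. X i a \<le> x i) = C (\<lambda>i. cdf (distr M borel (X i)) (x i)))"

definition mrv_copula :: "'i set \<Rightarrow> (('i \<Rightarrow> real) \<Rightarrow> real) \<Rightarrow> bool" where
  "mrv_copula I C \<longleftrightarrow> copula I C \<and>
     (\<exists>l. \<forall>v. (\<forall>i\<in>I. v i \<ge> 0) \<longrightarrow>
        ((\<lambda>s. (1 - C (\<lambda>i. 1 - s * v i)) / s) \<longlongrightarrow> l v) (at_right 0))"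

definition limiting_copula ::
  "'i set \<Rightarrow> (('i \<Rightarrow> real) \<Rightarrow> real) \<Rightarrow> (('i \<Rightarrow> real) \<Rightarrow> real) \<Rightarrow> bool" where
  "limiting_copula I C C' \<longleftrightarrow> copula I C' \<and>
     (\<forall>u\<in>unit_cube I. ((\<lambda>t. C (\<lambda>i. u i powr (1 / t)) powr t) \<longlongrightarrow> C' u) at_top)"

definition has_mrv_copula :: "'a measure \<Rightarrow> 'i set \<Rightarrow> ('i \<Rightarrow> 'a \<Rightarrow> real) \<Rightarrow> bool" where
  "has_mrv_copula M I X \<longleftrightarrow> (\<exists>C. copula_of M I X C \<and> mrv_copula I C)"

definition asymptotically_independent :: "'a measure \<Rightarrow> 'i set \<Rightarrow> ('i \<Rightarrow> 'a \<Rightarrow> real) \<Rightarrow> bool" where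
  "asymptotically_independent M I X \<longleftrightarrow>
     (\<exists>C. copula_of M I X C \<and> mrv_copula I C \<and> limiting_copula I C (\<lambda>u. \<Prod>i\<in>I. u i))"

end

theory Submission
  imports Defs "HOL-Real_Asymp.Real_Asymp"
begin

text \<open>
  Let \<open>g\<close> be the distribution function of the dominating signal \<open>i0\<close> that satisfies the heavy-tail condition.
  That condition makes \<open>g\<close> regularly varying at 0 with some index \<open>\<beta> > 0\<close> (\<open>rv_at_0_from_tail\<close>). Every
  p-value has a distribution function asymptotic to \<open>c i * g\<close>, where \<open>c i > 0\<close> exactly for the dominating
  signals. Let \<open>Y i\<close> be the transformed p-values \<open>Q\<^sub>F((1 - P i / w i)\<^sup>+)\<close>, shifted to be non-negative, and
  let \<open>l\<close> be the tail dependence function of the copula. Since \<open>Y i\<close> exceeds a level iff \<open>P i\<close> is small, the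
  MRV property gives limits for the probabilities that some \<open>Y i\<close> exceeds \<open>r i * x\<close>, relative to the scale
  \<open>h x = g (S x)\<close>, with \<open>S\<close> the shifted tail of \<open>F\<close>; the scale has tail index \<open>\<kappa> = \<gamma> * \<beta>\<close>.

  So \<open>Y\<close> is multivariate regularly varying. Writing \<open>\<nu>\<close> for its limit measure on the orthant, both tests
  have rejection probabilities proportional to \<open>h\<close> at the same level, with the constants \<open>\<nu>{sum > 1}\<close> for
  the combination test and \<open>\<nu>{max > 1} = l a\<close>, where \<open>a i = c i * w i powr \<beta>\<close>, for the Bonferroni
  test. The limiting ratio is their quotient, which is at least 1. By homogeneity of \<open>\<nu>\<close> it equals 1
  exactly if \<open>\<nu>\<close> is concentrated on the coordinate axes, that is, if no pair of coordinates has joint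
  exceedances. Coordinates outside the set of dominating signals have \<open>a i = 0\<close> and never do; for the
  dominating signals this is additivity of \<open>l\<close>, which is asymptotic independence
  (\<open>asymptotically_independent_iff\<close>).

  The measure \<open>\<nu>\<close> is not constructed. Limits for unions of exceedances give limits for every event
  determined by finitely many thresholds (\<open>pattern_has_tail\<close>), and the event that the sum is large is
  sandwiched between such events (\<open>total_has_tail\<close>). The comparison of the sum with the maximum is
  carried out on these limits (\<open>total_le_if_pairs_negligible\<close>, \<open>total_gt_if_pair_not_negligible\<close>).
\<close>

section \<open>Tails of sums of jointly regularly varying variables\<close>

lemma card_nat_less_real:
  fixes y :: real and N :: nat
  assumes "0 \<le> y"
  defines "k \<equiv> card {j \<in> {1..N}. real j < y}"
  shows "real k \<le> y" "min y (real N) \<le> real k + 1"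
proof -
  have "{j \<in> {1..N}. real j < y} \<subseteq> {1..nat \<lfloor>y\<rfloor>}" by (auto simp: le_nat_floor)
  then have "k \<le> nat \<lfloor>y\<rfloor>" unfolding k_def using card_mono[of "{1..nat \<lfloor>y\<rfloor>}"] by fastforce
  then show "real k \<le> y" using assms(1) by linarith
  define m where "m = min N (nat (\<lceil>y\<rceil> - 1))"
  have "{1..m} \<subseteq> {j \<in> {1..N}. real j < y}"
  proof
    fix j assume "j \<in> {1..m}"
    then have "1 \<le> j" "j \<le> N" "j \<le> nat (\<lceil>y\<rceil> - 1)" unfolding m_def by auto
    then have "int j \<le> \<lceil>y\<rceil> - 1" by linarith
    then have "real j < y" by linarith
    then show "j \<in> {j \<in> {1..N}. real j < y}" using \<open>1 \<le> j\<close> \<open>j \<le> N\<close> by auto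
  qed
  then have "m \<le> k" unfolding k_def using card_mono[of "{j \<in> {1..N}. real j < y}" "{1..m}"] by simp
  moreover have "min y (real N) \<le> real m + 1" unfolding m_def by linarith
  ultimately show "min y (real N) \<le> real k + 1" by linarith
qed

lemma shrink_tendsto:
  "((\<lambda>N. (1 - c / real N) powr p) \<longlonglongrightarrow> 1)"
proof -
  have "((\<lambda>N. (1 - c / real N) powr p) \<longlonglongrightarrow> (1 - 0) powr p)"
    by (intro tendsto_powr tendsto_diff tendsto_const lim_const_over_n) auto
  then show ?thesis by simp
qed

text \<open>
  Non-negative random variables whose finite unions of exceedance events \<open>{r x < Y i}\<close> have
  probabilities comparable to a common regularly varying scale \<open>h\<close>. This is multivariate regular
  variation, stated without a limit measure.
\<close>
locale joint_tail = prob_space M for M :: "'a measure" +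
  fixes A :: "'i set" and Y :: "'i \<Rightarrow> 'a \<Rightarrow> real" and h :: "real \<Rightarrow> real" and \<kappa> :: real
  assumes finA: "finite A"
    and meas [measurable]: "\<And>i. i \<in> A \<Longrightarrow> Y i \<in> borel_measurable M"
    and nonneg: "\<And>i \<omega>. i \<in> A \<Longrightarrow> \<omega> \<in> space M \<Longrightarrow> 0 \<le> Y i \<omega>"
    and kpos: "0 < \<kappa>"
    and hpos: "eventually (\<lambda>x. 0 < h x) at_top"
    and hrv: "\<And>r. 0 < r \<Longrightarrow> ((\<lambda>x. h (r * x) / h x) \<longlongrightarrow> r powr (- \<kappa>)) at_top"
    and exceed_conv: "\<And>K. finite K \<Longrightarrow> K \<subseteq> A \<times> {0<..} \<Longrightarrow>
      \<exists>a. ((\<lambda>x. prob {\<omega> \<in> space M. \<exists>(i, r)\<in>K. r * x < Y i \<omega>} / h x) \<longlongrightarrow> a) at_top"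
begin

text \<open>
  The rescaled probability of a family of events indexed by the level \<open>x\<close> has a limit. For
  \<open>E x = {Y / x \<in> B}\<close> the limit is the mass that the limit measure gives to \<open>B\<close>.
\<close>
definition has_tail :: "(real \<Rightarrow> 'a set) \<Rightarrow> real \<Rightarrow> bool" where
  "has_tail E a \<longleftrightarrow> ((\<lambda>x. prob (E x) / h x) \<longlongrightarrow> a) at_top"

text \<open>
  At least one of the finitely many thresholds in \<open>K\<close>, scaled by \<open>x\<close>, is exceeded.
\<close>
definition exceed :: "('i \<times> real) set \<Rightarrow> real \<Rightarrow> 'a set" where
  "exceed K x = {\<omega> \<in> space M. \<exists>(i, r)\<in>K. r * x < Y i \<omega>}"

text \<open>
  The pairs (coordinate, threshold) of a finite grid \<open>G\<close> that are exceeded at the outcome \<open>\<omega>\<close>;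
  this records the grid cell of \<open>Y / x\<close>.
\<close>
definition exceed_pattern :: "('i \<times> real) set \<Rightarrow> real \<Rightarrow> 'a \<Rightarrow> ('i \<times> real) set" where
  "exceed_pattern G x \<omega> = {e \<in> G. snd e * x < Y (fst e) \<omega>}"

lemma has_tail_mono:
  assumes "has_tail E a" "has_tail E' b" "\<And>x. 0 < x \<Longrightarrow> E x \<subseteq> E' x" "\<And>x. E' x \<in> events"
  shows "a \<le> b"
proof -
  have "eventually (\<lambda>x. prob (E x) / h x \<le> prob (E' x) / h x) at_top"
    using hpos eventually_gt_at_top[of 0]
    by eventually_elim (auto intro!: divide_right_mono finite_measure_mono assms)
  then show ?thesis
    using assms(1,2) unfolding has_tail_def
    by (intro tendsto_le[OF trivial_limit_at_top_linorder]) auto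
qed

lemma has_tail_nonneg:
  assumes "has_tail E a" shows "0 \<le> a"
proof -
  have "eventually (\<lambda>x. 0 \<le> prob (E x) / h x) at_top"
    using hpos by eventually_elim auto
  then show ?thesis using assms unfolding has_tail_def
    by (intro tendsto_lowerbound[OF _ _ trivial_limit_at_top_linorder]) auto
qed

lemma has_tail_scale:
  assumes "has_tail E a" "0 < r"
  shows "has_tail (\<lambda>x. E (r * x)) (r powr (- \<kappa>) * a)"
proof -
  have f: "filterlim (\<lambda>x. r * x) at_top at_top"
    using assms(2) by (intro filterlim_tendsto_pos_mult_at_top[OF tendsto_const _ filterlim_ident]) auto
  have 1: "((\<lambda>x. prob (E (r * x)) / h (r * x)) \<longlongrightarrow> a) at_top"
    using filterlim_compose[OF assms(1)[unfolded has_tail_def] f] by simp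
  have 2: "eventually (\<lambda>x. h (r * x) > 0) at_top"
    by (rule eventually_compose_filterlim[OF hpos f])
  have "((\<lambda>x. h (r * x) / h x * (prob (E (r * x)) / h (r * x))) \<longlongrightarrow> r powr (- \<kappa>) * a) at_top"
    by (intro tendsto_mult hrv 1 assms)
  then show ?thesis unfolding has_tail_def
    by (rule Lim_transform_eventually) (use 2 in eventually_elim, auto)
qed

lemma has_tail_Diff:
  assumes "has_tail E a" "has_tail E' b" "\<And>x. E' x \<subseteq> E x" "\<And>x. E x \<in> events" "\<And>x. E' x \<in> events"
  shows "has_tail (\<lambda>x. E x - E' x) (a - b)"
  using tendsto_diff[OF assms(1,2)[unfolded has_tail_def]] assms(3-)
  by (simp add: has_tail_def finite_measure_Diff diff_divide_distrib)

lemma has_tail_UN_disjoint: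
  assumes "finite S" "\<And>H. H \<in> S \<Longrightarrow> has_tail (E H) (a H)" "\<And>H x. H \<in> S \<Longrightarrow> E H x \<in> events"
    "\<And>x. disjoint_family_on (\<lambda>H. E H x) S"
  shows "has_tail (\<lambda>x. \<Union>H\<in>S. E H x) (\<Sum>H\<in>S. a H)"
proof -
  have "prob (\<Union>H\<in>S. E H x) = (\<Sum>H\<in>S. prob (E H x))" for x
    using assms by (intro finite_measure_finite_Union) auto
  then show ?thesis
    using tendsto_sum[of S "\<lambda>H x. prob (E H x) / h x" a at_top] assms(2)
    by (simp add: has_tail_def sum_divide_distrib)
qed

lemma exceed_events [measurable]:
  assumes "finite K" "K \<subseteq> A \<times> {0<..}" shows "exceed K x \<in> events"
proof -
  have "exceed K x = (\<Union>e\<in>K. {\<omega> \<in> space M. snd e * x < Y (fst e) \<omega>})"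
    unfolding exceed_def by auto
  also have "\<dots> \<in> events"
  proof (intro sets.finite_UN assms)
    fix e assume "e \<in> K"
    then have [measurable]: "Y (fst e) \<in> borel_measurable M" using assms by auto
    show "{\<omega> \<in> space M. snd e * x < Y (fst e) \<omega>} \<in> events" by measurable
  qed
  finally show ?thesis .
qed

lemma exceed_has_tail:
  assumes "finite K" "K \<subseteq> A \<times> {0<..}" shows "\<exists>a. has_tail (exceed K) a"
  using exceed_conv[OF assms] unfolding has_tail_def exceed_def .

lemma pattern_events:
  assumes "finite G" "G \<subseteq> A \<times> {0<..}" shows "{\<omega> \<in> space M. exceed_pattern G x \<omega> = H} \<in> events"
proof (cases "H \<subseteq> G")
  case True
  have "{\<omega> \<in> space M. exceed_pattern G x \<omega> = H} =
    {\<omega> \<in> space M. \<forall>e\<in>G. (snd e * x < Y (fst e) \<omega>) = (e \<in> H)}"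
    using True unfolding exceed_pattern_def by auto
  also have "\<dots> \<in> events"
  proof (intro sets.sets_Collect_finite_All assms)
    fix e assume "e \<in> G"
    then have [measurable]: "Y (fst e) \<in> borel_measurable M" using assms by auto
    show "{\<omega> \<in> space M. (snd e * x < Y (fst e) \<omega>) = (e \<in> H)} \<in> events" by measurable
  qed
  finally show ?thesis .
next
  case False
  then have eq: "{\<omega> \<in> space M. exceed_pattern G x \<omega> = H} = {}" unfolding exceed_pattern_def by auto
  show ?thesis unfolding eq by simp
qed

text \<open>
  The events that the pattern is non-empty and contained in \<open>H\<close> are differences of two exceedance
  events; removing the strictly smaller patterns isolates \<open>H\<close>, by induction on \<open>H\<close>.
\<close>
lemma pattern_eq_has_tail:
  assumes G: "finite G" "G \<subseteq> A \<times> {0<..}" and "H \<subseteq> G" "H \<noteq> {}"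
  shows "\<exists>a. has_tail (\<lambda>x. {\<omega> \<in> space M. exceed_pattern G x \<omega> = H}) a"
proof -
  have "finite H" using assms finite_subset by blast
  then show ?thesis using assms(3,4)
  proof (induction H rule: finite_psubset_induct)
    case (psubset H)
    let ?P = "\<lambda>H' x. {\<omega> \<in> space M. exceed_pattern G x \<omega> = H'}"
    let ?S = "{H'. H' \<subset> H \<and> H' \<noteq> {}}"
    have finS: "finite ?S" using psubset.hyps by (auto intro: finite_subset[of _ "Pow H"])
    have GH: "finite (G - H)" "G - H \<subseteq> A \<times> {0<..}" using G by auto
    obtain a b where ab: "has_tail (exceed G) a" "has_tail (exceed (G - H)) b"
      using exceed_has_tail[OF G] exceed_has_tail[OF GH] by blast
    have "\<forall>H'\<in>?S. \<exists>c. has_tail (?P H') c" using psubset by blast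
    from bchoice[OF this] obtain c where c: "\<And>H'. H' \<in> ?S \<Longrightarrow> has_tail (?P H') (c H')"
      by blast
    have 1: "has_tail (\<lambda>x. exceed G x - exceed (G - H) x) (a - b)"
      by (rule has_tail_Diff[OF ab _ exceed_events[OF G] exceed_events[OF GH]]) (auto simp: exceed_def)
    have 2: "has_tail (\<lambda>x. \<Union>H'\<in>?S. ?P H' x) (\<Sum>H'\<in>?S. c H')"
      using c finS by (intro has_tail_UN_disjoint pattern_events G) (auto simp: disjoint_family_on_def)
    have "has_tail (\<lambda>x. (exceed G x - exceed (G - H) x) - (\<Union>H'\<in>?S. ?P H' x)) (a - b - (\<Sum>H'\<in>?S. c H'))"
    proof (rule has_tail_Diff[OF 1 2])
      fix x
      show "exceed G x - exceed (G - H) x \<in> events" using exceed_events[OF G] exceed_events[OF GH] by auto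
      show "(\<Union>H'\<in>?S. ?P H' x) \<in> events" using finS by (intro sets.finite_UN pattern_events G)
      show "(\<Union>H'\<in>?S. ?P H' x) \<subseteq> exceed G x - exceed (G - H) x"
        unfolding exceed_def exceed_pattern_def using psubset.prems by fastforce
    qed
    moreover have "(exceed G x - exceed (G - H) x) - (\<Union>H'\<in>?S. ?P H' x) = ?P H x" for x
    proof -
      have "\<omega> \<in> exceed G x - exceed (G - H) x \<longleftrightarrow> \<omega> \<in> space M \<and> exceed_pattern G x \<omega> \<noteq> {} \<and> exceed_pattern G x \<omega> \<subseteq> H" for \<omega>
        unfolding exceed_def exceed_pattern_def by fastforce
      moreover have "\<omega> \<in> (\<Union>H'\<in>?S. ?P H' x) \<longleftrightarrow> \<omega> \<in> space M \<and> exceed_pattern G x \<omega> \<noteq> {} \<and> exceed_pattern G x \<omega> \<subset> H" for \<omega>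
        by auto
      ultimately show ?thesis using psubset.prems by (intro set_eqI) (simp only: Diff_iff mem_Collect_eq, auto)
    qed
    ultimately show ?case by auto
  qed
qed

lemma pattern_has_tail:
  assumes G: "finite G" "G \<subseteq> A \<times> {0<..}" and "\<not> Q {}"
  shows "\<exists>a. has_tail (\<lambda>x. {\<omega> \<in> space M. Q (exceed_pattern G x \<omega>)}) a"
    and "{\<omega> \<in> space M. Q (exceed_pattern G x \<omega>)} \<in> events"
proof -
  let ?S = "{H. H \<subseteq> G \<and> Q H}"
  have eq: "{\<omega> \<in> space M. Q (exceed_pattern G x \<omega>)} = (\<Union>H\<in>?S. {\<omega> \<in> space M. exceed_pattern G x \<omega> = H})" for x
    unfolding exceed_pattern_def by auto
  have fin: "finite ?S" using G by auto
  have "\<forall>H\<in>?S. \<exists>a. has_tail (\<lambda>x. {\<omega> \<in> space M. exceed_pattern G x \<omega> = H}) a"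
    using assms by (intro ballI pattern_eq_has_tail) auto
  from bchoice[OF this] obtain a
    where "\<And>H. H \<in> ?S \<Longrightarrow> has_tail (\<lambda>x. {\<omega> \<in> space M. exceed_pattern G x \<omega> = H}) (a H)"
    by blast
  then have "has_tail (\<lambda>x. \<Union>H\<in>?S. {\<omega> \<in> space M. exceed_pattern G x \<omega> = H}) (\<Sum>H\<in>?S. a H)"
    using fin by (intro has_tail_UN_disjoint pattern_events G) (auto simp: disjoint_family_on_def)
  then show "\<exists>a. has_tail (\<lambda>x. {\<omega> \<in> space M. Q (exceed_pattern G x \<omega>)}) a" unfolding eq by blast
  show "{\<omega> \<in> space M. Q (exceed_pattern G x \<omega>)} \<in> events" unfolding eq using fin
    by (intro sets.finite_UN pattern_events G)
qed


text \<open>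
  The sum of all coordinates reaches the level \<open>x\<close>.
\<close>
definition total :: "real \<Rightarrow> 'a set" where
  "total x = {\<omega> \<in> space M. x \<le> (\<Sum>i\<in>A. Y i \<omega>)}"

lemma total_events [measurable]: "total x \<in> events"
  unfolding total_def by measurable

text \<open>
  With mesh \<open>1 / N\<close>, the number of exceeded grid points determines the sum of the coordinates up to
  a relative error of \<open>card A / N\<close>. The event \<open>B\<close> depends on the exceedance pattern only, so it has
  a tail limit.
\<close>
lemma total_grid_sandwich:
  assumes N: "card A < N"
  defines "G \<equiv> A \<times> ((\<lambda>j. real j / real N) ` {1..N})"
  defines "B \<equiv> \<lambda>x. {\<omega> \<in> space M. N - card A \<le> card (exceed_pattern G x \<omega>)}"
  shows "\<exists>a. has_tail B a" "B x \<in> events"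
    "0 < x \<Longrightarrow> total x \<subseteq> B x" "0 < x \<Longrightarrow> B x \<subseteq> total ((1 - card A / N) * x)"
proof -
  have N0: "0 < N" using N by simp
  have G: "finite G" "G \<subseteq> A \<times> {0<..}" unfolding G_def using finA N0 by auto
  show "\<exists>a. has_tail B a" "B x \<in> events" unfolding B_def
    using pattern_has_tail[OF G, of "\<lambda>H. N - card A \<le> card H"] N by auto
  define y where "y i \<omega> = Y i \<omega> * N / x" for i \<omega>
  define k where "k i \<omega> = card {j \<in> {1..N}. real j < y i \<omega>}" for i \<omega>
  have card_pat: "card (exceed_pattern G x \<omega>) = (\<Sum>i\<in>A. k i \<omega>)" if "0 < x" for \<omega>
  proof -
    have "exceed_pattern G x \<omega> = (SIGMA i:A. (\<lambda>j. real j / real N) ` {j \<in> {1..N}. real j < y i \<omega>})"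
      unfolding exceed_pattern_def G_def y_def using that N0 by (auto simp: field_simps)
    also have "card \<dots> = (\<Sum>i\<in>A. card ((\<lambda>j. real j / real N) ` {j \<in> {1..N}. real j < y i \<omega>}))"
      using finA by (intro card_SigmaI) auto
    also have "\<dots> = (\<Sum>i\<in>A. k i \<omega>)" unfolding k_def
      using N0 by (intro sum.cong refl card_image) (auto simp: inj_on_def)
    finally show ?thesis .
  qed
  have y0: "0 \<le> y i \<omega>" if "i \<in> A" "\<omega> \<in> space M" "0 < x" for i \<omega>
    unfolding y_def using nonneg[OF that(1,2)] that(3) by simp
  have ysum: "(\<Sum>i\<in>A. y i \<omega>) = (\<Sum>i\<in>A. Y i \<omega>) * N / x" for \<omega>
    unfolding y_def by (simp add: sum_distrib_right sum_divide_distrib)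
  show "total x \<subseteq> B x" if x: "0 < x"
  proof
    fix \<omega> assume "\<omega> \<in> total x"
    then have w: "\<omega> \<in> space M" and s: "x \<le> (\<Sum>i\<in>A. Y i \<omega>)" unfolding total_def by auto
    have s': "real N \<le> (\<Sum>i\<in>A. y i \<omega>)" unfolding ysum using s x N0 by (simp add: field_simps)
    have "real N \<le> (\<Sum>i\<in>A. min (y i \<omega>) (real N))"
    proof (cases "\<exists>i\<in>A. real N < y i \<omega>")
      case True
      then obtain i where i: "i \<in> A" "real N < y i \<omega>" by auto
      then have "min (y i \<omega>) (real N) \<le> (\<Sum>i\<in>A. min (y i \<omega>) (real N))"
        using finA y0 w x by (intro member_le_sum) auto
      then show ?thesis using i by simp
    next
      case False
      then have "(\<Sum>i\<in>A. min (y i \<omega>) (real N)) = (\<Sum>i\<in>A. y i \<omega>)" by (intro sum.cong) auto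
      then show ?thesis using s' by simp
    qed
    also have "\<dots> \<le> (\<Sum>i\<in>A. real (k i \<omega>) + 1)"
      unfolding k_def using card_nat_less_real(2) y0 w x by (intro sum_mono) auto
    also have "\<dots> = real (card (exceed_pattern G x \<omega>) + card A)" by (simp add: card_pat[OF x] sum.distrib)
    finally show "\<omega> \<in> B x" unfolding B_def using w by auto
  qed
  show "B x \<subseteq> total ((1 - card A / N) * x)" if x: "0 < x"
  proof
    fix \<omega> assume "\<omega> \<in> B x"
    then have w: "\<omega> \<in> space M" and s: "N - card A \<le> card (exceed_pattern G x \<omega>)" unfolding B_def by auto
    have "real N - card A \<le> real (card (exceed_pattern G x \<omega>))" using s by linarith
    also have "\<dots> = (\<Sum>i\<in>A. real (k i \<omega>))" by (simp add: card_pat[OF x])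
    also have "\<dots> \<le> (\<Sum>i\<in>A. y i \<omega>)"
      unfolding k_def using card_nat_less_real(1) y0 w x by (intro sum_mono) auto
    finally show "\<omega> \<in> total ((1 - card A / N) * x)"
      unfolding total_def ysum using w x N0 by (simp add: field_simps)
  qed
qed

text \<open>
  The limit is the infimum of the limits of the outer grid approximations. It is also the limit from
  below, because the inner approximations are the outer ones at a level rescaled by a factor tending to 1,
  and rescaling the level multiplies the limits by a power of that factor.
\<close>
lemma total_has_tail: "\<exists>a. has_tail total a"
proof -
  define n where "n = card A"
  have "\<forall>N\<in>{n<..}. \<exists>B a. has_tail B a \<and> (\<forall>x. B x \<in> events) \<and>
      (\<forall>x>0. total x \<subseteq> B x \<and> B x \<subseteq> total ((1 - n / N) * x))"
  proof
    fix N assume "N \<in> {n<..}"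
    then have N: "card A < N" unfolding n_def by simp
    show "\<exists>B a. has_tail B a \<and> (\<forall>x. B x \<in> events) \<and>
      (\<forall>x>0. total x \<subseteq> B x \<and> B x \<subseteq> total ((1 - n / N) * x))"
      using total_grid_sandwich[OF N] unfolding n_def by blast
  qed
  from bchoice[OF this] obtain B where "\<forall>N\<in>{n<..}. \<exists>a. has_tail (B N) a \<and> (\<forall>x. B N x \<in> events) \<and>
      (\<forall>x>0. total x \<subseteq> B N x \<and> B N x \<subseteq> total ((1 - n / N) * x))" by blast
  from bchoice[OF this] obtain a where "\<forall>N\<in>{n<..}. has_tail (B N) (a N) \<and> (\<forall>x. B N x \<in> events) \<and>
      (\<forall>x>0. total x \<subseteq> B N x \<and> B N x \<subseteq> total ((1 - n / N) * x))" by blast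
  then have B: "\<And>N. n < N \<Longrightarrow> has_tail (B N) (a N)"
      "\<And>N x. n < N \<Longrightarrow> B N x \<in> events" "\<And>N x. n < N \<Longrightarrow> 0 < x \<Longrightarrow> total x \<subseteq> B N x"
      "\<And>N x. n < N \<Longrightarrow> 0 < x \<Longrightarrow> B N x \<subseteq> total ((1 - n / N) * x)"
    by (simp_all add: Ball_def)
  define l where "l = Inf (a ` {n<..})"
  have a0: "0 \<le> a N" if "n < N" for N using has_tail_nonneg B(1) that by blast
  have bdd: "bdd_below (a ` {n<..})" using a0 by (intro bdd_belowI[of _ 0]) auto
  have la: "l \<le> a N" if "n < N" for N unfolding l_def using that bdd by (intro cInf_lower) auto
  have "has_tail total l" unfolding has_tail_def
  proof (rule order_tendstoI)
    fix y assume "l < y"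
    then obtain N where N: "n < N" "a N < y"
      using cInf_less_iff[of "a ` {n<..}" y] bdd unfolding l_def by auto
    have "eventually (\<lambda>x. prob (B N x) / h x < y) at_top"
      using B(1)[OF N(1)] N(2) unfolding has_tail_def by (rule order_tendstoD)
    then show "eventually (\<lambda>x. prob (total x) / h x < y) at_top"
      using eventually_gt_at_top[of 0] hpos
    proof eventually_elim
      case (elim x)
      have "prob (total x) / h x \<le> prob (B N x) / h x"
        using B(2,3)[OF N(1)] elim by (intro divide_right_mono finite_measure_mono) auto
      then show ?case using elim by simp
    qed
  next
    fix y assume y: "y < l"
    have "((\<lambda>N. (1 - real n / real N) powr \<kappa> * l) \<longlonglongrightarrow> 1 * l)"
      by (intro tendsto_mult shrink_tendsto tendsto_const)
    then have "eventually (\<lambda>N. y < (1 - real n / real N) powr \<kappa> * l) sequentially"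
      using y by (intro order_tendstoD) auto
    then have "eventually (\<lambda>N. n < N \<and> y < (1 - real n / real N) powr \<kappa> * l) sequentially"
      using eventually_gt_at_top[of n] by eventually_elim simp
    then obtain N where N: "n < N" "y < (1 - real n / real N) powr \<kappa> * l"
      using eventually_happens'[OF sequentially_bot] by blast
    define r where "r = 1 / (1 - real n / real N)"
    have r: "0 < r" "(1 - real n / real N) * r = 1" using N(1) unfolding r_def by (auto simp: field_simps)
    have "r powr (- \<kappa>) = (1 - real n / real N) powr \<kappa>"
      using N(1) unfolding r_def by (simp add: powr_divide powr_minus field_simps)
    then have "has_tail (\<lambda>x. B N (r * x)) ((1 - real n / real N) powr \<kappa> * a N)"
      using has_tail_scale[OF B(1)[OF N(1)] r(1)] by simp
    moreover have "y < (1 - real n / real N) powr \<kappa> * a N"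
      using N(2) mult_left_mono[OF la[OF N(1)], of "(1 - real n / real N) powr \<kappa>"] by simp
    ultimately have "eventually (\<lambda>x. y < prob (B N (r * x)) / h x) at_top"
      unfolding has_tail_def by (rule order_tendstoD)
    then show "eventually (\<lambda>x. y < prob (total x) / h x) at_top"
      using eventually_gt_at_top[of 0] hpos
    proof eventually_elim
      case (elim x)
      have "B N (r * x) \<subseteq> total ((1 - n / N) * (r * x))" using B(4)[OF N(1)] r elim by simp
      also have "(1 - n / N) * (r * x) = x" using r(2) by (simp flip: mult.assoc)
      finally have "prob (B N (r * x)) / h x \<le> prob (total x) / h x"
        using elim by (intro divide_right_mono finite_measure_mono) auto
      then show ?case using elim by simp
    qed
  qed
  then show ?thesis ..
qed

lemma exceed_subset_total:
  assumes "0 < x" shows "exceed (A \<times> {1}) x \<subseteq> total x"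
proof
  fix \<omega> assume "\<omega> \<in> exceed (A \<times> {1}) x"
  then obtain i where i: "\<omega> \<in> space M" "i \<in> A" "x < Y i \<omega>" unfolding exceed_def by auto
  then have "Y i \<omega> \<le> (\<Sum>i\<in>A. Y i \<omega>)" using finA nonneg by (intro member_le_sum) auto
  then show "\<omega> \<in> total x" using i unfolding total_def by auto
qed

text \<open>
  Two given coordinates exceed the level \<open>x\<close> together.
\<close>
definition pair :: "'i \<Rightarrow> 'i \<Rightarrow> real \<Rightarrow> 'a set" where
  "pair i j x = {\<omega> \<in> space M. x < Y i \<omega> \<and> x < Y j \<omega>}"

lemma pair_events [measurable]: "i \<in> A \<Longrightarrow> j \<in> A \<Longrightarrow> pair i j x \<in> events"
  unfolding pair_def by measurable

text \<open>
  If no two coordinates are large together, a large sum is caused by a single large coordinate,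
  up to a relative error of \<open>card A / N\<close>.
\<close>
lemma total_le_if_pairs_negligible:
  assumes L: "has_tail total L" and b: "has_tail (exceed (A \<times> {1})) b"
    and pairs: "\<And>i j. i \<in> A \<Longrightarrow> j \<in> A \<Longrightarrow> i \<noteq> j \<Longrightarrow> has_tail (pair i j) 0"
  shows "L \<le> b"
proof -
  define n where "n = card A"
  have exK: "exceed (A \<times> {1}) x \<in> events" for x using finA by (intro exceed_events) auto
  define D where "D = {(i, j). i \<in> A \<and> j \<in> A \<and> i \<noteq> j}"
  have finD: "finite D" unfolding D_def using finA by (auto intro: finite_subset[of _ "A \<times> A"])
  have le: "L \<le> (1 - real n / real N) powr (- \<kappa>) * b" if N: "n < N" for N
  proof -
    let ?r = "1 - real n / real N"
    have N0: "0 < N" and r: "0 < ?r" using N by (auto simp: field_simps)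
    have sub: "total x \<subseteq> exceed (A \<times> {1}) (?r * x) \<union> (\<Union>(i, j)\<in>D. pair i j (1 / N * x))"
      if x: "0 < x" for x
    proof
      fix \<omega> assume "\<omega> \<in> total x"
      then have w: "\<omega> \<in> space M" and s: "x \<le> (\<Sum>i\<in>A. Y i \<omega>)" unfolding total_def by auto
      show "\<omega> \<in> exceed (A \<times> {1}) (?r * x) \<union> (\<Union>(i, j)\<in>D. pair i j (1 / N * x))"
      proof (rule ccontr)
        assume "\<not> ?thesis"
        then have not_in: "\<omega> \<notin> exceed (A \<times> {1}) (?r * x)" "\<And>e. e \<in> D \<Longrightarrow> \<omega> \<notin> pair (fst e) (snd e) (1 / N * x)"
          by (auto simp: case_prod_beta)
        have 1: "Y i \<omega> \<le> ?r * x" if "i \<in> A" for i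
          using not_in(1) w that unfolding exceed_def by (auto simp: not_less)
        have 2: "Y i \<omega> \<le> x / N \<or> Y j \<omega> \<le> x / N" if "i \<in> A" "j \<in> A" "i \<noteq> j" for i j
          using not_in(2)[of "(i, j)"] w that unfolding D_def pair_def by (auto simp: not_less)
        obtain i where i: "i \<in> A" "\<And>j. j \<in> A \<Longrightarrow> j \<noteq> i \<Longrightarrow> Y j \<omega> \<le> x / N"
        proof (cases "\<exists>i\<in>A. x / N < Y i \<omega>")
          case True
          then show ?thesis using 2 that by (meson not_less)
        next
          case False
          moreover have "A \<noteq> {}" using s x by auto
          ultimately show ?thesis using that by (meson ex_in_conv not_less)
        qed
        have "(\<Sum>i\<in>A. Y i \<omega>) = Y i \<omega> + (\<Sum>j\<in>A - {i}. Y j \<omega>)"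
          using i finA by (simp add: sum.remove)
        also have "\<dots> \<le> ?r * x + real (card (A - {i})) * (x / N)"
          using i 1 by (intro add_mono sum_bounded_above) auto
        also have "\<dots> = ?r * x + (real n - 1) * (x / N)"
        proof -
          have "0 < card A" using i finA card_gt_0_iff by blast
          then show ?thesis using i unfolding n_def by (simp add: of_nat_diff)
        qed
        also have "\<dots> < x" using x N0 by (simp add: field_simps)
        finally show False using s by simp
      qed
    qed
    have 1: "has_tail (\<lambda>x. exceed (A \<times> {1}) (?r * x)) (?r powr (- \<kappa>) * b)"
      by (rule has_tail_scale[OF b r])
    have 2: "has_tail (\<lambda>x. pair i j (1 / N * x)) 0" if "(i, j) \<in> D" for i j
      using has_tail_scale[OF pairs, of i j "1 / N"] that N0 unfolding D_def by auto
    have lim: "((\<lambda>x. prob (exceed (A \<times> {1}) (?r * x)) / h x +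
        (\<Sum>e\<in>D. prob (pair (fst e) (snd e) (1 / N * x)) / h x)) \<longlongrightarrow> ?r powr (- \<kappa>) * b + (\<Sum>e\<in>D. 0)) at_top"
      by (intro tendsto_add tendsto_sum 1[unfolded has_tail_def] 2[unfolded has_tail_def]) auto
    have "eventually (\<lambda>x. prob (total x) / h x \<le> prob (exceed (A \<times> {1}) (?r * x)) / h x +
        (\<Sum>e\<in>D. prob (pair (fst e) (snd e) (1 / N * x)) / h x)) at_top"
      using hpos eventually_gt_at_top[of 0]
    proof eventually_elim
      case (elim x)
      have ev: "pair (fst e) (snd e) (1 / N * x) \<in> events" if "e \<in> D" for e
        using that unfolding D_def by (auto intro: pair_events)
      have "prob (total x) \<le> prob (exceed (A \<times> {1}) (?r * x) \<union> (\<Union>e\<in>D. pair (fst e) (snd e) (1 / N * x)))"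
        using sub[of x] elim exK finD ev
        by (intro finite_measure_mono sets.Un sets.finite_UN) (auto simp: case_prod_beta)
      also have "\<dots> \<le> prob (exceed (A \<times> {1}) (?r * x)) + prob (\<Union>e\<in>D. pair (fst e) (snd e) (1 / N * x))"
        using exK finD ev by (intro measure_Un_le sets.finite_UN)
      also have "prob (\<Union>e\<in>D. pair (fst e) (snd e) (1 / N * x)) \<le> (\<Sum>e\<in>D. prob (pair (fst e) (snd e) (1 / N * x)))"
        using finD ev by (intro measure_UNION_le) auto
      finally have "prob (total x) / h x \<le> (prob (exceed (A \<times> {1}) (?r * x)) +
         (\<Sum>e\<in>D. prob (pair (fst e) (snd e) (1 / N * x)))) / h x"
        using elim by (intro divide_right_mono) auto
      then show ?case by (simp add: add_divide_distrib sum_divide_distrib)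
    qed
    then show ?thesis
      using tendsto_le[OF trivial_limit_at_top_linorder lim L[unfolded has_tail_def]] by simp
  qed
  have "((\<lambda>N. (1 - real n / real N) powr (- \<kappa>) * b) \<longlonglongrightarrow> 1 * b)"
    by (intro tendsto_mult shrink_tendsto tendsto_const)
  moreover have "eventually (\<lambda>N. L \<le> (1 - real n / real N) powr (- \<kappa>) * b) sequentially"
    using eventually_gt_at_top[of n] by eventually_elim (rule le)
  ultimately show ?thesis using tendsto_lowerbound[OF _ _ sequentially_bot] by fastforce
qed

text \<open>
  For \<open>k \<ge> 1\<close> let \<open>H k\<close> be the limit for the event that some coordinate exceeds \<open>x\<close> while both
  \<open>i\<close> and \<open>j\<close> exceed \<open>x / k\<close>. Applying this event at level \<open>k x / (k + 1)\<close> forces the sum to exceed \<open>x\<close>,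
  since one of \<open>i, j\<close> differs from the large coordinate and contributes \<open>x / (k + 1)\<close> on top. So if
  the sum had no more mass than the maximum, then \<open>H (k + 1) \<ge> ((k + 1) / k) powr \<kappa> * H k\<close> for all \<open>k\<close>;
  then \<open>H k\<close> would grow like \<open>k powr \<kappa>\<close>, although it is bounded by \<open>b\<close>.
\<close>
lemma total_gt_if_pair_not_negligible:
  assumes L: "has_tail total L" and b: "has_tail (exceed (A \<times> {1})) b"
    and ij: "i \<in> A" "j \<in> A" "i \<noteq> j" and q: "has_tail (pair i j) q" "0 < q"
  shows "b < L"
proof (rule ccontr)
  assume "\<not> b < L"
  then have Lb: "L \<le> b" by simp
  define E where "E k x = {\<omega> \<in> space M. (\<exists>l\<in>A. x < Y l \<omega>) \<and> x / real k < Y i \<omega> \<and> x / real k < Y j \<omega>}"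
    for k :: nat and x
  have exK: "exceed (A \<times> {1}) x \<in> events" for x using finA by (intro exceed_events) auto
  have "(\<exists>a. has_tail (E k) a) \<and> (\<forall>x. E k x \<in> events)" if "0 < k" for k
  proof -
    let ?G = "A \<times> {1} \<union> {(i, 1 / real k), (j, 1 / real k)}"
    let ?Q = "\<lambda>H. (\<exists>l\<in>A. (l, 1) \<in> H) \<and> (i, 1 / real k) \<in> H \<and> (j, 1 / real k) \<in> H"
    have eq: "E k = (\<lambda>x. {\<omega> \<in> space M. ?Q (exceed_pattern ?G x \<omega>)})"
      unfolding E_def exceed_pattern_def by auto
    have G: "finite ?G" "?G \<subseteq> A \<times> {0<..}" using finA ij that by auto
    have "\<not> ?Q {}" by simp
    from pattern_has_tail[OF G, of ?Q, OF this] show ?thesis unfolding eq by blast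
  qed
  then have "\<forall>k\<in>{0<..}. \<exists>a. has_tail (E k) a" and Eev: "\<And>k x. 0 < k \<Longrightarrow> E k x \<in> events" by auto
  from bchoice[OF this(1)] obtain H where H: "\<And>k. 0 < k \<Longrightarrow> has_tail (E k) (H k)" by auto
  have Hb: "H k \<le> b" if "0 < k" for k
    using H[OF that] b by (rule has_tail_mono[OF _ _ _ exK]) (auto simp: E_def exceed_def)
  have q1: "q \<le> H 1"
    using q(1) H[of 1] by (rule has_tail_mono[OF _ _ _ Eev]) (use ij in \<open>auto simp: E_def pair_def\<close>)
  have step: "((k + 1) / k) powr \<kappa> * H k \<le> H (k + 1)" if k: "0 < k" for k :: nat
  proof -
    define r where "r = real k / (real k + 1)"
    have r: "0 < r" "r / real k = 1 / (real k + 1)" "r < 1" using k unfolding r_def by auto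
    have rp: "r powr (- \<kappa>) = ((k + 1) / k) powr \<kappa>"
      using k unfolding r_def by (simp add: powr_divide powr_minus field_simps)
    have 1: "has_tail (\<lambda>x. E k (r * x)) (r powr (- \<kappa>) * H k)"
      by (rule has_tail_scale[OF H[OF k] r(1)])
    have Er: "E k (r * x) = {\<omega> \<in> space M. (\<exists>l\<in>A. r * x < Y l \<omega>) \<and>
        x / (real k + 1) < Y i \<omega> \<and> x / (real k + 1) < Y j \<omega>}" for x
      unfolding E_def using k by (simp add: r_def)
    \<comment> \<open>mass that the sum gains over the maximum at this step\<close>
    define D where "D x = (if 0 < x then E k (r * x) - E (k + 1) x else {})" for x
    have sub: "E (k + 1) x \<subseteq> E k (r * x)" if "0 < x" for x
    proof -
      have "r * x \<le> x" using r that by simp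
      then show ?thesis unfolding Er by (auto simp: E_def add.commute intro: le_less_trans)
    qed
    have Dev: "D x \<in> events" for x using Eev k by (auto simp: D_def)
    have D: "has_tail D (r powr (- \<kappa>) * H k - H (k + 1))"
      unfolding has_tail_def
    proof (rule Lim_transform_eventually)
      show "((\<lambda>x. prob (E k (r * x)) / h x - prob (E (k + 1) x) / h x)
         \<longlongrightarrow> r powr (- \<kappa>) * H k - H (k + 1)) at_top"
        using 1 H[of "k + 1"] unfolding has_tail_def by (intro tendsto_diff) auto
      show "eventually (\<lambda>x. prob (E k (r * x)) / h x - prob (E (k + 1) x) / h x = prob (D x) / h x) at_top"
        using eventually_gt_at_top[of 0]
      proof eventually_elim
        case (elim x)
        then have "prob (D x) = prob (E k (r * x)) - prob (E (k + 1) x)"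
          unfolding D_def using sub Eev k by (simp add: finite_measure_Diff)
        then show ?case by (simp add: diff_divide_distrib)
      qed
    qed
    have dis: "exceed (A \<times> {1}) x \<inter> D x = {}" for x
      unfolding D_def Er by (auto simp: exceed_def E_def add.commute)
    have 2: "has_tail (\<lambda>x. exceed (A \<times> {1}) x \<union> D x) (b + (r powr (- \<kappa>) * H k - H (k + 1)))"
      using tendsto_add[OF b[unfolded has_tail_def] D[unfolded has_tail_def]] dis exK Dev
      by (simp add: has_tail_def finite_measure_Union add_divide_distrib)
    have "b + (r powr (- \<kappa>) * H k - H (k + 1)) \<le> L"
      using 2 L
    proof (rule has_tail_mono)
      fix x :: real assume x: "0 < x"
      have "E k (r * x) \<subseteq> total x"
      proof
        fix \<omega> assume "\<omega> \<in> E k (r * x)"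
        then obtain l where w: "\<omega> \<in> space M" and l: "l \<in> A" "r * x < Y l \<omega>" and
          y: "x / (real k + 1) < Y i \<omega>" "x / (real k + 1) < Y j \<omega>" unfolding Er by auto
        define m where "m = (if i = l then j else i)"
        have m: "m \<in> A" "m \<noteq> l" "x / (real k + 1) < Y m \<omega>" using ij y unfolding m_def by auto
        have "r + 1 / (real k + 1) = 1" unfolding r_def by (simp flip: add_divide_distrib)
        then have "x = (r + 1 / (real k + 1)) * x" by simp
        also have "\<dots> = r * x + x / (real k + 1)" by (simp add: distrib_right)
        also have "\<dots> < (\<Sum>a\<in>{l, m}. Y a \<omega>)" using l m by auto
        also have "\<dots> \<le> (\<Sum>a\<in>A. Y a \<omega>)" using l m finA w nonneg by (intro sum_mono2) auto
        finally show "\<omega> \<in> total x" unfolding total_def using w by auto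
      qed
      then show "exceed (A \<times> {1}) x \<union> D x \<subseteq> total x"
        using exceed_subset_total[OF x] x unfolding D_def by auto
    qed measurable
    then show ?thesis using Lb rp by simp
  qed
  have "real (Suc k) powr \<kappa> * q \<le> H (Suc k)" for k
  proof (induction k)
    case 0
    then show ?case using q1 by simp
  next
    case (Suc k)
    have "real (Suc (Suc k)) powr \<kappa> * q = ((Suc k + 1) / Suc k) powr \<kappa> * (real (Suc k) powr \<kappa> * q)"
      by (simp add: powr_divide)
    also have "\<dots> \<le> ((Suc k + 1) / Suc k) powr \<kappa> * H (Suc k)"
      by (intro mult_left_mono Suc.IH) simp
    also have "\<dots> \<le> H (Suc (Suc k))" using step[of "Suc k"] by simp
    finally show ?case .
  qed
  then have bound: "real (Suc k) powr \<kappa> * q \<le> b" for k using Hb[of "Suc k"] by (meson order_trans zero_less_Suc)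
  have "filterlim (\<lambda>x::real. x powr \<kappa>) at_top at_top" using kpos by real_asymp
  then have "filterlim (\<lambda>k. real (Suc k) powr \<kappa>) at_top sequentially"
    by (rule filterlim_compose) (rule filterlim_compose[OF filterlim_real_sequentially filterlim_Suc])
  then have "eventually (\<lambda>k. b / q < real (Suc k) powr \<kappa>) sequentially"
    by (simp add: filterlim_at_top_dense)
  then obtain k where "b / q < real (Suc k) powr \<kappa>"
    using eventually_happens'[OF sequentially_bot] by blast
  then show False using bound[of k] q(2) by (simp add: field_simps)
qed

end


section \<open>Quantiles and regular variation\<close>

text \<open>
  A limit obtained from families of lower and upper bounds whose own limits close up as the
  parameter tends to 0.
\<close>
lemma tendsto_between:
  fixes f :: "'b \<Rightarrow> real" and D :: real
  assumes "0 < D" "\<And>d. 0 < d \<Longrightarrow> d < D \<Longrightarrow> \<exists>l u. (l \<longlongrightarrow> p d) \<F> \<and> (u \<longlongrightarrow> q d) \<F> \<and>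
      eventually (\<lambda>x. l x \<le> f x \<and> f x \<le> u x) \<F>"
    and "(p \<longlongrightarrow> a) (at_right 0)" "(q \<longlongrightarrow> a) (at_right 0)"
  shows "(f \<longlongrightarrow> a) \<F>"
proof (rule order_tendstoI)
  have D: "eventually (\<lambda>d. 0 < d \<and> d < D) (at_right 0)"
    unfolding eventually_at_right_field using assms(1) by (intro exI[of _ D]) auto
  fix y
  {
    assume "y < a"
    then have "eventually (\<lambda>d. y < p d) (at_right 0)" using order_tendstoD(1)[OF assms(3)] by simp
    then have "eventually (\<lambda>d. y < p d \<and> 0 < d \<and> d < D) (at_right 0)" using D by eventually_elim auto
    then obtain d where d: "0 < d" "d < D" "y < p d" using eventually_happens'[OF trivial_limit_at_right_real] by blast
    then obtain l u where l: "(l \<longlongrightarrow> p d) \<F>" "eventually (\<lambda>x. l x \<le> f x \<and> f x \<le> u x) \<F>" using assms(2) by blast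
    have "eventually (\<lambda>x. y < l x) \<F>" using l(1) d(3) by (rule order_tendstoD)
    then show "eventually (\<lambda>x. y < f x) \<F>" using l(2) by eventually_elim auto
  }
  {
    assume "a < y"
    then have "eventually (\<lambda>d. q d < y) (at_right 0)" using order_tendstoD(2)[OF assms(4)] by simp
    then have "eventually (\<lambda>d. q d < y \<and> 0 < d \<and> d < D) (at_right 0)" using D by eventually_elim auto
    then obtain d where d: "0 < d" "d < D" "q d < y" using eventually_happens'[OF trivial_limit_at_right_real] by blast
    then obtain l u where l: "(u \<longlongrightarrow> q d) \<F>" "eventually (\<lambda>x. l x \<le> f x \<and> f x \<le> u x) \<F>" using assms(2) by blast
    have "eventually (\<lambda>x. u x < y) \<F>" using l(1) d(3) by (rule order_tendstoD)
    then show "eventually (\<lambda>x. f x < y) \<F>" using l(2) by eventually_elim auto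
  }
qed

lemma is_cdfD:
  assumes "is_cdf F"
  shows "mono F" "0 \<le> F x" "F x \<le> 1" "(F \<longlongrightarrow> 1) at_top" "(F \<longlongrightarrow> 0) at_bot" "continuous (at_right x) F"
proof -
  obtain N where N: "real_distribution N" "F = cdf N" using assms unfolding is_cdf_def by auto
  interpret real_distribution N by fact
  show "mono F" unfolding N(2) by (auto intro!: monoI cdf_nondecreasing)
  show "0 \<le> F x" "F x \<le> 1" "(F \<longlongrightarrow> 1) at_top" "(F \<longlongrightarrow> 0) at_bot" "continuous (at_right x) F"
    unfolding N(2) by (auto simp: cdf_nonneg cdf_bounded_prob cdf_lim_at_top_prob cdf_lim_at_bot cdf_is_right_cont)
qed

text \<open>
  The Galois connection between a distribution function and its quantile function.
\<close>
lemma quantile_le_iff: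
  assumes F: "is_cdf F" and u: "0 < u" "u < 1"
  shows "quantile F u \<le> x \<longleftrightarrow> u \<le> F x"
proof -
  note F' = is_cdfD[OF F]
  define X where "X = {x. u \<le> F x}"
  have ne: "X \<noteq> {}"
    using order_tendstoD(1)[OF F'(4) u(2)] unfolding X_def eventually_at_top_linorder
    by (auto intro: less_imp_le)
  obtain b where b: "\<And>x. x \<le> b \<Longrightarrow> F x < u"
    using order_tendstoD(2)[OF F'(5) u(1)] unfolding eventually_at_bot_linorder by auto
  have bdd: "bdd_below X" unfolding X_def by (rule bdd_belowI[of _ b]) (use b in \<open>meson mem_Collect_eq linorder_not_less nle_le\<close>)
  have q: "quantile F u = Inf X" using u unfolding quantile_def X_def by auto
  have up: "u \<le> F y" if y: "Inf X < y" for y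
  proof -
    obtain z where "z \<in> X" "z < y" using y unfolding cInf_less_iff[OF ne bdd] by blast
    then show ?thesis unfolding X_def using monoD[OF F'(1), of z y] by auto
  qed
  have "u \<le> F (Inf X)"
  proof (rule tendsto_lowerbound)
    show "(F \<longlongrightarrow> F (Inf X)) (at_right (Inf X))" using F'(6) by (simp add: continuous_within)
    show "eventually (\<lambda>y. u \<le> F y) (at_right (Inf X))" using up by (auto simp: eventually_at_right_field intro: exI[of _ "Inf X + 1"])
  qed simp
  then show ?thesis unfolding q
    using monoD[OF F'(1), of "Inf X" x] cInf_lower[OF _ bdd, of x] unfolding X_def by auto
qed

lemma measurable_quantile [measurable]:
  assumes F: "is_cdf F" shows "quantile F \<in> borel_measurable borel"
proof (rule borel_measurable_piecewise_mono[where C = "{{..<0}, {0}, {0<..<1}, {1}, {1<..}}"])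
  fix c :: "real set" assume c: "c \<in> {{..<0}, {0}, {0<..<1}, {1}, {1<..}}"
  then show "c \<in> sets borel" by auto
  have 1: "mono_on {0<..<1} (quantile F)"
  proof (rule mono_onI)
    fix r s :: real assume rs: "r \<in> {0<..<1}" "s \<in> {0<..<1}" "r \<le> s"
    then have "s \<le> F (quantile F s)" using quantile_le_iff[OF F, of s "quantile F s"] by auto
    then show "quantile F r \<le> quantile F s" using quantile_le_iff[OF F, of r "quantile F s"] rs by auto
  qed
  have "{x. u \<le> F x} = UNIV" if "u < 0" for u using is_cdfD(2)[OF F] that by (auto intro: less_imp_le less_le_trans)
  then have 2: "mono_on {..<0} (quantile F)" by (auto simp: mono_on_def quantile_def)
  have "{x. u \<le> F x} = {}" if "1 < u" for u using le_less_trans[OF is_cdfD(3)[OF F] that] by (auto simp: not_le)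
  then have 3: "mono_on {1<..} (quantile F)" by (auto simp: mono_on_def quantile_def)
  show "mono_on c (quantile F)" using c 1 2 3 by (auto simp: mono_on_def)
next
  show "\<Union>{{..<0}, {0}, {0<..<1}, {1}, {1<..}} = (UNIV :: real set)" by auto
qed auto

lemma RV_is_cdf: "F \<in> RV \<gamma> \<Longrightarrow> is_cdf F"
  unfolding RV_def by simp

lemma RV_less_1:
  assumes "F \<in> RV \<gamma>" shows "F x < 1"
proof -
  note F = is_cdfD[OF RV_is_cdf[OF assms]]
  have "((\<lambda>x. (1 - F (x * 1)) / (1 - F x)) \<longlongrightarrow> 1 powr (- \<gamma>)) at_top"
    using assms unfolding RV_def mem_Collect_eq by (meson zero_less_one)
  then have "eventually (\<lambda>x. 0 < (1 - F (x * 1)) / (1 - F x)) at_top"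
    by (rule order_tendstoD) simp
  then obtain y where "0 < (1 - F (y * 1)) / (1 - F y)" "x \<le> y"
    unfolding eventually_at_top_linorder using linear by blast
  then show ?thesis using monoD[OF F(1), of x y] F(3)[of y] by (cases "F y = 1") auto
qed

lemma RV_tail:
  assumes "F \<in> RV \<gamma>" "0 < r"
  shows "((\<lambda>x. (1 - F (r * x)) / (1 - F x)) \<longlongrightarrow> r powr (- \<gamma>)) at_top"
  using assms unfolding RV_def mem_Collect_eq by (simp only: mult.commute[of r])

lemma cdf_tail_0: "is_cdf F \<Longrightarrow> ((\<lambda>x. 1 - F x) \<longlongrightarrow> 0) at_top"
  using tendsto_diff[OF tendsto_const is_cdfD(4), of F 1] by simp

lemma powr_shift_tendsto:
  assumes "0 < (r::real)"
  shows "((\<lambda>d. (r + d) powr p) \<longlongrightarrow> r powr p) (at_right 0)" "((\<lambda>d. (r - d) powr p) \<longlongrightarrow> r powr p) (at_right 0)"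
proof -
  have "((\<lambda>d. (r + d) powr p) \<longlongrightarrow> (r + 0) powr p) (at_right 0)"
    using assms by (intro tendsto_powr tendsto_add tendsto_const tendsto_ident_at) auto
  then show "((\<lambda>d. (r + d) powr p) \<longlongrightarrow> r powr p) (at_right 0)" by simp
  have "((\<lambda>d. (r - d) powr p) \<longlongrightarrow> (r - 0) powr p) (at_right 0)"
    using assms by (intro tendsto_powr tendsto_diff tendsto_const tendsto_ident_at) auto
  then show "((\<lambda>d. (r - d) powr p) \<longlongrightarrow> r powr p) (at_right 0)" by simp
qed

lemma RV_affine_tail:
  assumes F: "F \<in> RV \<gamma>" and r: "0 < r"
  shows "((\<lambda>x. (1 - F (r * x + c)) / (1 - F x)) \<longlongrightarrow> r powr (- \<gamma>)) at_top"
proof (rule tendsto_between[where D = r])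
  note F' = is_cdfD[OF RV_is_cdf[OF F]]
  fix d assume d: "0 < d" "d < r"
  let ?g = "\<lambda>s x. (1 - F (s * x)) / (1 - F x)"
  have "eventually (\<lambda>x. \<bar>c\<bar> / d \<le> x) at_top" by (rule eventually_ge_at_top)
  then have "eventually (\<lambda>x. ?g (r + d) x \<le> (1 - F (r * x + c)) / (1 - F x) \<and>
      (1 - F (r * x + c)) / (1 - F x) \<le> ?g (r - d) x) at_top"
  proof eventually_elim
    case (elim x)
    then have "\<bar>c\<bar> \<le> d * x" using d by (simp add: field_simps)
    then have "r * x + c \<le> (r + d) * x" "(r - d) * x \<le> r * x + c" by (auto simp: algebra_simps)
    then show ?case using monoD[OF F'(1)] RV_less_1[OF F, of x] by (auto intro!: divide_right_mono)
  qed
  then show "\<exists>l u. (l \<longlongrightarrow> (r + d) powr (- \<gamma>)) at_top \<and> (u \<longlongrightarrow> (r - d) powr (- \<gamma>)) at_top \<and>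
     eventually (\<lambda>x. l x \<le> (1 - F (r * x + c)) / (1 - F x) \<and> (1 - F (r * x + c)) / (1 - F x) \<le> u x) at_top"
    using RV_tail[OF F, of "r + d"] RV_tail[OF F, of "r - d"] d r by fastforce
qed (use r powr_shift_tendsto in auto)

lemma RV_shift_tail:
  assumes F: "F \<in> RV \<gamma>" and r: "0 < r"
  shows "((\<lambda>x. (1 - F (r * x + c)) / (1 - F (x + c))) \<longlongrightarrow> r powr (- \<gamma>)) at_top"
proof -
  have "((\<lambda>x. ((1 - F (r * x + c)) / (1 - F x)) / ((1 - F (1 * x + c)) / (1 - F x))) \<longlongrightarrow> r powr (- \<gamma>) / 1 powr (- \<gamma>)) at_top"
    by (intro tendsto_divide RV_affine_tail F r) auto
  moreover have ne: "F x \<noteq> 1" for x using RV_less_1[OF F, of x] by simp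
  then have "((1 - F (r * x + c)) / (1 - F x)) / ((1 - F (1 * x + c)) / (1 - F x)) = (1 - F (r * x + c)) / (1 - F (x + c))" for x
    by simp
  ultimately show ?thesis by (simp only: powr_one_eq_one div_by_1)
qed

text \<open>
  Monotone functions that are positive and regularly varying at 0 from the right, with index \<open>\<beta>\<close>.
\<close>
definition rv_at_0 :: "real \<Rightarrow> (real \<Rightarrow> real) \<Rightarrow> bool" where
  "rv_at_0 \<beta> g \<longleftrightarrow> mono g \<and> (\<forall>t>0. 0 < g t) \<and>
     (\<forall>c>0. ((\<lambda>t. g (c * t) / g t) \<longlongrightarrow> c powr \<beta>) (at_right 0))"

lemma rv_at_0_ratio:
  assumes g: "rv_at_0 \<beta> g" and r: "0 < r"
    and ab: "((\<lambda>x. a x / b x) \<longlongrightarrow> r) \<F>" and b: "filterlim b (at_right 0) \<F>"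
  shows "((\<lambda>x. g (a x) / g (b x)) \<longlongrightarrow> r powr \<beta>) \<F>"
proof (rule tendsto_between[where D = r])
  fix d assume d: "0 < d" "d < r"
  have g': "mono g" "\<And>t. 0 < t \<Longrightarrow> 0 < g t" using g unfolding rv_at_0_def by auto
  have lim: "((\<lambda>x. g (c * b x) / g (b x)) \<longlongrightarrow> c powr \<beta>) \<F>" if "0 < c" for c
    using filterlim_compose[OF _ b, of "\<lambda>t. g (c * t) / g t"] g that unfolding rv_at_0_def by blast
  have "eventually (\<lambda>x. 0 < b x) \<F>"
    using b by (simp add: filterlim_at eventually_conj_iff)
  moreover have "eventually (\<lambda>x. r - d < a x / b x) \<F>" "eventually (\<lambda>x. a x / b x < r + d) \<F>"
    using order_tendstoD[OF ab] d by auto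
  ultimately have "eventually (\<lambda>x. g ((r - d) * b x) / g (b x) \<le> g (a x) / g (b x) \<and>
      g (a x) / g (b x) \<le> g ((r + d) * b x) / g (b x)) \<F>"
  proof eventually_elim
    case (elim x)
    then have "(r - d) * b x \<le> a x" "a x \<le> (r + d) * b x" by (auto simp: field_simps)
    then show ?case using elim g'(2)[of "b x"] monoD[OF g'(1)] by (auto intro!: divide_right_mono)
  qed
  then show "\<exists>l u. (l \<longlongrightarrow> (r - d) powr \<beta>) \<F> \<and> (u \<longlongrightarrow> (r + d) powr \<beta>) \<F> \<and>
      eventually (\<lambda>x. l x \<le> g (a x) / g (b x) \<and> g (a x) / g (b x) \<le> u x) \<F>"
    using lim[of "r - d"] lim[of "r + d"] d r by fastforce
qed (use r powr_shift_tendsto in auto)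

text \<open>
  If \<open>g\<close> composed with the tail of \<open>F \<in> RV 1\<close> is regularly varying at infinity with index \<open>-\<beta>\<close>, then
  \<open>g\<close> is regularly varying at 0 with index \<open>\<beta>\<close>: the quantile \<open>x t\<close> of order \<open>1 - t\<close> inverts the tail
  asymptotically, even where \<open>F\<close> jumps.
\<close>
lemma rv_at_0_from_tail:
  assumes g: "mono g" and F: "F \<in> RV 1"
    and k: "\<And>r. 0 < r \<Longrightarrow> ((\<lambda>x. g (1 - F (r * x)) / g (1 - F x)) \<longlongrightarrow> r powr (- \<beta>)) at_top"
    and g0: "\<And>t. 0 < t \<Longrightarrow> 0 < g t"
  shows "rv_at_0 \<beta> g"
proof -
  note cF = RV_is_cdf[OF F] and F' = is_cdfD[OF RV_is_cdf[OF F]]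
  define x where "x t = quantile F (1 - t)" for t
  have xle: "x t \<le> y \<longleftrightarrow> 1 - F y \<le> t" if "0 < t" "t < 1" for t y
    unfolding x_def using quantile_le_iff[OF cF, of "1 - t" y] that by auto
  have ev01: "eventually (\<lambda>t::real. 0 < t \<and> t < 1) (at_right 0)"
    by (auto simp: eventually_at_right_field intro: exI[of _ 1])
  have xtop: "filterlim x at_top (at_right 0)"
    unfolding filterlim_at_top
  proof
    fix Z
    have "0 < 1 - F Z" using RV_less_1[OF F, of Z] by simp
    then have "eventually (\<lambda>t. t < 1 - F Z) (at_right 0)"
      unfolding eventually_at_right_field by (intro exI[of _ "1 - F Z"]) auto
    then show "eventually (\<lambda>t. Z \<le> x t) (at_right 0)" using ev01
      by eventually_elim (use xle in \<open>meson linorder_not_less nle_le\<close>)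
  qed
  have x0: "eventually (\<lambda>t. 0 < x t) (at_right 0)"
    using xtop by (simp add: filterlim_at_top_dense)
  have Fx: "((\<lambda>t. (1 - F (r * x t)) / (1 - F (x t))) \<longlongrightarrow> r powr (- 1)) (at_right 0)" if "0 < r" for r
    using filterlim_compose[OF RV_tail[OF F that] xtop] .
  \<comment> \<open>\<open>t\<close> lies between the tail of \<open>F\<close> at \<open>x t\<close> and at any smaller multiple of \<open>x t\<close>\<close>
  have t1: "((\<lambda>t. t / (1 - F (x t))) \<longlongrightarrow> 1) (at_right 0)"
  proof (rule tendsto_between[where D = 1])
    fix d :: real assume d: "0 < d" "d < 1"
    have "((\<lambda>t. (1 - F (1 / (1 + d) * x t)) / (1 - F (x t))) \<longlongrightarrow> (1 / (1 + d)) powr (- 1)) (at_right 0)"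
      using d by (intro Fx) auto
    moreover have "(1 / (1 + d)) powr (- 1) = 1 + d" using d by (simp add: powr_minus_divide)
    moreover have "eventually (\<lambda>t. 1 \<le> t / (1 - F (x t)) \<and>
        t / (1 - F (x t)) \<le> (1 - F (1 / (1 + d) * x t)) / (1 - F (x t))) (at_right 0)"
      using x0 ev01
    proof eventually_elim
      case (elim t)
      have "1 / (1 + d) * x t < x t" using d elim by (simp add: field_simps)
      then have "t < 1 - F (1 / (1 + d) * x t)" using xle[of t "1 / (1 + d) * x t"] elim by auto
      moreover have "1 - F (x t) \<le> t" using xle[of t "x t"] elim by auto
      ultimately show ?case using RV_less_1[OF F, of "x t"] by (auto simp: divide_simps)
    qed
    ultimately show "\<exists>l u. (l \<longlongrightarrow> 1) (at_right 0) \<and> (u \<longlongrightarrow> 1 + d) (at_right 0) \<and>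
       eventually (\<lambda>t. l t \<le> t / (1 - F (x t)) \<and> t / (1 - F (x t)) \<le> u t) (at_right 0)"
      by (intro exI[of _ "\<lambda>_. 1"] exI[of _ "\<lambda>t. (1 - F (1 / (1 + d) * x t)) / (1 - F (x t))"]) auto
  next
    have "((\<lambda>d::real. 1 + d) \<longlongrightarrow> 1 + 0) (at_right 0)" by (intro tendsto_intros)
    then show "((\<lambda>d::real. 1 + d) \<longlongrightarrow> 1) (at_right 0)" by simp
  qed auto
  \<comment> \<open>\<open>c * t\<close> lies eventually between the tail values at \<open>x t / (c - d)\<close> and \<open>x t / (c + d)\<close>\<close>
  have key: "((\<lambda>t. g (c * t) / g (1 - F (x t))) \<longlongrightarrow> c powr \<beta>) (at_right 0)" if c: "0 < c" for c
  proof (rule tendsto_between[where D = c])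
    fix d assume d: "0 < d" "d < c"
    have ct: "((\<lambda>t. c * (t / (1 - F (x t)))) \<longlongrightarrow> c * 1) (at_right 0)" by (intro tendsto_intros t1)
    have lim: "((\<lambda>t. (1 - F (1 / s * x t)) / (1 - F (x t))) \<longlongrightarrow> s) (at_right 0)" if "0 < s" for s
      using Fx[of "1 / s"] that by (simp add: powr_minus_divide)
    have klim: "((\<lambda>t. g (1 - F (1 / s * x t)) / g (1 - F (x t))) \<longlongrightarrow> s powr \<beta>) (at_right 0)" if "0 < s" for s
      using filterlim_compose[OF k[of "1 / s"] xtop] that by (simp add: powr_minus_divide powr_divide)
    have "((\<lambda>t. c * (t / (1 - F (x t))) - (1 - F (1 / (c - d) * x t)) / (1 - F (x t))) \<longlongrightarrow> c * 1 - (c - d)) (at_right 0)"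
      using d by (intro tendsto_diff ct lim) auto
    then have 1: "eventually (\<lambda>t. 0 < c * (t / (1 - F (x t))) - (1 - F (1 / (c - d) * x t)) / (1 - F (x t))) (at_right 0)"
      by (rule order_tendstoD) (use d in auto)
    have "((\<lambda>t. c * (t / (1 - F (x t))) - (1 - F (1 / (c + d) * x t)) / (1 - F (x t))) \<longlongrightarrow> c * 1 - (c + d)) (at_right 0)"
      using d c by (intro tendsto_diff ct lim) auto
    then have 2: "eventually (\<lambda>t. c * (t / (1 - F (x t))) - (1 - F (1 / (c + d) * x t)) / (1 - F (x t)) < 0) (at_right 0)"
      by (rule order_tendstoD) (use d in auto)
    have "eventually (\<lambda>t. g (1 - F (1 / (c - d) * x t)) / g (1 - F (x t)) \<le> g (c * t) / g (1 - F (x t)) \<and>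
        g (c * t) / g (1 - F (x t)) \<le> g (1 - F (1 / (c + d) * x t)) / g (1 - F (x t))) (at_right 0)"
      using 1 2
    proof eventually_elim
      case (elim t)
      have p: "0 < 1 - F (x t)" using RV_less_1[OF F, of "x t"] by simp
      then have "1 - F (1 / (c - d) * x t) \<le> c * t" "c * t \<le> 1 - F (1 / (c + d) * x t)"
        using elim by (simp_all add: less_divide_eq divide_less_eq flip: diff_divide_distrib)
      then show ?case using monoD[OF g] g0[OF p] by (auto intro!: divide_right_mono)
    qed
    then show "\<exists>l u. (l \<longlongrightarrow> (c - d) powr \<beta>) (at_right 0) \<and> (u \<longlongrightarrow> (c + d) powr \<beta>) (at_right 0) \<and>
       eventually (\<lambda>t. l t \<le> g (c * t) / g (1 - F (x t)) \<and> g (c * t) / g (1 - F (x t)) \<le> u t) (at_right 0)"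
      using klim[of "c - d"] klim[of "c + d"] d c by fastforce
  qed (use c powr_shift_tendsto in auto)
  have "((\<lambda>t. g (c * t) / g t) \<longlongrightarrow> c powr \<beta>) (at_right 0)" if c: "0 < c" for c
  proof -
    have "((\<lambda>t. (g (c * t) / g (1 - F (x t))) / (g (1 * t) / g (1 - F (x t)))) \<longlongrightarrow> c powr \<beta> / 1 powr \<beta>) (at_right 0)"
      using c by (intro tendsto_divide key) auto
    moreover have "g (1 - F (x t)) \<noteq> 0" for t using g0[of "1 - F (x t)"] RV_less_1[OF F, of "x t"] by auto
    ultimately show ?thesis by simp
  qed
  then show ?thesis unfolding rv_at_0_def using g g0 by auto
qed


section \<open>Tail dependence of copulas\<close>

text \<open>
  The vector \<open>v\<close> with all coordinates outside \<open>J\<close> set to 0. For the tail dependence function of a copula,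
  this means that only the coordinates in \<open>J\<close> are taken into account.
\<close>
definition on_coords :: "'i set \<Rightarrow> ('i \<Rightarrow> real) \<Rightarrow> 'i \<Rightarrow> real" where
  "on_coords J v = (\<lambda>i. if i \<in> J then v i else 0)"

text \<open>
  A copula together with a measure on the function space that realises it.
\<close>
locale copula_space = prob_space N for N :: "('i \<Rightarrow> real) measure" +
  fixes I :: "'i set" and C :: "('i \<Rightarrow> real) \<Rightarrow> real"
  assumes finI: "finite I"
    and sets_N: "sets N = sets (Pi\<^sub>M I (\<lambda>_. borel))"
    and margin: "\<And>i. i \<in> I \<Longrightarrow> distr N borel (\<lambda>x. x i) = uniform_measure lborel {0..1}"
    and C_eq: "\<And>u. u \<in> unit_cube I \<Longrightarrow> C u = prob {x \<in> space N. \<forall>i\<in>I. x i \<le> u i}"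
begin

text \<open>
  The dependence function \<open>D\<close> of a copula: the probability that some coordinate \<open>i\<close> exceeds \<open>1 - u i\<close>.
\<close>
definition D :: "('i \<Rightarrow> real) \<Rightarrow> real" where
  "D u = 1 - C (\<lambda>i. 1 - u i)"

text \<open>
  The upper tail event of a single coordinate.
\<close>
definition W :: "'i \<Rightarrow> real \<Rightarrow> ('i \<Rightarrow> real) set" where
  "W i a = {x \<in> space N. 1 - a < x i}"

lemma coord_measurable [measurable]: "i \<in> I \<Longrightarrow> (\<lambda>x. x i) \<in> borel_measurable N"
  unfolding measurable_cong_sets[OF sets_N refl] by (rule measurable_component_singleton)

lemma W_events [measurable]: "i \<in> I \<Longrightarrow> W i a \<in> events"
  unfolding W_def by measurable

lemma prob_W:
  assumes "i \<in> I" "0 \<le> a" "a \<le> 1" shows "prob (W i a) = a"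
proof -
  have "prob (W i a) = measure (distr N borel (\<lambda>x. x i)) {1 - a<..}"
    using assms by (subst measure_distr) (auto simp: W_def intro!: arg_cong[of _ _ prob])
  also have "\<dots> = measure lborel ({0..1} \<inter> {1 - a<..})"
    unfolding margin[OF assms(1)] by simp
  also have "{0..1} \<inter> {1 - a<..} = {1 - a<..1}" using assms by auto
  finally show ?thesis using assms by simp
qed

lemma W_mono: "a \<le> b \<Longrightarrow> W i a \<subseteq> W i b"
  unfolding W_def by auto

lemma D_eq:
  assumes "J \<subseteq> I" "\<And>i. i \<in> J \<Longrightarrow> 0 \<le> u i" "\<And>i. i \<in> J \<Longrightarrow> u i \<le> 1"
  shows "D (on_coords J u) = prob (\<Union>i\<in>J. W i (u i))"
proof -
  let ?u = "on_coords J u"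
  have finJ: "finite J" using assms(1) finI finite_subset by blast
  have cube: "(\<lambda>i. 1 - ?u i) \<in> unit_cube I" using assms unfolding unit_cube_def on_coords_def by auto
  have ev: "{x \<in> space N. \<forall>i\<in>I. x i \<le> 1 - ?u i} \<in> events"
    using finI by (intro sets.sets_Collect_finite_All) measurable
  have "D ?u = prob (space N - {x \<in> space N. \<forall>i\<in>I. x i \<le> 1 - ?u i})"
    unfolding D_def C_eq[OF cube] using ev by (simp add: prob_compl)
  also have "space N - {x \<in> space N. \<forall>i\<in>I. x i \<le> 1 - ?u i} = (\<Union>i\<in>J. W i (u i)) \<union> (\<Union>i\<in>I - J. W i 0)"
    using assms(1) unfolding W_def on_coords_def by (auto simp: not_le split: if_splits)
  also have "prob \<dots> = prob (\<Union>i\<in>J. W i (u i))"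
  proof (rule antisym)
    have 0: "prob (\<Union>i\<in>I - J. W i 0) \<le> (\<Sum>i\<in>I - J. prob (W i 0))"
      using finI by (intro measure_UNION_le) auto
    also have "\<dots> = 0" using prob_W[of _ 0] by simp
    finally have "prob (\<Union>i\<in>I - J. W i 0) \<le> 0" .
    moreover have "prob ((\<Union>i\<in>J. W i (u i)) \<union> (\<Union>i\<in>I - J. W i 0)) \<le> prob (\<Union>i\<in>J. W i (u i)) + prob (\<Union>i\<in>I - J. W i 0)"
      using finI finJ assms(1) by (intro measure_Un_le sets.finite_UN) auto
    ultimately show "prob ((\<Union>i\<in>J. W i (u i)) \<union> (\<Union>i\<in>I - J. W i 0)) \<le> prob (\<Union>i\<in>J. W i (u i))" by simp
    show "prob (\<Union>i\<in>J. W i (u i)) \<le> prob ((\<Union>i\<in>J. W i (u i)) \<union> (\<Union>i\<in>I - J. W i 0))"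
      using finI finJ assms(1) by (intro finite_measure_mono sets.Un sets.finite_UN) auto
  qed
  finally show ?thesis .
qed

lemma C_cong:
  assumes "u \<in> unit_cube I" "\<And>i. i \<in> I \<Longrightarrow> u i = v i" shows "C u = C v"
proof -
  have "v \<in> unit_cube I" using assms unfolding unit_cube_def by auto
  then show ?thesis using assms by (simp add: C_eq)
qed

lemma D_cong:
  assumes "\<And>i. i \<in> I \<Longrightarrow> 0 \<le> u i" "\<And>i. i \<in> I \<Longrightarrow> u i \<le> 1" "\<And>i. i \<in> I \<Longrightarrow> u i = v i" shows "D u = D v"
proof -
  have "(\<lambda>i. 1 - u i) \<in> unit_cube I" using assms(1,2) by (auto simp: unit_cube_def)
  then have "C (\<lambda>i. 1 - u i) = C (\<lambda>i. 1 - v i)" by (rule C_cong) (use assms(3) in simp)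
  then show ?thesis unfolding D_def by simp
qed

lemma D_eq_full:
  assumes "\<And>i. i \<in> I \<Longrightarrow> 0 \<le> u i" "\<And>i. i \<in> I \<Longrightarrow> u i \<le> 1"
  shows "D u = prob (\<Union>i\<in>I. W i (u i))"
proof -
  have "D u = D (on_coords I u)" using assms by (rule D_cong) (simp_all add: on_coords_def)
  also have "\<dots> = prob (\<Union>i\<in>I. W i (u i))" using assms by (intro D_eq) auto
  finally show ?thesis .
qed

lemma D_diff_le:
  assumes "\<And>i. i \<in> I \<Longrightarrow> 0 \<le> u i" "\<And>i. i \<in> I \<Longrightarrow> u i \<le> 1" "\<And>i. i \<in> I \<Longrightarrow> 0 \<le> v i" "\<And>i. i \<in> I \<Longrightarrow> v i \<le> 1"
  shows "\<bar>D u - D v\<bar> \<le> (\<Sum>i\<in>I. \<bar>u i - v i\<bar>)"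
proof -
  have *: "D u - D v \<le> (\<Sum>i\<in>I. \<bar>u i - v i\<bar>)"
    if uv: "\<And>i. i \<in> I \<Longrightarrow> 0 \<le> u i" "\<And>i. i \<in> I \<Longrightarrow> u i \<le> 1" "\<And>i. i \<in> I \<Longrightarrow> 0 \<le> v i" "\<And>i. i \<in> I \<Longrightarrow> v i \<le> 1" for u v
  proof -
    have ev: "(\<Union>i\<in>I. W i (v i)) \<in> events" "(\<Union>i\<in>I. W i (u i) - W i (v i)) \<in> events"
      using finI by (intro sets.finite_UN; auto)+
    have Du: "D u = prob (\<Union>i\<in>I. W i (u i))" and Dv: "D v = prob (\<Union>i\<in>I. W i (v i))"
      using uv by (auto intro: D_eq_full)
    have "D u \<le> prob ((\<Union>i\<in>I. W i (v i)) \<union> (\<Union>i\<in>I. W i (u i) - W i (v i)))"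
      unfolding Du using ev by (intro finite_measure_mono) auto
    also have "\<dots> \<le> D v + prob (\<Union>i\<in>I. W i (u i) - W i (v i))"
      unfolding Dv using ev by (intro measure_Un_le)
    also have "prob (\<Union>i\<in>I. W i (u i) - W i (v i)) \<le> (\<Sum>i\<in>I. prob (W i (u i) - W i (v i)))"
      using finI by (intro measure_UNION_le) auto
    also have "\<dots> \<le> (\<Sum>i\<in>I. \<bar>u i - v i\<bar>)"
    proof (rule sum_mono)
      fix i assume i: "i \<in> I"
      show "prob (W i (u i) - W i (v i)) \<le> \<bar>u i - v i\<bar>"
      proof (cases "u i \<le> v i")
        case True
        then have eq: "W i (u i) - W i (v i) = {}" using W_mono by blast
        show ?thesis unfolding eq by simp
      next
        case False
        then show ?thesis using i W_mono[of "v i" "u i" i] prob_W uv by (simp add: finite_measure_Diff)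
      qed
    qed
    finally show ?thesis by simp
  qed
  show ?thesis using *[of u v] *[of v u] assms by (simp add: abs_le_iff abs_minus_commute)
qed

lemma D_single:
  assumes "i \<in> I" "0 \<le> u i" "u i \<le> 1" shows "D (on_coords {i} u) = u i"
proof -
  have "D (on_coords {i} u) = prob (\<Union>k\<in>{i}. W k (u k))" using assms by (intro D_eq) auto
  then show ?thesis using prob_W[OF assms] by simp
qed

lemma D_pair:
  assumes "i \<in> I" "j \<in> I" "i \<noteq> j" "0 \<le> u i" "u i \<le> 1" "0 \<le> u j" "u j \<le> 1"
  shows "u i + u j - D (on_coords {i, j} u) = prob (W i (u i) \<inter> W j (u j))"
proof -
  have "D (on_coords {i, j} u) = prob (W i (u i) \<union> W j (u j))"
    using D_eq[of "{i, j}" u] assms by auto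
  also have "\<dots> = prob (W i (u i)) + prob (W j (u j)) - prob (W i (u i) \<inter> W j (u j))"
    using assms by (intro measure_Un3) (auto simp: fmeasurable_eq_sets)
  finally show ?thesis using assms prob_W by simp
qed

text \<open>
  Boole and Bonferroni inequalities. The summands of the correction are joint exceedance probabilities.
\<close>
lemma D_on_bounds:
  assumes "J \<subseteq> I" "\<And>i. i \<in> J \<Longrightarrow> 0 \<le> u i" "\<And>i. i \<in> J \<Longrightarrow> u i \<le> 1"
  shows "D (on_coords J u) \<le> (\<Sum>i\<in>J. u i)"
    "(\<Sum>i\<in>J. u i) - (\<Sum>(i, j)\<in>{(i, j). i \<in> J \<and> j \<in> J \<and> i \<noteq> j}. u i + u j - D (on_coords {i, j} u)) \<le> D (on_coords J u)"
proof -
  have finJ: "finite J" using assms(1) finI finite_subset by blast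
  have ev: "\<And>i. i \<in> J \<Longrightarrow> W i (u i) \<in> events" using assms(1) by auto
  have pW: "\<And>i. i \<in> J \<Longrightarrow> prob (W i (u i)) = u i" using assms prob_W by auto
  have "prob (\<Union>i\<in>J. W i (u i)) \<le> (\<Sum>i\<in>J. prob (W i (u i)))" using finJ ev by (intro measure_UNION_le) auto
  then show "D (on_coords J u) \<le> (\<Sum>i\<in>J. u i)" using pW by (simp add: D_eq[OF assms])
  have eqs: "(\<Sum>(i, j)\<in>{(i, j). i \<in> K \<and> j \<in> K \<and> i \<noteq> j}. u i + u j - D (on_coords {i, j} u)) =
    (\<Sum>(i, j)\<in>{(i, j). i \<in> K \<and> j \<in> K \<and> i \<noteq> j}. prob (W i (u i) \<inter> W j (u j)))" if "K \<subseteq> J" for K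
    using that assms by (intro sum.cong refl) (auto intro!: D_pair)
  have bon: "(\<Sum>i\<in>K. prob (W i (u i))) - (\<Sum>(i, j)\<in>{(i, j). i \<in> K \<and> j \<in> K \<and> i \<noteq> j}. prob (W i (u i) \<inter> W j (u j)))
     \<le> prob (\<Union>i\<in>K. W i (u i))" if "K \<subseteq> J" for K
  proof -
    have "finite K" using that finJ finite_subset by blast
    then show ?thesis using that
    proof (induction K)
      case (insert k K)
      let ?V = "\<Union>i\<in>K. W i (u i)"
      let ?P = "\<lambda>K. {(i, j). i \<in> K \<and> j \<in> K \<and> i \<noteq> j}"
      let ?f = "\<lambda>(i, j). prob (W i (u i) \<inter> W j (u j))"
      have V: "?V \<in> events" using insert ev by (intro sets.finite_UN) auto
      have k: "W k (u k) \<in> events" using insert ev by auto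
      have finP: "finite (?P (insert k K))" using insert(1) by (auto intro: finite_subset[of _ "insert k K \<times> insert k K"])
      have "prob (W k (u k) \<inter> ?V) = prob (\<Union>j\<in>K. W k (u k) \<inter> W j (u j))" by (simp only: Int_UN_distrib)
      also have "\<dots> \<le> (\<Sum>j\<in>K. prob (W k (u k) \<inter> W j (u j)))"
        using insert ev k by (intro measure_UNION_le) auto
      also have "\<dots> = sum ?f (Pair k ` K)" by (subst sum.reindex) (auto simp: inj_on_def)
      finally have 1: "prob (W k (u k) \<inter> ?V) \<le> sum ?f (Pair k ` K)" .
      have "sum ?f (?P K) + sum ?f (Pair k ` K) = sum ?f (?P K \<union> Pair k ` K)"
        using insert finP by (intro sum.union_disjoint[symmetric]) (auto intro: finite_subset[OF _ finP])
      also have "\<dots> \<le> sum ?f (?P (insert k K))"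
        using insert(2) by (intro sum_mono2 finP) auto
      finally have 2: "sum ?f (?P K) + sum ?f (Pair k ` K) \<le> sum ?f (?P (insert k K))" .
      have "prob (\<Union>i\<in>insert k K. W i (u i)) = prob (W k (u k)) + prob ?V - prob (W k (u k) \<inter> ?V)"
        using measure_Un3[of "W k (u k)" N ?V] V k by (simp add: fmeasurable_eq_sets)
      then show ?case using 1 2 insert by simp
    qed simp
  qed
  show "(\<Sum>i\<in>J. u i) - (\<Sum>(i, j)\<in>{(i, j). i \<in> J \<and> j \<in> J \<and> i \<noteq> j}. u i + u j - D (on_coords {i, j} u)) \<le> D (on_coords J u)"
    unfolding eqs[OF subset_refl] using bon[OF subset_refl] pW by (simp add: D_eq[OF assms])
qed

end

text \<open>
  A copula with tail dependence function \<open>l\<close>, the limit of \<open>D (s v) / s\<close> for \<open>s\<close> decreasing to 0.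
\<close>
locale mrv_space = copula_space N I C for N :: "('i \<Rightarrow> real) measure" and I C +
  fixes l :: "('i \<Rightarrow> real) \<Rightarrow> real"
  assumes l_lim: "\<And>v. (\<And>i. i \<in> I \<Longrightarrow> 0 \<le> v i) \<Longrightarrow> ((\<lambda>s. (1 - C (\<lambda>i. 1 - s * v i)) / s) \<longlongrightarrow> l v) (at_right 0)"
begin

lemma D_lim: "(\<And>i. i \<in> I \<Longrightarrow> 0 \<le> v i) \<Longrightarrow> ((\<lambda>s. D (\<lambda>i. s * v i) / s) \<longlongrightarrow> l v) (at_right 0)"
  using l_lim[of v] unfolding D_def .

text \<open>
  The defining limit of \<open>l\<close> holds along any arguments asymptotic to \<open>s * a\<close>, because \<open>D\<close> is 1-Lipschitz.
\<close>
lemma D_asymp: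
  assumes s: "filterlim s (at_right 0) \<F>"
    and u01: "eventually (\<lambda>x. \<forall>i\<in>I. 0 \<le> u x i \<and> u x i \<le> 1) \<F>"
    and lim: "\<And>i. i \<in> I \<Longrightarrow> ((\<lambda>x. u x i / s x) \<longlongrightarrow> a i) \<F>"
    and a0: "\<And>i. i \<in> I \<Longrightarrow> 0 \<le> a i"
  shows "((\<lambda>x. D (u x) / s x) \<longlongrightarrow> l a) \<F>"
proof -
  have s0: "eventually (\<lambda>x. 0 < s x) \<F>" and s1: "(s \<longlongrightarrow> 0) \<F>"
    using s by (auto simp: filterlim_at eventually_conj_iff)
  have "eventually (\<lambda>x. s x * a i < 1) \<F>" for i
  proof -
    have "((\<lambda>x. s x * a i) \<longlongrightarrow> 0 * a i) \<F>" by (intro tendsto_intros s1)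
    then show ?thesis by (rule order_tendstoD) simp
  qed
  then have sa: "eventually (\<lambda>x. \<forall>i\<in>I. s x * a i < 1) \<F>"
    using finI by (intro eventually_ball_finite) auto
  have 1: "((\<lambda>x. D (\<lambda>i. s x * a i) / s x) \<longlongrightarrow> l a) \<F>"
    using filterlim_compose[OF D_lim s] a0 by simp
  have "((\<lambda>x. \<Sum>i\<in>I. \<bar>u x i / s x - a i\<bar>) \<longlongrightarrow> (\<Sum>i\<in>I. \<bar>a i - a i\<bar>)) \<F>"
    by (intro tendsto_sum tendsto_rabs tendsto_diff lim tendsto_const)
  then have 2: "((\<lambda>x. \<Sum>i\<in>I. \<bar>u x i / s x - a i\<bar>) \<longlongrightarrow> 0) \<F>" by simp
  have "((\<lambda>x. D (u x) / s x - D (\<lambda>i. s x * a i) / s x) \<longlongrightarrow> 0) \<F>"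
  proof (rule Lim_null_comparison[OF _ 2])
    show "eventually (\<lambda>x. norm (D (u x) / s x - D (\<lambda>i. s x * a i) / s x) \<le> (\<Sum>i\<in>I. \<bar>u x i / s x - a i\<bar>)) \<F>"
      using s0 u01 sa
    proof eventually_elim
      case (elim x)
      have "\<bar>D (u x) - D (\<lambda>i. s x * a i)\<bar> \<le> (\<Sum>i\<in>I. \<bar>u x i - s x * a i\<bar>)"
        using elim a0 by (intro D_diff_le) (auto intro: less_imp_le)
      then have "\<bar>D (u x) - D (\<lambda>i. s x * a i)\<bar> / s x \<le> (\<Sum>i\<in>I. \<bar>u x i - s x * a i\<bar>) / s x"
        using elim by (intro divide_right_mono) auto
      also have "\<dots> = (\<Sum>i\<in>I. \<bar>u x i / s x - a i\<bar>)"
        unfolding sum_divide_distrib using elim by (intro sum.cong refl) (auto simp: field_simps abs_divide diff_divide_distrib[symmetric] abs_if)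
      finally show ?case using elim by (simp add: abs_divide flip: diff_divide_distrib)
    qed
  qed
  from tendsto_add[OF this 1] show ?thesis by simp
qed

lemma scaled_01:
  fixes v :: "'i \<Rightarrow> real"
  assumes "\<And>i. i \<in> I \<Longrightarrow> 0 \<le> v i"
  shows "eventually (\<lambda>s. 0 < s \<and> (\<forall>i\<in>I. 0 \<le> s * v i \<and> s * v i \<le> 1)) (at_right 0)"
proof -
  have "eventually (\<lambda>s. s * v i < 1) (at_right 0)" for i
  proof -
    have "((\<lambda>s. s * v i) \<longlongrightarrow> 0 * v i) (at_right 0)" by (intro tendsto_intros)
    then show ?thesis by (rule order_tendstoD) simp
  qed
  then have "eventually (\<lambda>s. \<forall>i\<in>I. s * v i < 1) (at_right 0)" using finI by (intro eventually_ball_finite) auto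
  moreover have "eventually (\<lambda>s::real. 0 < s) (at_right 0)" by (rule eventually_at_right_less)
  ultimately show ?thesis by eventually_elim (use assms in \<open>auto intro: less_imp_le\<close>)
qed

lemma on_coords_scale: "on_coords J (\<lambda>i. s * v i) = (\<lambda>i. s * on_coords J v i)"
  unfolding on_coords_def by auto

lemma D_lim_on:
  assumes "\<And>i. i \<in> J \<Longrightarrow> 0 \<le> v i"
  shows "((\<lambda>s. D (on_coords J (\<lambda>i. s * v i)) / s) \<longlongrightarrow> l (on_coords J v)) (at_right 0)"
proof -
  have "((\<lambda>s. D (\<lambda>i. s * on_coords J v i) / s) \<longlongrightarrow> l (on_coords J v)) (at_right 0)"
    using assms by (intro D_lim) (simp add: on_coords_def)
  then show ?thesis by (simp only: on_coords_scale)
qed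

lemma l_single:
  assumes "i \<in> I" "0 \<le> v i" shows "l (on_coords {i} v) = v i"
proof -
  have nn: "0 \<le> on_coords {i} v k" for k using assms by (simp add: on_coords_def)
  have "eventually (\<lambda>s. D (on_coords {i} (\<lambda>i. s * v i)) / s = v i) (at_right 0)"
    using scaled_01[of "on_coords {i} v", OF nn]
  proof eventually_elim
    case (elim s)
    then have "0 \<le> s * v i" "s * v i \<le> 1" using assms by (auto simp: on_coords_def split: if_splits)
    then show ?case using D_single[of i "\<lambda>i. s * v i"] assms elim by simp
  qed
  then have "((\<lambda>s. D (on_coords {i} (\<lambda>i. s * v i)) / s) \<longlongrightarrow> v i) (at_right 0)" by (rule tendsto_eventually)
  then show ?thesis using tendsto_unique[OF trivial_limit_at_right_real D_lim_on[of "{i}" v]] assms by auto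
qed

lemma l_ge:
  assumes "\<And>i. i \<in> I \<Longrightarrow> 0 \<le> v i" "i \<in> I" shows "v i \<le> l v"
proof (rule tendsto_lowerbound)
  have sc: "eventually (\<lambda>s. 0 < s \<and> (\<forall>i\<in>I. 0 \<le> s * v i \<and> s * v i \<le> 1)) (at_right 0)"
    using assms(1) by (rule scaled_01)
  show "((\<lambda>s. D (\<lambda>i. s * v i) / s) \<longlongrightarrow> l v) (at_right 0)" using assms(1) by (rule D_lim)
  show "eventually (\<lambda>s. v i \<le> D (\<lambda>i. s * v i) / s) (at_right 0)"
    using sc
  proof eventually_elim
    case (elim s)
    have "prob (W i (s * v i)) \<le> prob (\<Union>i\<in>I. W i (s * v i))"
      using assms finI by (intro finite_measure_mono sets.finite_UN) auto
    then have "s * v i \<le> D (\<lambda>i. s * v i)" using D_eq_full[of "\<lambda>i. s * v i"] prob_W[of i "s * v i"] elim assms by simp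
    then show ?case using elim by (simp add: field_simps)
  qed
qed simp

lemma l_scale:
  assumes "0 < c" "\<And>i. i \<in> I \<Longrightarrow> 0 \<le> v i" shows "l (\<lambda>i. c * v i) = c * l v"
proof -
  have f: "filterlim (\<lambda>s. c * s) (at_right 0) (at_right 0)"
    using assms(1) by real_asymp
  have "((\<lambda>s. c * (D (\<lambda>i. (c * s) * v i) / (c * s))) \<longlongrightarrow> c * l v) (at_right 0)"
    by (intro tendsto_mult tendsto_const filterlim_compose[OF D_lim f] assms)
  moreover have "c * (D (\<lambda>i. (c * s) * v i) / (c * s)) = D (\<lambda>i. s * (c * v i)) / s" for s
    using assms(1) by (simp add: mult_ac)
  ultimately have "((\<lambda>s. D (\<lambda>i. s * (c * v i)) / s) \<longlongrightarrow> c * l v) (at_right 0)" by simp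
  then show ?thesis using tendsto_unique[OF trivial_limit_at_right_real D_lim[of "\<lambda>i. c * v i"]] assms by auto
qed

text \<open>
  The mass that \<open>l\<close> gives to joint exceedances of two coordinates increases with the arguments.
\<close>
lemma l_pair_mono:
  assumes "i \<in> I" "j \<in> I" "i \<noteq> j" "0 \<le> v i" "0 \<le> v j" "v i \<le> w i" "v j \<le> w j"
  shows "v i + v j - l (on_coords {i, j} v) \<le> w i + w j - l (on_coords {i, j} w)"
proof (rule tendsto_le[OF trivial_limit_at_right_real])
  have nn: "0 \<le> on_coords {i, j} w k" for k using assms by (auto simp: on_coords_def)
  have vw: "\<And>k. k \<in> {i, j} \<Longrightarrow> 0 \<le> v k" "\<And>k. k \<in> {i, j} \<Longrightarrow> 0 \<le> w k" using assms by auto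
  show "((\<lambda>s. v i + v j - D (on_coords {i, j} (\<lambda>i. s * v i)) / s) \<longlongrightarrow> v i + v j - l (on_coords {i, j} v)) (at_right 0)"
    by (intro tendsto_intros D_lim_on vw)
  show "((\<lambda>s. w i + w j - D (on_coords {i, j} (\<lambda>i. s * w i)) / s) \<longlongrightarrow> w i + w j - l (on_coords {i, j} w)) (at_right 0)"
    by (intro tendsto_intros D_lim_on vw)
  show "eventually (\<lambda>s. v i + v j - D (on_coords {i, j} (\<lambda>i. s * v i)) / s
     \<le> w i + w j - D (on_coords {i, j} (\<lambda>i. s * w i)) / s) (at_right 0)"
    using scaled_01[of "on_coords {i, j} w", OF nn]
  proof eventually_elim
    case (elim s)
    then have "0 \<le> s * on_coords {i, j} w k \<and> s * on_coords {i, j} w k \<le> 1" if "k \<in> {i, j}" for k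
      using that assms by blast
    from this[of i] this[of j] have w: "s * w i \<le> 1" "s * w j \<le> 1" "0 \<le> s * w i" "0 \<le> s * w j" by (auto simp: on_coords_def)
    have sv: "s * v i \<le> s * w i" "s * v j \<le> s * w j" using elim assms by (auto intro: mult_left_mono)
    have v: "s * v i \<le> 1" "s * v j \<le> 1" "0 \<le> s * v i" "0 \<le> s * v j"
      using order_trans[OF sv(1) w(1)] order_trans[OF sv(2) w(2)] elim assms by auto
    have "prob (W i (s * v i) \<inter> W j (s * v j)) \<le> prob (W i (s * w i) \<inter> W j (s * w j))"
      using W_mono sv assms by (intro finite_measure_mono Int_mono) auto
    then have "s * v i + s * v j - D (on_coords {i, j} (\<lambda>i. s * v i)) \<le> s * w i + s * w j - D (on_coords {i, j} (\<lambda>i. s * w i))"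
      using D_pair[of i j "\<lambda>i. s * v i"] D_pair[of i j "\<lambda>i. s * w i"] assms v w by simp
    then have "(s * v i + s * v j - D (on_coords {i, j} (\<lambda>i. s * v i))) / s \<le> (s * w i + s * w j - D (on_coords {i, j} (\<lambda>i. s * w i))) / s"
      using elim by (intro divide_right_mono) auto
    then show ?case using elim by (simp add: add_divide_distrib diff_divide_distrib)
  qed
qed

text \<open>
  Pairwise additivity of \<open>l\<close> implies additivity.
\<close>
lemma l_sum_if_pairs:
  assumes "J \<subseteq> I" "\<And>i. i \<in> J \<Longrightarrow> 0 \<le> v i"
    and pairs: "\<And>i j. i \<in> J \<Longrightarrow> j \<in> J \<Longrightarrow> i \<noteq> j \<Longrightarrow> v i + v j \<le> l (on_coords {i, j} v)"
  shows "l (on_coords J v) = (\<Sum>i\<in>J. v i)"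
proof (rule antisym)
  have finJ: "finite J" using assms(1) finI finite_subset by blast
  let ?P = "{(i, j). i \<in> J \<and> j \<in> J \<and> i \<noteq> j}"
  have finP: "finite ?P" using finJ by (auto intro: finite_subset[of _ "J \<times> J"])
  have nn: "0 \<le> on_coords J v k" for k using assms by (auto simp: on_coords_def)
  have ev: "eventually (\<lambda>s. 0 < s \<and> (\<forall>i\<in>J. 0 \<le> s * v i \<and> s * v i \<le> 1)) (at_right 0)"
    using scaled_01[of "on_coords J v", OF nn]
  proof eventually_elim
    case (elim s)
    then have "0 \<le> s * on_coords J v i \<and> s * on_coords J v i \<le> 1" if "i \<in> J" for i
      using that assms(1) by blast
    then show ?case using elim by (auto simp: on_coords_def)
  qed
  have lim: "((\<lambda>s. D (on_coords J (\<lambda>i. s * v i)) / s) \<longlongrightarrow> l (on_coords J v)) (at_right 0)"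
    using assms(2) by (rule D_lim_on)
  show "l (on_coords J v) \<le> (\<Sum>i\<in>J. v i)"
  proof (rule tendsto_upperbound[OF lim])
    show "eventually (\<lambda>s. D (on_coords J (\<lambda>i. s * v i)) / s \<le> (\<Sum>i\<in>J. v i)) (at_right 0)"
      using ev
    proof eventually_elim
      case (elim s)
      then have "D (on_coords J (\<lambda>i. s * v i)) \<le> (\<Sum>i\<in>J. s * v i)" using assms by (intro D_on_bounds) auto
      then show ?case using elim by (simp add: field_simps flip: sum_distrib_left)
    qed
  qed simp
  have lim2: "((\<lambda>s. (\<Sum>i\<in>J. v i) - (\<Sum>(i, j)\<in>?P. v i + v j - D (on_coords {i, j} (\<lambda>i. s * v i)) / s))
     \<longlongrightarrow> (\<Sum>i\<in>J. v i) - (\<Sum>(i, j)\<in>?P. v i + v j - l (on_coords {i, j} v))) (at_right 0)"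
    unfolding case_prod_beta
    by (intro tendsto_diff tendsto_sum tendsto_const D_lim_on) (use assms in auto)
  have "(\<Sum>i\<in>J. v i) \<le> (\<Sum>i\<in>J. v i) - (\<Sum>(i, j)\<in>?P. v i + v j - l (on_coords {i, j} v))"
    using pairs by (auto intro!: sum_nonpos)
  also have "\<dots> \<le> l (on_coords J v)"
  proof (rule tendsto_le[OF trivial_limit_at_right_real lim lim2])
    show "eventually (\<lambda>s. (\<Sum>i\<in>J. v i) - (\<Sum>(i, j)\<in>?P. v i + v j - D (on_coords {i, j} (\<lambda>i. s * v i)) / s)
       \<le> D (on_coords J (\<lambda>i. s * v i)) / s) (at_right 0)"
      using ev
    proof eventually_elim
      case (elim s)
      then have "((\<Sum>i\<in>J. s * v i) - (\<Sum>(i, j)\<in>?P. s * v i + s * v j - D (on_coords {i, j} (\<lambda>i. s * v i)))) / s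
        \<le> D (on_coords J (\<lambda>i. s * v i)) / s" using assms D_on_bounds(2)[of J "\<lambda>i. s * v i"]
        by (intro divide_right_mono) auto
      then show ?case using elim
        by (simp add: diff_divide_distrib add_divide_distrib sum_divide_distrib case_prod_beta)
    qed
  qed
  finally show "(\<Sum>i\<in>J. v i) \<le> l (on_coords J v)" .
qed

end


section \<open>Subvectors and asymptotic independence\<close>

lemma copula_space_exists:
  assumes "finite I" "copula I C" obtains N where "copula_space N I C"
proof -
  from assms(2) obtain N where "prob_space N" "sets N = sets (Pi\<^sub>M I (\<lambda>_. borel))"
    "\<forall>i\<in>I. distr N borel (\<lambda>x. x i) = uniform_measure lborel {0..1}"
    "\<forall>u\<in>unit_cube I. C u = \<P>(x in N. \<forall>i\<in>I. x i \<le> u i)" unfolding copula_def by blast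
  then show ?thesis using assms(1) by (intro that[of N]) (simp add: copula_space_def copula_space_axioms_def)
qed

lemma (in copula_space) copula_subvector:
  assumes J: "J \<subseteq> I" shows "copula J (\<lambda>u. C (\<lambda>i. if i \<in> J then u i else 1))"
  unfolding copula_def
proof (intro exI conjI ballI)
  let ?N = "distr N (Pi\<^sub>M J (\<lambda>_. borel)) (\<lambda>x. restrict x J)"
  have m [measurable]: "(\<lambda>x. restrict x J) \<in> measurable N (Pi\<^sub>M J (\<lambda>_. borel))"
    unfolding measurable_cong_sets[OF sets_N refl] using J by (rule measurable_restrict_subset)
  show "prob_space ?N" by (rule prob_space_distr) measurable
  show "sets ?N = sets (Pi\<^sub>M J (\<lambda>_. borel))" by simp
  fix i assume i: "i \<in> J"
  have "distr ?N borel (\<lambda>x. x i) = distr N borel ((\<lambda>x. x i) \<circ> (\<lambda>x. restrict x J))"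
    using i by (intro distr_distr m measurable_component_singleton) auto
  also have "\<dots> = distr N borel (\<lambda>x. x i)" using i by (intro arg_cong[of _ _ "distr N borel"]) auto
  finally show "distr ?N borel (\<lambda>x. x i) = uniform_measure lborel {0..1}" using margin i J by auto
next
  fix u assume u: "u \<in> unit_cube J"
  let ?N = "distr N (Pi\<^sub>M J (\<lambda>_. borel)) (\<lambda>x. restrict x J)"
  let ?u = "\<lambda>i. if i \<in> J then u i else 1"
  have finJ: "finite J" using J finI finite_subset by blast
  have m [measurable]: "(\<lambda>x. restrict x J) \<in> measurable N (Pi\<^sub>M J (\<lambda>_. borel))"
    unfolding measurable_cong_sets[OF sets_N refl] using J by (rule measurable_restrict_subset)
  have ev: "{x \<in> space (Pi\<^sub>M J (\<lambda>_. borel)). \<forall>i\<in>J. x i \<le> u i} \<in> sets (Pi\<^sub>M J (\<lambda>_. borel))"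
    using finJ by (intro sets.sets_Collect_finite_All) measurable
  have cube: "?u \<in> unit_cube I" using u unfolding unit_cube_def by auto
  define v where "v i = 1 - ?u i" for i
  have v: "0 \<le> v i" "v i \<le> 1" for i using u unfolding v_def unit_cube_def by auto
  have "v = on_coords J v" unfolding v_def on_coords_def by auto
  then have "C ?u = 1 - D (on_coords J v)" unfolding D_def by (simp add: v_def[abs_def])
  also have "D (on_coords J v) = prob (\<Union>i\<in>J. W i (v i))" using v by (intro D_eq J)
  also have "1 - \<dots> = prob (space N - (\<Union>i\<in>J. W i (v i)))"
    using J finJ by (intro prob_compl[symmetric] sets.finite_UN) auto
  also have "space N - (\<Union>i\<in>J. W i (v i)) = (\<lambda>x. restrict x J) -` {x \<in> space (Pi\<^sub>M J (\<lambda>_. borel)). \<forall>i\<in>J. x i \<le> u i} \<inter> space N"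
    unfolding W_def v_def by (auto simp: not_less space_PiM)
  also have "prob \<dots> = measure ?N {x \<in> space (Pi\<^sub>M J (\<lambda>_. borel)). \<forall>i\<in>J. x i \<le> u i}"
    using ev by (intro measure_distr[symmetric] m)
  finally show "C ?u = measure ?N {x \<in> space ?N. \<forall>i\<in>J. x i \<le> u i}" by simp
qed

lemma copula_product:
  assumes J: "finite J" shows "copula J (\<lambda>u. \<Prod>i\<in>J. u i)"
  unfolding copula_def
proof (intro exI conjI ballI)
  let ?U = "uniform_measure lborel {0..1::real}"
  let ?N = "Pi\<^sub>M J (\<lambda>_. ?U)"
  have U: "prob_space ?U" by (rule prob_space_uniform_measure) auto
  show "prob_space ?N" by (intro prob_space_PiM U)
  show "sets ?N = sets (Pi\<^sub>M J (\<lambda>_. borel))" by (intro sets_PiM_cong) auto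
  {
    fix i assume i: "i \<in> J"
    have "distr ?N borel (\<lambda>x. x i) = distr ?N ?U (\<lambda>x. x i)" by (intro distr_cong) auto
    also have "\<dots> = ?U" using i by (intro distr_PiM_component[of J "\<lambda>_. ?U"] U)
    finally show "distr ?N borel (\<lambda>x. x i) = ?U" .
  }
  fix u assume u: "u \<in> unit_cube J"
  interpret prob_space ?U by (rule U)
  interpret finite_product_prob_space "\<lambda>_. ?U" J by standard (rule J)
  have "measure ?N {x \<in> space ?N. \<forall>i\<in>J. x i \<le> u i} = measure ?N (\<Pi>\<^sub>E i\<in>J. {..u i})"
    by (intro arg_cong[of _ _ "measure ?N"]) (auto simp: space_PiM PiE_def)
  also have "\<dots> = (\<Prod>i\<in>J. measure ?U {..u i})" by (intro prob_times) auto
  also have "\<dots> = (\<Prod>i\<in>J. u i)"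
  proof (intro prod.cong refl)
    fix i assume "i \<in> J"
    then have ui: "0 \<le> u i" "u i \<le> 1" using u unfolding unit_cube_def by auto
    have "measure ?U {..u i} = measure lborel ({0..1} \<inter> {..u i})" by simp
    also have "{0..1} \<inter> {..u i} = {0..u i}" using ui by auto
    finally show "measure ?U {..u i} = u i" using ui by simp
  qed
  finally show "(\<Prod>i\<in>J. u i) = measure ?N {x \<in> space ?N. \<forall>i\<in>J. x i \<le> u i}" by simp
qed

lemma powr_tendsto_exp:
  fixes d :: "real \<Rightarrow> real"
  assumes d: "((\<lambda>t. t * d t) \<longlongrightarrow> a) at_top"
  shows "((\<lambda>t. (1 - d t) powr t) \<longlongrightarrow> exp (- a)) at_top"
proof -
  have 1: "((\<lambda>t. (t * d t) * (1 / t)) \<longlongrightarrow> a * 0) at_top"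
    by (intro tendsto_mult d) real_asymp
  have "eventually (\<lambda>t. (t * d t) * (1 / t) = d t) at_top"
    using eventually_gt_at_top[of 0] by eventually_elim simp
  then have d0: "(d \<longlongrightarrow> 0) at_top" using Lim_transform_eventually[OF 1] by simp
  then have d1: "eventually (\<lambda>t. d t < 1) at_top" by (rule order_tendstoD) simp
  have "((\<lambda>t. t * ln (1 - d t)) \<longlongrightarrow> - a) at_top"
  proof (rule tendsto_sandwich)
    show "((\<lambda>t. - (t * d t) / (1 - d t)) \<longlongrightarrow> - a) at_top"
      using tendsto_divide[OF tendsto_minus[OF d] tendsto_diff[OF tendsto_const[of 1] d0]] by simp
    show "((\<lambda>t. - (t * d t)) \<longlongrightarrow> - a) at_top" by (intro tendsto_minus d)
    show "eventually (\<lambda>t. t * ln (1 - d t) \<le> - (t * d t)) at_top"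
      using d1 eventually_gt_at_top[of 0]
    proof eventually_elim
      case (elim t)
      then have "ln (1 - d t) \<le> - d t" using ln_le_minus_one[of "1 - d t"] by simp
      then have "t * ln (1 - d t) \<le> t * - d t" using elim by (intro mult_left_mono) auto
      then show ?case by simp
    qed
    show "eventually (\<lambda>t. - (t * d t) / (1 - d t) \<le> t * ln (1 - d t)) at_top"
      using d1 eventually_gt_at_top[of 0]
    proof eventually_elim
      case (elim t)
      then have "ln (1 / (1 - d t)) \<le> 1 / (1 - d t) - 1" by (intro ln_le_minus_one) auto
      moreover have "1 / (1 - d t) - 1 = d t / (1 - d t)" using elim by (simp add: field_simps)
      ultimately have "- (d t / (1 - d t)) \<le> ln (1 - d t)" using elim by (simp add: ln_div)
      then have "t * - (d t / (1 - d t)) \<le> t * ln (1 - d t)" using elim by (intro mult_left_mono) auto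
      then show ?case by simp
    qed
  qed
  then have "((\<lambda>t. exp (t * ln (1 - d t))) \<longlongrightarrow> exp (- a)) at_top" by (rule tendsto_exp)
  then show ?thesis
    by (rule Lim_transform_eventually) (use d1 in eventually_elim, simp add: powr_def)
qed

text \<open>
  The limiting copula of a subvector is \<open>exp (- l (- ln u))\<close>.
\<close>
lemma (in mrv_space) C_powr_tendsto:
  assumes J: "J \<subseteq> I" and v: "\<And>i. i \<in> J \<Longrightarrow> 0 \<le> v i"
  shows "((\<lambda>t. C (\<lambda>i. if i \<in> J then exp (- v i) powr (1 / t) else 1) powr t) \<longlongrightarrow> exp (- l (on_coords J v))) at_top"
proof -
  let ?u = "\<lambda>t. on_coords J (\<lambda>i. 1 - exp (- v i) powr (1 / t))"
  have "((\<lambda>t. D (?u t) / (1 / t)) \<longlongrightarrow> l (on_coords J v)) at_top"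
  proof (rule D_asymp)
    show "filterlim (\<lambda>t::real. 1 / t) (at_right 0) at_top" by real_asymp
    show "eventually (\<lambda>t. \<forall>i\<in>I. 0 \<le> ?u t i \<and> ?u t i \<le> 1) at_top"
      using eventually_gt_at_top[of 0]
      by eventually_elim (use v in \<open>auto simp: on_coords_def powr_def\<close>)
    fix i
    show "((\<lambda>t. ?u t i / (1 / t)) \<longlongrightarrow> on_coords J v i) at_top"
    proof (cases "i \<in> J")
      case True
      have "((\<lambda>t. (1 - exp (- c / t)) / (1 / t)) \<longlongrightarrow> c) at_top" for c :: real
        by real_asymp
      then show ?thesis using True by (simp add: on_coords_def powr_def)
    qed (simp add: on_coords_def)
    show "0 \<le> on_coords J v i" using v by (simp add: on_coords_def)
  qed
  then have "((\<lambda>t. t * D (?u t)) \<longlongrightarrow> l (on_coords J v)) at_top" by (simp add: mult.commute)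
  from powr_tendsto_exp[OF this]
  have "((\<lambda>t. (1 - D (?u t)) powr t) \<longlongrightarrow> exp (- l (on_coords J v))) at_top" .
  moreover have "1 - D (?u t) = C (\<lambda>i. if i \<in> J then exp (- v i) powr (1 / t) else 1)" for t
    unfolding D_def on_coords_def by (auto intro!: arg_cong[of _ _ C])
  ultimately show ?thesis by simp
qed

text \<open>
  Asymptotic independence of a subvector means that \<open>l\<close> is additive on its coordinates. Since the
  marginal distribution functions are onto the unit interval, the copula of the subvector is unique, so
  it may be taken to be the corresponding margin of \<open>C\<close>.
\<close>
lemma (in mrv_space) asymptotically_independent_iff:
  assumes J: "J \<subseteq> I" and M: "prob_space M" and X: "\<And>i. i \<in> I \<Longrightarrow> X i \<in> borel_measurable M"
    and X1: "\<And>i x. i \<in> I \<Longrightarrow> x \<in> space M \<Longrightarrow> X i x \<le> 1"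
    and C: "copula_of M I X C"
    and onto: "\<And>i u. i \<in> J \<Longrightarrow> 0 \<le> u \<Longrightarrow> u \<le> 1 \<Longrightarrow> \<exists>x. cdf (distr M borel (X i)) x = u"
  shows "asymptotically_independent M J X \<longleftrightarrow>
    (\<forall>v. (\<forall>i\<in>J. 0 \<le> v i) \<longrightarrow> l (on_coords J v) = (\<Sum>i\<in>J. v i))"
proof -
  interpret M: prob_space M by fact
  have finJ: "finite J" using J finI finite_subset by blast
  define CJ where "CJ = (\<lambda>u. C (\<lambda>i. if i \<in> J then u i else 1))"
  have cdf1: "cdf (distr M borel (X i)) 1 = 1" if "i \<in> I" for i
  proof -
    have "X i -` {..1} \<inter> space M = space M" using X1[OF that] by auto
    then show ?thesis unfolding cdf_def using X[OF that] by (simp add: measure_distr M.prob_space)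
  qed
  have cdf01: "0 \<le> cdf (distr M borel (X i)) y" "cdf (distr M borel (X i)) y \<le> 1" if "i \<in> I" for i y
    using X[OF that] unfolding cdf_def by (auto simp: measure_distr)
  have joint: "measure M {a \<in> space M. \<forall>i\<in>J. X i a \<le> x i} = CJ (\<lambda>i. cdf (distr M borel (X i)) (x i))" for x
  proof -
    let ?x = "\<lambda>i. if i \<in> J then x i else 1"
    have "{a \<in> space M. \<forall>i\<in>J. X i a \<le> x i} = {a \<in> space M. \<forall>i\<in>I. X i a \<le> ?x i}"
      using J X1 by auto
    also have "measure M \<dots> = C (\<lambda>i. cdf (distr M borel (X i)) (?x i))"
      by (rule spec[OF conjunct2[OF C[unfolded copula_of_def]], of ?x])
    also have "\<dots> = CJ (\<lambda>i. cdf (distr M borel (X i)) (x i))"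
      unfolding CJ_def using cdf01 cdf1 by (intro C_cong) (auto simp: unit_cube_def)
    finally show ?thesis .
  qed
  have copJ: "copula J CJ" unfolding CJ_def by (rule copula_subvector[OF J])
  have CJ_of: "copula_of M J X CJ" unfolding copula_of_def using copJ joint by blast
  have uniq: "C' u = CJ u" if C': "copula_of M J X C'" and u: "u \<in> unit_cube J" for C' u
  proof -
    obtain N' where "copula_space N' J C'" using C' finJ copula_space_exists unfolding copula_of_def by blast
    then interpret C': copula_space N' J C' .
    have "\<forall>i\<in>J. \<exists>x. cdf (distr M borel (X i)) x = u i" using onto u unfolding unit_cube_def by auto
    from bchoice[OF this] obtain x where x: "\<And>i. i \<in> J \<Longrightarrow> cdf (distr M borel (X i)) (x i) = u i" by blast
    have "C' u = C' (\<lambda>i. cdf (distr M borel (X i)) (x i))" using u x by (intro C'.C_cong) auto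
    also have "\<dots> = CJ (\<lambda>i. cdf (distr M borel (X i)) (x i))"
      using C' joint unfolding copula_of_def by (metis (mono_tags, lifting))
    also have "\<dots> = CJ u" unfolding CJ_def using x by (intro arg_cong[of _ _ C]) auto
    finally show ?thesis .
  qed
  have pow: "(\<lambda>i. u i powr (1 / t)) \<in> unit_cube J" if "u \<in> unit_cube J" "0 < t" for u and t :: real
    using that powr_le1 unfolding unit_cube_def by auto
  show ?thesis
  proof
    assume "asymptotically_independent M J X"
    then obtain C' where C': "copula_of M J X C'" and lim: "limiting_copula J C' (\<lambda>u. \<Prod>i\<in>J. u i)"
      unfolding asymptotically_independent_def by blast
    show "\<forall>v. (\<forall>i\<in>J. 0 \<le> v i) \<longrightarrow> l (on_coords J v) = (\<Sum>i\<in>J. v i)"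
    proof (intro allI impI)
      fix v :: "'i \<Rightarrow> real" assume v: "\<forall>i\<in>J. 0 \<le> v i"
      define u where "u i = exp (- v i)" for i
      have u: "u \<in> unit_cube J" using v unfolding u_def unit_cube_def by auto
      have 1: "((\<lambda>t. C' (\<lambda>i. u i powr (1 / t)) powr t) \<longlongrightarrow> (\<Prod>i\<in>J. u i)) at_top"
        using lim u unfolding limiting_copula_def by blast
      have 2: "eventually (\<lambda>t. C' (\<lambda>i. u i powr (1 / t)) powr t =
          C (\<lambda>i. if i \<in> J then exp (- v i) powr (1 / t) else 1) powr t) at_top"
        using eventually_gt_at_top[of 0]
      proof eventually_elim
        case (elim t)
        then show ?case using uniq[OF C' pow[OF u]] unfolding CJ_def u_def by simp
      qed
      have "exp (- l (on_coords J v)) = (\<Prod>i\<in>J. u i)"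
        using tendsto_unique[OF trivial_limit_at_top_linorder C_powr_tendsto[OF J] Lim_transform_eventually[OF 1 2]] v by blast
      also have "\<dots> = exp (- (\<Sum>i\<in>J. v i))" unfolding u_def using finJ by (simp add: exp_sum sum_negf[symmetric])
      finally show "l (on_coords J v) = (\<Sum>i\<in>J. v i)" by simp
    qed
  next
    assume add: "\<forall>v. (\<forall>i\<in>J. 0 \<le> v i) \<longrightarrow> l (on_coords J v) = (\<Sum>i\<in>J. v i)"
    have "mrv_copula J CJ" unfolding mrv_copula_def
    proof (intro conjI copJ exI allI impI)
      fix v :: "'i \<Rightarrow> real" assume v: "\<forall>i\<in>J. 0 \<le> v i"
      have "((\<lambda>s. (1 - C (\<lambda>i. 1 - s * on_coords J v i)) / s) \<longlongrightarrow> l (on_coords J v)) (at_right 0)"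
        using v by (intro l_lim) (simp add: on_coords_def)
      moreover have "C (\<lambda>i. 1 - s * on_coords J v i) = CJ (\<lambda>i. 1 - s * v i)" for s
        unfolding CJ_def on_coords_def by (auto intro!: arg_cong[of _ _ C])
      ultimately show "((\<lambda>s. (1 - CJ (\<lambda>i. 1 - s * v i)) / s) \<longlongrightarrow> l (on_coords J v)) (at_right 0)" by simp
    qed
    moreover have "limiting_copula J CJ (\<lambda>u. \<Prod>i\<in>J. u i)" unfolding limiting_copula_def
    proof (intro conjI copula_product finJ ballI)
      fix u assume u: "u \<in> unit_cube J"
      show "((\<lambda>t. CJ (\<lambda>i. u i powr (1 / t)) powr t) \<longlongrightarrow> (\<Prod>i\<in>J. u i)) at_top"
      proof (cases "\<exists>i\<in>J. u i = 0")
        case True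
        then obtain i where i: "i \<in> J" "u i = 0" by blast
        obtain N' where "copula_space N' J CJ" using copJ finJ copula_space_exists by blast
        then interpret CJ: copula_space N' J CJ .
        have "eventually (\<lambda>t. CJ (\<lambda>i. u i powr (1 / t)) powr t = (\<Prod>i\<in>J. u i)) at_top"
          using eventually_gt_at_top[of 0]
        proof eventually_elim
          case (elim t)
          have "CJ (\<lambda>i. u i powr (1 / t)) = CJ.prob {x \<in> space N'. \<forall>i\<in>J. x i \<le> u i powr (1 / t)}"
            using u elim by (intro CJ.C_eq pow)
          also have "\<dots> \<le> CJ.prob (space N' - CJ.W i 1)"
            using i by (intro CJ.finite_measure_mono) (auto simp: CJ.W_def not_less)
          also have "\<dots> = 0" using CJ.prob_W[of i 1] i by (simp add: CJ.prob_compl)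
          finally have "CJ (\<lambda>i. u i powr (1 / t)) \<le> 0" .
          moreover have "0 \<le> CJ (\<lambda>i. u i powr (1 / t))" using CJ.C_eq[OF pow[OF u]] elim by simp
          ultimately show ?case using i finJ by auto
        qed
        then show ?thesis by (rule tendsto_eventually)
      next
        case False
        then have u0: "0 < u i" "u i \<le> 1" if "i \<in> J" for i using u that unfolding unit_cube_def by force+
        define v where "v i = - ln (u i)" for i
        have v: "0 \<le> v i" "exp (- v i) = u i" if "i \<in> J" for i using u0[OF that] unfolding v_def by auto
        have "exp (- l (on_coords J v)) = (\<Prod>i\<in>J. exp (- v i))"
          using add v finJ by (simp add: exp_sum sum_negf[symmetric])
        also have "\<dots> = (\<Prod>i\<in>J. u i)" using v by (intro prod.cong) auto
        finally have e: "exp (- l (on_coords J v)) = (\<Prod>i\<in>J. u i)" .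
        have "CJ (\<lambda>i. u i powr (1 / t)) = C (\<lambda>i. if i \<in> J then exp (- v i) powr (1 / t) else 1)" for t
          unfolding CJ_def using v by (intro arg_cong[of _ _ C]) auto
        then show ?thesis using C_powr_tendsto[of J v, OF J] v e by simp
      qed
    qed
    ultimately show "asymptotically_independent M J X"
      unfolding asymptotically_independent_def using CJ_of by blast
  qed
qed


section \<open>The two combination tests\<close>

lemma (in prob_space) no_atom_if_continuous_cdf:
  assumes [measurable]: "X \<in> borel_measurable M" and "continuous_on UNIV (cdf (distr M borel X))"
  shows "prob {\<omega> \<in> space M. X \<omega> = x} = 0" "AE \<omega> in M. X \<omega> \<noteq> x"
proof -
  interpret D: real_distribution "distr M borel X" by (rule real_distribution_distr) measurable
  have "measure (distr M borel X) {x} = 0"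
    using assms(2) D.isCont_cdf by (simp add: continuous_on_eq_continuous_at)
  then show 0: "prob {\<omega> \<in> space M. X \<omega> = x} = 0"
    by (simp add: measure_distr vimage_def Int_def conj_commute)
  show "AE \<omega> in M. X \<omega> \<noteq> x"
    by (rule AE_I[of _ _ "{\<omega> \<in> space M. X \<omega> = x}"]) (use 0 in \<open>auto simp: emeasure_eq_measure\<close>)
qed

text \<open>
  The heavy-tail condition on a transformed p-value says that its distribution function is regularly
  varying at 0.
\<close>
lemma (in prob_space) heavy_rv_at_0:
  assumes [measurable]: "X \<in> borel_measurable M" and range: "\<And>\<omega>. \<omega> \<in> space M \<Longrightarrow> X \<omega> \<in> {0..1}"
    and cont: "continuous_on UNIV (cdf (distr M borel X))"
    and F: "F \<in> RV 1" and K: "cdf (distr M borel (\<lambda>\<omega>. quantile F (1 - X \<omega>))) \<in> RV \<beta>"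
  shows "rv_at_0 \<beta> (\<lambda>t. prob {\<omega> \<in> space M. X \<omega> < t})"
proof -
  let ?g = "\<lambda>t. prob {\<omega> \<in> space M. X \<omega> < t}"
  let ?K = "cdf (distr M borel (\<lambda>\<omega>. quantile F (1 - X \<omega>)))"
  note cF = RV_is_cdf[OF F]
  have [measurable]: "quantile F \<in> borel_measurable borel" by (rule measurable_quantile[OF cF])
  have eq: "1 - ?K x = ?g (1 - F x)" for x
  proof -
    have "?K x = prob {\<omega> \<in> space M. quantile F (1 - X \<omega>) \<le> x}"
      unfolding cdf_def by (simp add: measure_distr vimage_def Int_def conj_commute)
    then have "1 - ?K x = prob {\<omega> \<in> space M. \<not> quantile F (1 - X \<omega>) \<le> x}"
      by (simp add: prob_neg)
    also have "\<dots> = ?g (1 - F x)"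
    proof (rule finite_measure_eq_AE)
      show "AE \<omega> in M. \<omega> \<in> {\<omega> \<in> space M. \<not> quantile F (1 - X \<omega>) \<le> x} \<longleftrightarrow> \<omega> \<in> {\<omega> \<in> space M. X \<omega> < 1 - F x}"
        using no_atom_if_continuous_cdf(2)[OF assms(1) cont, of 0] no_atom_if_continuous_cdf(2)[OF assms(1) cont, of 1] AE_space
      proof eventually_elim
        case (elim \<omega>)
        then have "0 < 1 - X \<omega>" "1 - X \<omega> < 1" using range[of \<omega>] by auto
        then show ?case using quantile_le_iff[OF cF, of "1 - X \<omega>" x] by auto
      qed
    qed measurable
    finally show ?thesis .
  qed
  show ?thesis
  proof (rule rv_at_0_from_tail[OF _ F])
    show "mono ?g" by (intro monoI finite_measure_mono) auto
    show "((\<lambda>x. ?g (1 - F (r * x)) / ?g (1 - F x)) \<longlongrightarrow> r powr (- \<beta>)) at_top" if "0 < r" for r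
      using RV_tail[OF K that] unfolding eq .
    show "0 < ?g t" if "0 < t" for t
    proof -
      have "eventually (\<lambda>x. 1 - F x < t) at_top"
        using order_tendstoD(2)[OF cdf_tail_0[OF cF]] that by simp
      then obtain x where "1 - F x < t" using eventually_happens'[OF trivial_limit_at_top_linorder] by blast
      then have "?g (1 - F x) \<le> ?g t" by (intro finite_measure_mono) auto
      moreover have "0 < ?g (1 - F x)" using RV_less_1[OF K, of x] eq[of x] by linarith
      ultimately show ?thesis by linarith
    qed
  qed
qed

text \<open>
  The distribution function may still have an atom at the left end point \<open>e\<close> of its support, as
  continuity is only required on \<open>{e..}\<close>.
\<close>
lemma RV_starE:
  assumes "F \<in> RV_star \<gamma>"
  obtains e where "\<And>y. y < e \<Longrightarrow> F y = 0" "quantile F 0 = e" "continuous_on {e..} F" "strict_mono_on {e..} F"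
proof -
  from assms obtain e where F: "F \<in> RV \<gamma>" and e: "cdf_support F = {e..}" "continuous_on {e..} F" "strict_mono_on {e..} F"
    unfolding RV_star_def by auto
  have cF: "is_cdf F" using F by (rule RV_is_cdf)
  note F' = is_cdfD[OF cF]
  have "F y = 0" if y: "y < e" for y
  proof (rule ccontr)
    assume "F y \<noteq> 0"
    then have u: "0 < F y / 2" "F y / 2 < 1" "F y / 2 \<le> F y" using F'(2)[of y] F'(3)[of y] by auto
    let ?q = "quantile F (F y / 2)"
    have q: "?q \<le> x \<longleftrightarrow> F y / 2 \<le> F x" for x using quantile_le_iff[OF cF u(1,2)] .
    have "?q \<in> cdf_support F" unfolding cdf_support_def
    proof (intro CollectI allI impI)
      fix d :: real assume "0 < d"
      then have "F (?q - d) < F y / 2" "F y / 2 \<le> F (?q + d)" using q[of "?q - d"] q[of "?q + d"] by auto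
      then show "F (?q - d) < F (?q + d)" by linarith
    qed
    then show False using e(1) q[of y] u(3) y by auto
  qed
  moreover have "quantile F 0 = e" unfolding quantile_def using e(1) by simp
  ultimately show ?thesis using that e by blast
qed

lemma at_right_0I:
  assumes "(f \<longlongrightarrow> 0) \<F>" "eventually (\<lambda>x. 0 < f x) \<F>" shows "filterlim f (at_right (0::real)) \<F>"
  using assms by (auto simp: filterlim_at elim: eventually_mono)

text \<open>
  P-values with an MRV copula, all of whose distribution functions are near 0 asymptotically multiples
  \<open>c i\<close> (possibly zero) of one function \<open>g\<close> that is regularly varying with index \<open>\<beta>\<close>; and a
  distribution function \<open>F\<close> with tail index \<open>\<gamma>\<close> and support \<open>{e..}\<close>.
\<close>
locale pvalue_tails = M: prob_space M + mrv_space N "{1..n}" C l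
  for M :: "'a measure" and N :: "(nat \<Rightarrow> real) measure" and n C l +
  fixes P :: "nat \<Rightarrow> 'a \<Rightarrow> real" and w c :: "nat \<Rightarrow> real" and g F :: "real \<Rightarrow> real" and \<beta> \<gamma> e :: real
  assumes P_meas [measurable]: "\<And>i. i \<in> {1..n} \<Longrightarrow> P i \<in> borel_measurable M"
    and P_range: "\<And>i \<omega>. i \<in> {1..n} \<Longrightarrow> \<omega> \<in> space M \<Longrightarrow> P i \<omega> \<in> {0..1}"
    and no_atom: "\<And>i x. i \<in> {1..n} \<Longrightarrow> AE \<omega> in M. P i \<omega> \<noteq> x"
    and C_of: "copula_of M {1..n} (\<lambda>i x. 1 - P i x) C"
    and w_pos: "\<And>i. i \<in> {1..n} \<Longrightarrow> 0 < w i"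
    and g: "rv_at_0 \<beta> g" and \<beta>: "0 < \<beta>" and g_lim: "(g \<longlongrightarrow> 0) (at_right 0)"
    and c: "\<And>i. i \<in> {1..n} \<Longrightarrow> ((\<lambda>t. M.prob {\<omega> \<in> space M. P i \<omega> < t} / g t) \<longlongrightarrow> c i) (at_right 0)"
    and c_pos: "\<exists>i\<in>{1..n}. 0 < c i"
    and F: "F \<in> RV \<gamma>" and \<gamma>: "0 < \<gamma>"
    and F_0: "\<And>y. y < e \<Longrightarrow> F y = 0" and quantile_0: "quantile F 0 = e"
    and F_cont: "continuous_on {e..} F" and F_strict: "strict_mono_on {e..} F"
begin

text \<open>
  The tail of \<open>F\<close>, with the left end point of the support moved to 0.
\<close>
definition S :: "real \<Rightarrow> real" where "S z = 1 - F (z + e)"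

text \<open>
  The common scale for the tails of the transformed p-values.
\<close>
definition h :: "real \<Rightarrow> real" where "h x = g (S x)"

text \<open>
  The distribution function of the \<open>i\<close>-th p-value.
\<close>
definition G :: "nat \<Rightarrow> real \<Rightarrow> real" where "G i t = M.prob {\<omega> \<in> space M. P i \<omega> < t}"

text \<open>
  The transformed p-value entering the combination test, shifted to be non-negative. On the null event
  where the p-value vanishes, the quantile has an arbitrary value and is replaced by 0.
\<close>
definition Y :: "nat \<Rightarrow> 'a \<Rightarrow> real" where
  "Y i \<omega> = (if P i \<omega> \<le> 0 then 0 else quantile F (max 0 (1 - P i \<omega> / w i)) - e)"

text \<open>
  The limit of \<open>P(x < Y i) / h x\<close>.
\<close>
definition a :: "nat \<Rightarrow> real" where "a i = c i * w i powr \<beta>"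

lemmas cF = RV_is_cdf[OF F]
lemmas cFD = is_cdfD[OF cF]

lemma g_pos: "0 < t \<Longrightarrow> 0 < g t"
  using g unfolding rv_at_0_def by auto

lemma S_pos: "0 < S z" using RV_less_1[OF F, of "z + e"] unfolding S_def by simp

lemma S_le_1: "S z \<le> 1" unfolding S_def using cFD(2)[of "z + e"] by simp

lemma S_antimono: "x \<le> y \<Longrightarrow> S y \<le> S x" unfolding S_def using monoD[OF cFD(1)] by simp

lemma S_strict: "0 \<le> x \<Longrightarrow> x < y \<Longrightarrow> S y < S x"
  unfolding S_def using strict_mono_onD[OF F_strict, of "x + e" "y + e"] by simp

lemma S_tendsto: "(S \<longlongrightarrow> 0) at_top"
proof -
  have "filterlim (\<lambda>x. x + e) at_top at_top" by real_asymp
  then have "((\<lambda>x. 1 - F (x + e)) \<longlongrightarrow> 0) at_top" by (rule filterlim_compose[OF cdf_tail_0[OF cF]])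
  then show ?thesis unfolding S_def .
qed

lemma S_at_right: "filterlim S (at_right 0) at_top"
  by (intro at_right_0I S_tendsto always_eventually allI S_pos)

lemma S_rv: "0 < r \<Longrightarrow> ((\<lambda>x. S (r * x) / S x) \<longlongrightarrow> r powr (- \<gamma>)) at_top"
  unfolding S_def by (rule RV_shift_tail[OF F])

lemma S_surj:
  assumes "0 < y" "y < S 0" shows "\<exists>z\<ge>0. S z = y"
proof -
  have "eventually (\<lambda>z. S z < y \<and> 0 \<le> z) at_top"
    using order_tendstoD(2)[OF S_tendsto assms(1)] eventually_ge_at_top by (rule eventually_conj)
  then obtain b where b: "S b < y" "0 \<le> b" using eventually_happens'[OF trivial_limit_at_top_linorder] by blast
  have "continuous_on {0..b} S" unfolding S_def
    by (intro continuous_on_diff continuous_on_const continuous_on_compose2[OF F_cont] continuous_on_add continuous_on_id) auto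
  then show ?thesis using IVT2'[of S b y 0] b assms by auto
qed

lemma h_pos: "0 < h x" unfolding h_def by (intro g_pos S_pos)

lemma h_at_right: "filterlim h (at_right 0) at_top"
  unfolding h_def using h_pos
  by (intro at_right_0I filterlim_compose[OF g_lim S_at_right] always_eventually) (auto simp: h_def)

lemma h_rv:
  assumes "0 < r" shows "((\<lambda>x. h (r * x) / h x) \<longlongrightarrow> r powr (- (\<gamma> * \<beta>))) at_top"
  using rv_at_0_ratio[OF g _ S_rv[OF assms] S_at_right] assms
  unfolding h_def by (simp add: powr_powr)

lemma G_ratio:
  assumes "i \<in> {1..n}" "0 < r" "((\<lambda>x. s x / b x) \<longlongrightarrow> r) \<F>" "filterlim b (at_right 0) \<F>"
  shows "((\<lambda>x. G i (s x) / g (b x)) \<longlongrightarrow> c i * r powr \<beta>) \<F>"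
proof -
  have b: "(b \<longlongrightarrow> 0) \<F>" "eventually (\<lambda>x. 0 < b x) \<F>"
    using assms(4) by (auto simp: filterlim_at eventually_conj_iff)
  have "((\<lambda>x. s x / b x * b x) \<longlongrightarrow> r * 0) \<F>" by (intro tendsto_mult assms b)
  moreover have "eventually (\<lambda>x. s x / b x * b x = s x) \<F>" using b(2) by eventually_elim auto
  ultimately have s0: "(s \<longlongrightarrow> 0) \<F>" using Lim_transform_eventually by fastforce
  have "eventually (\<lambda>x. 0 < s x / b x) \<F>" using assms(2,3) by (intro order_tendstoD)
  then have s1: "eventually (\<lambda>x. 0 < s x) \<F>" using b(2) by eventually_elim (auto simp: zero_less_divide_iff)
  have 1: "((\<lambda>x. G i (s x) / g (s x)) \<longlongrightarrow> c i) \<F>"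
    unfolding G_def using filterlim_compose[OF c[OF assms(1)] at_right_0I[OF s0 s1]] .
  have "((\<lambda>x. (G i (s x) / g (s x)) * (g (s x) / g (b x))) \<longlongrightarrow> c i * r powr \<beta>) \<F>"
    by (intro tendsto_mult 1 rv_at_0_ratio[OF g assms(2-4)])
  moreover have "eventually (\<lambda>x. (G i (s x) / g (s x)) * (g (s x) / g (b x)) = G i (s x) / g (b x)) \<F>"
    using s1
  proof eventually_elim
    case (elim x)
    then show ?case using g_pos[of "s x"] by simp
  qed
  ultimately show ?thesis by (rule Lim_transform_eventually)
qed

lemma c_nonneg: "i \<in> {1..n} \<Longrightarrow> 0 \<le> c i"
proof (rule tendsto_lowerbound[OF c])
  show "eventually (\<lambda>t. 0 \<le> M.prob {\<omega> \<in> space M. P i \<omega> < t} / g t) (at_right 0)"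
    using eventually_at_right_less[of 0] by eventually_elim (auto intro!: divide_nonneg_pos g_pos)
qed auto

lemma G_01: "0 \<le> G i t" "G i t \<le> 1" unfolding G_def by auto

lemma G_nonpos: "i \<in> {1..n} \<Longrightarrow> t \<le> 0 \<Longrightarrow> G i t = 0"
proof -
  assume i: "i \<in> {1..n}" "t \<le> 0"
  then have eq: "{\<omega> \<in> space M. P i \<omega> < t} = {}" using P_range[of i] by force
  show "G i t = 0" unfolding G_def eq by simp
qed

lemma prob_some_P_less: "M.prob {\<omega> \<in> space M. \<exists>i\<in>{1..n}. P i \<omega> < t i} = D (\<lambda>i. G i (t i))"
proof -
  have cdf: "cdf (distr M borel (\<lambda>x. 1 - P i x)) (1 - t i) = 1 - G i (t i)" if i: "i \<in> {1..n}" for i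
  proof -
    have [measurable]: "P i \<in> borel_measurable M" using i by (rule P_meas)
    have "cdf (distr M borel (\<lambda>x. 1 - P i x)) (1 - t i) = M.prob {\<omega> \<in> space M. \<not> P i \<omega> < t i}"
      unfolding cdf_def by (subst measure_distr) (auto intro!: arg_cong[of _ _ M.prob])
    also have "\<dots> = 1 - G i (t i)" unfolding G_def by (intro M.prob_neg) measurable
    finally show ?thesis .
  qed
  have ev: "{\<omega> \<in> space M. \<exists>i\<in>{1..n}. P i \<omega> < t i} \<in> sets M"
    by (intro sets.sets_Collect_finite_Ex) measurable
  have "1 - M.prob {\<omega> \<in> space M. \<exists>i\<in>{1..n}. P i \<omega> < t i} = M.prob {\<omega> \<in> space M. \<not> (\<exists>i\<in>{1..n}. P i \<omega> < t i)}"
    using M.prob_neg[OF ev] by simp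
  also have "{\<omega> \<in> space M. \<not> (\<exists>i\<in>{1..n}. P i \<omega> < t i)} = {\<omega> \<in> space M. \<forall>i\<in>{1..n}. 1 - P i \<omega> \<le> 1 - t i}"
    by (auto simp: not_less)
  also have "M.prob \<dots> = C (\<lambda>i. cdf (distr M borel (\<lambda>x. 1 - P i x)) (1 - t i))"
    by (rule spec[OF conjunct2[OF C_of[unfolded copula_of_def]], of "\<lambda>i. 1 - t i"])
  also have "\<dots> = C (\<lambda>i. 1 - G i (t i))"
    using cdf G_01 by (intro C_cong) (auto simp: unit_cube_def)
  finally show ?thesis unfolding D_def by simp
qed

lemma Y_nonneg: "i \<in> {1..n} \<Longrightarrow> 0 \<le> Y i \<omega>"
proof -
  assume i: "i \<in> {1..n}"
  show ?thesis
  proof (cases "0 < P i \<omega> \<and> P i \<omega> < w i")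
    case True
    define u where "u = 1 - P i \<omega> / w i"
    have u: "0 < u" "u < 1" using True w_pos[OF i] unfolding u_def by auto
    have "e \<le> quantile F u"
    proof (rule ccontr)
      assume "\<not> ?thesis"
      then show False using F_0[of "quantile F u"] quantile_le_iff[OF cF u, of "quantile F u"] u by auto
    qed
    then show ?thesis using True u unfolding Y_def u_def by (simp add: max_def)
  next
    case False
    then have "P i \<omega> \<le> 0 \<or> max 0 (1 - P i \<omega> / w i) = 0" using w_pos[OF i] by (auto simp: max_def field_simps)
    then show ?thesis unfolding Y_def using quantile_0 by auto
  qed
qed

lemma Y_gt_iff:
  assumes i: "i \<in> {1..n}" and "0 < P i \<omega>" "0 \<le> t"
  shows "t < Y i \<omega> \<longleftrightarrow> P i \<omega> < w i * S t"
proof (cases "P i \<omega> < w i")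
  case True
  define u where "u = 1 - P i \<omega> / w i"
  have u: "0 < u" "u < 1" using True assms(2) w_pos[OF i] unfolding u_def by auto
  have mx: "max 0 (1 - P i \<omega> / w i) = u" using u(1) unfolding u_def by simp
  have "t < Y i \<omega> \<longleftrightarrow> t < quantile F u - e" unfolding Y_def mx using assms(2) by simp
  also have "\<dots> \<longleftrightarrow> \<not> quantile F u \<le> t + e" by linarith
  finally have "t < Y i \<omega> \<longleftrightarrow> \<not> quantile F u \<le> t + e" .
  also have "\<dots> \<longleftrightarrow> F (t + e) < u" unfolding quantile_le_iff[OF cF u] by (rule not_le)
  also have "\<dots> \<longleftrightarrow> P i \<omega> / w i < S t" unfolding S_def u_def by linarith
  also have "\<dots> \<longleftrightarrow> P i \<omega> < w i * S t" using pos_divide_less_eq[OF w_pos[OF i]] by (simp add: mult.commute)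
  finally show ?thesis .
next
  case False
  then have "max 0 (1 - P i \<omega> / w i) = 0" using w_pos[OF i] by (auto simp: max_def field_simps)
  moreover have "w i * S t \<le> w i" using S_le_1[of t] w_pos[OF i] by simp
  ultimately show ?thesis using False assms quantile_0 unfolding Y_def by auto
qed

lemma quantile_measurable [measurable]: "quantile F \<in> borel_measurable borel"
  by (rule measurable_quantile[OF cF])

lemma F_measurable [measurable]: "F \<in> borel_measurable borel"
  by (rule borel_measurable_mono[OF cFD(1)])

lemma Y_measurable [measurable]: "i \<in> {1..n} \<Longrightarrow> Y i \<in> borel_measurable M"
  unfolding Y_def by measurable

lemma AE_P_pos: "AE \<omega> in M. \<forall>i\<in>{1..n}. 0 < P i \<omega>"
proof -
  have "AE \<omega> in M. 0 < P i \<omega>" if "i \<in> {1..n}" for i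
    using no_atom[OF that, of 0] AE_space
  proof eventually_elim
    case (elim \<omega>)
    then show ?case using P_range[OF that, of \<omega>] by auto
  qed
  then show ?thesis by (intro AE_finite_allI) auto
qed

text \<open>
  The exceedances of the transformed p-values are, up to a null event, lower tail events of the
  p-values; their joint probability is an instance of the dependence function \<open>D\<close>.
\<close>
lemma exceed_tendsto:
  assumes J: "J \<subseteq> {1..n}" and r: "\<And>i. i \<in> J \<Longrightarrow> 0 < r i"
  shows "((\<lambda>x. M.prob {\<omega> \<in> space M. \<exists>i\<in>J. r i * x < Y i \<omega>} / h x)
    \<longlongrightarrow> l (on_coords J (\<lambda>i. c i * (w i * r i powr (- \<gamma>)) powr \<beta>))) at_top"
proof -
  have finJ: "finite J" using J finite_subset by blast
  define t where "t x i = (if i \<in> J then w i * S (r i * x) else 0)" for x i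
  have 1: "((\<lambda>x. D (\<lambda>i. G i (t x i)) / h x) \<longlongrightarrow> l (on_coords J (\<lambda>i. c i * (w i * r i powr (- \<gamma>)) powr \<beta>))) at_top"
  proof (rule D_asymp[OF h_at_right])
    show "eventually (\<lambda>x. \<forall>i\<in>{1..n}. 0 \<le> G i (t x i) \<and> G i (t x i) \<le> 1) at_top" using G_01 by simp
    fix i assume i: "i \<in> {1..n}"
    show "0 \<le> on_coords J (\<lambda>i. c i * (w i * r i powr (- \<gamma>)) powr \<beta>) i" using c_nonneg[OF i] by (simp add: on_coords_def)
    show "((\<lambda>x. G i (t x i) / h x) \<longlongrightarrow> on_coords J (\<lambda>i. c i * (w i * r i powr (- \<gamma>)) powr \<beta>) i) at_top"
    proof (cases "i \<in> J")
      case True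
      have "((\<lambda>x. w i * (S (r i * x) / S x)) \<longlongrightarrow> w i * r i powr (- \<gamma>)) at_top"
        using True r by (intro tendsto_mult tendsto_const S_rv)
      then have "((\<lambda>x. G i (w i * S (r i * x)) / g (S x)) \<longlongrightarrow> c i * (w i * r i powr (- \<gamma>)) powr \<beta>) at_top"
        using w_pos[OF i] r[OF True] by (intro G_ratio[OF i _ _ S_at_right]) auto
      then show ?thesis using True by (simp add: t_def h_def on_coords_def)
    qed (use G_nonpos[OF i] in \<open>simp add: on_coords_def t_def\<close>)
  qed
  have "eventually (\<lambda>x. D (\<lambda>i. G i (t x i)) / h x = M.prob {\<omega> \<in> space M. \<exists>i\<in>J. r i * x < Y i \<omega>} / h x) at_top"
    using eventually_ge_at_top[of 0]
  proof eventually_elim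
    case (elim x)
    have "M.prob {\<omega> \<in> space M. \<exists>i\<in>J. r i * x < Y i \<omega>} = M.prob {\<omega> \<in> space M. \<exists>i\<in>{1..n}. P i \<omega> < t x i}"
    proof (rule M.finite_measure_eq_AE)
      show "AE \<omega> in M. \<omega> \<in> {\<omega> \<in> space M. \<exists>i\<in>J. r i * x < Y i \<omega>} \<longleftrightarrow> \<omega> \<in> {\<omega> \<in> space M. \<exists>i\<in>{1..n}. P i \<omega> < t x i}"
        using AE_P_pos
      proof eventually_elim
        case (elim \<omega>)
        have "r i * x < Y i \<omega> \<longleftrightarrow> P i \<omega> < t x i" if "i \<in> J" for i
          using Y_gt_iff[of i \<omega> "r i * x"] elim \<open>0 \<le> x\<close> r[OF that] that J unfolding t_def by auto
        moreover have "\<not> P i \<omega> < t x i" if "i \<in> {1..n} - J" for i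
          using bspec[OF elim, of i] that unfolding t_def by auto
        ultimately show ?case using J by blast
      qed
      show "{\<omega> \<in> space M. \<exists>i\<in>J. r i * x < Y i \<omega>} \<in> sets M"
      proof (intro sets.sets_Collect_finite_Ex finJ)
        fix i assume "i \<in> J"
        then have [measurable]: "Y i \<in> borel_measurable M" using J by auto
        show "{\<omega> \<in> space M. r i * x < Y i \<omega>} \<in> sets M" by measurable
      qed
      show "{\<omega> \<in> space M. \<exists>i\<in>{1..n}. P i \<omega> < t x i} \<in> sets M"
        by (intro sets.sets_Collect_finite_Ex) measurable
    qed
    then show ?case using prob_some_P_less[of "t x"] by simp
  qed
  with 1 show ?thesis by (rule Lim_transform_eventually)
qed

text \<open>
  Among several thresholds for the same coordinate only the smallest one matters.
\<close>
sublocale T: joint_tail M "{1..n}" Y h "\<gamma> * \<beta>"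
proof (unfold_locales)
  show "0 < \<gamma> * \<beta>" using \<gamma> \<beta> by simp
  show "eventually (\<lambda>x. 0 < h x) at_top" using h_pos by simp
  show "finite {1..n}" by simp
  show "Y i \<in> borel_measurable M" if "i \<in> {1..n}" for i using that by (rule Y_measurable)
  show "0 \<le> Y i \<omega>" if "i \<in> {1..n}" for i \<omega> using that by (rule Y_nonneg)
  show "((\<lambda>x. h (r * x) / h x) \<longlongrightarrow> r powr - (\<gamma> * \<beta>)) at_top" if "0 < r" for r using that by (rule h_rv)
  fix K :: "(nat \<times> real) set" assume K: "finite K" "K \<subseteq> {1..n} \<times> {0<..}"
  define J where "J = fst ` K"
  define r where "r i = Min {s. (i, s) \<in> K}" for i
  have fin: "finite {s. (i, s) \<in> K}" for i
  proof (rule finite_subset)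
    show "{s. (i, s) \<in> K} \<subseteq> snd ` K" by force
  qed (use K(1) in simp)
  have rK: "(i, r i) \<in> K" if "i \<in> J" for i
  proof -
    have "{s. (i, s) \<in> K} \<noteq> {}" using that unfolding J_def by auto
    from Min_in[OF fin this] show ?thesis unfolding r_def by simp
  qed
  have rmin: "r i \<le> s" if "(i, s) \<in> K" for i s
    unfolding r_def using that fin by (intro Min_le) auto
  have eq: "(\<exists>(i, s)\<in>K. s * x < Y i \<omega>) \<longleftrightarrow> (\<exists>i\<in>J. r i * x < Y i \<omega>)" if "0 \<le> x" for x \<omega>
  proof
    assume "\<exists>(i, s)\<in>K. s * x < Y i \<omega>"
    then obtain i s where i_s: "(i, s) \<in> K" "s * x < Y i \<omega>" by auto
    moreover have "r i * x \<le> s * x" using rmin[OF i_s(1)] that by (rule mult_right_mono)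
    ultimately show "\<exists>i\<in>J. r i * x < Y i \<omega>" unfolding J_def by force
  qed (use rK in blast)
  have lim: "((\<lambda>x. M.prob {\<omega> \<in> space M. \<exists>i\<in>J. r i * x < Y i \<omega>} / h x)
    \<longlongrightarrow> l (on_coords J (\<lambda>i. c i * (w i * r i powr (- \<gamma>)) powr \<beta>))) at_top"
  proof (rule exceed_tendsto)
    show "J \<subseteq> {1..n}" using K(2) unfolding J_def by auto
    show "0 < r i" if "i \<in> J" for i using subsetD[OF K(2) rK[OF that]] by simp
  qed
  have "eventually (\<lambda>x. M.prob {\<omega> \<in> space M. \<exists>i\<in>J. r i * x < Y i \<omega>} / h x
      = M.prob {\<omega> \<in> space M. \<exists>(i, r)\<in>K. r * x < Y i \<omega>} / h x) at_top"
    using eventually_ge_at_top[of 0] by eventually_elim (simp only: eq)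
  from Lim_transform_eventually[OF lim this]
  show "\<exists>a. ((\<lambda>x. M.prob {\<omega> \<in> space M. \<exists>(i, r)\<in>K. r * x < Y i \<omega>} / h x) \<longlongrightarrow> a) at_top" by blast
qed

lemma has_tail_exceed_1:
  assumes "J \<subseteq> {1..n}" shows "T.has_tail (T.exceed (J \<times> {1})) (l (on_coords J a))"
proof -
  have eq: "(\<exists>(i, r)\<in>J \<times> {1}. r * x < Y i \<omega>) \<longleftrightarrow> (\<exists>i\<in>J. 1 * x < Y i \<omega>)" for x \<omega> by auto
  have "(\<lambda>i. c i * (w i * 1 powr (- \<gamma>)) powr \<beta>) = a" unfolding a_def by simp
  then show ?thesis
    unfolding T.has_tail_def T.exceed_def eq using exceed_tendsto[OF assms, of "\<lambda>_. 1"] by (simp only: zero_less_one)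
qed

lemma a_nonneg: "i \<in> {1..n} \<Longrightarrow> 0 \<le> a i"
  unfolding a_def by (intro mult_nonneg_nonneg c_nonneg) simp_all

lemma has_tail_pair:
  assumes "i \<in> {1..n}" "j \<in> {1..n}" "i \<noteq> j"
  shows "T.has_tail (T.pair i j) (a i + a j - l (on_coords {i, j} a))"
proof -
  have lim: "T.has_tail (T.exceed ({k} \<times> {1})) (a k)" if "k \<in> {1..n}" for k
    using has_tail_exceed_1[of "{k}"] l_single[OF that, of a] a_nonneg[OF that] that by simp
  have ev: "T.exceed ({k} \<times> {1}) x \<in> sets M" if "k \<in> {1..n}" for k x
    using that by (intro T.exceed_events) auto
  have "M.prob (T.exceed ({i} \<times> {1}) x) + M.prob (T.exceed ({j} \<times> {1}) x) - M.prob (T.exceed ({i, j} \<times> {1}) x) = M.prob (T.pair i j x)" for x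
  proof -
    have "T.exceed ({i, j} \<times> {1}) x = T.exceed ({i} \<times> {1}) x \<union> T.exceed ({j} \<times> {1}) x"
      "T.pair i j x = T.exceed ({i} \<times> {1}) x \<inter> T.exceed ({j} \<times> {1}) x"
      unfolding T.exceed_def T.pair_def by auto
    then show ?thesis
      using measure_Un3[of "T.exceed ({i} \<times> {1}) x" M "T.exceed ({j} \<times> {1}) x"] ev assms
      by (simp add: M.fmeasurable_eq_sets)
  qed
  then have eq: "M.prob (T.exceed ({i} \<times> {1}) x) / h x + M.prob (T.exceed ({j} \<times> {1}) x) / h x - M.prob (T.exceed ({i, j} \<times> {1}) x) / h x
     = M.prob (T.pair i j x) / h x" for x by (metis add_divide_distrib diff_divide_distrib)
  show ?thesis
    using tendsto_diff[OF tendsto_add[OF lim[OF assms(1), unfolded T.has_tail_def] lim[OF assms(2), unfolded T.has_tail_def]]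
      has_tail_exceed_1[of "{i, j}", unfolded T.has_tail_def]] assms
    unfolding eq T.has_tail_def by simp
qed

text \<open>
  For small \<open>\<alpha>\<close>, the combination test at level \<open>\<alpha>\<close> rejects when the average of the shifted
  variables \<open>Y i\<close> reaches \<open>z \<alpha>\<close>.
\<close>
definition z :: "real \<Rightarrow> real" where
  "z \<alpha> = (SOME z. 0 \<le> z \<and> S z = \<alpha> * real n powr (\<gamma> - 1))"

lemma n_pos: "0 < n" using c_pos by auto

lemma z_props:
  "eventually (\<lambda>\<alpha>. 0 \<le> z \<alpha> \<and> S (z \<alpha>) = \<alpha> * real n powr (\<gamma> - 1)) (at_right 0)"
proof -
  have "((\<lambda>\<alpha>. \<alpha> * real n powr (\<gamma> - 1)) \<longlongrightarrow> 0 * real n powr (\<gamma> - 1)) (at_right 0)"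
    by (intro tendsto_mult tendsto_ident_at tendsto_const)
  then have "eventually (\<lambda>\<alpha>. \<alpha> * real n powr (\<gamma> - 1) < S 0) (at_right 0)"
    using S_pos[of 0] by (intro order_tendstoD) auto
  then show ?thesis using eventually_at_right_less[of 0]
  proof eventually_elim
    case (elim \<alpha>)
    then have "\<exists>z. 0 \<le> z \<and> S z = \<alpha> * real n powr (\<gamma> - 1)" using S_surj[of "\<alpha> * real n powr (\<gamma> - 1)"] n_pos by auto
    then show ?case unfolding z_def by (rule someI_ex)
  qed
qed

lemma z_at_top: "filterlim z at_top (at_right 0)"
  unfolding filterlim_at_top
proof
  fix Z
  have "((\<lambda>\<alpha>. \<alpha> * real n powr (\<gamma> - 1)) \<longlongrightarrow> 0 * real n powr (\<gamma> - 1)) (at_right 0)"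
    by (intro tendsto_mult tendsto_ident_at tendsto_const)
  then have "eventually (\<lambda>\<alpha>. \<alpha> * real n powr (\<gamma> - 1) < S Z) (at_right 0)"
    using S_pos[of Z] by (intro order_tendstoD) auto
  then show "eventually (\<lambda>\<alpha>. Z \<le> z \<alpha>) (at_right 0)" using z_props
  proof eventually_elim
    case (elim \<alpha>)
    then show ?case using S_antimono[of "z \<alpha>" Z] by (cases "Z \<le> z \<alpha>") auto
  qed
qed

lemma nz_at_top: "filterlim (\<lambda>\<alpha>. real n * z \<alpha>) at_top (at_right 0)"
  using n_pos by (intro filterlim_tendsto_pos_mult_at_top[OF tendsto_const _ z_at_top]) auto

text \<open>
  The Bonferroni test at level \<open>\<alpha>\<close> is asymptotically the test rejecting when the largest transformed
  p-value exceeds \<open>n * z \<alpha>\<close>: the constant \<open>n powr (1 - \<gamma>)\<close> in the combined p-value makes the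
  two scales agree.
\<close>
lemma bon_tendsto:
  "((\<lambda>\<alpha>. M.prob {\<omega> \<in> space M. p_bon n w (\<lambda>i. P i \<omega>) \<le> \<alpha>} / h (real n * z \<alpha>)) \<longlongrightarrow> l a) (at_right 0)"
proof -
  let ?t = "\<lambda>\<alpha> i. \<alpha> * w i / real n"
  have lim: "((\<lambda>\<alpha>. D (\<lambda>i. G i (?t \<alpha> i)) / h (real n * z \<alpha>)) \<longlongrightarrow> l a) (at_right 0)"
  proof (rule D_asymp[OF filterlim_compose[OF h_at_right nz_at_top]])
    show "eventually (\<lambda>\<alpha>. \<forall>i\<in>{1..n}. 0 \<le> G i (?t \<alpha> i) \<and> G i (?t \<alpha> i) \<le> 1) (at_right 0)" using G_01 by simp
    fix i assume i: "i \<in> {1..n}"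
    show "0 \<le> a i" by (rule a_nonneg[OF i])
    have "((\<lambda>\<alpha>. S (real n * z \<alpha>) / S (z \<alpha>)) \<longlongrightarrow> real n powr (- \<gamma>)) (at_right 0)"
      using filterlim_compose[OF S_rv z_at_top, of "real n"] n_pos by simp
    then have "((\<lambda>\<alpha>. w i * real n powr (- \<gamma>) / (S (real n * z \<alpha>) / S (z \<alpha>))) \<longlongrightarrow> w i * real n powr (- \<gamma>) / real n powr (- \<gamma>)) (at_right 0)"
      using n_pos by (intro tendsto_divide tendsto_const) auto
    moreover have "eventually (\<lambda>\<alpha>. w i * real n powr (- \<gamma>) / (S (real n * z \<alpha>) / S (z \<alpha>)) = ?t \<alpha> i / S (real n * z \<alpha>)) (at_right 0)"
      using z_props
    proof eventually_elim
      case (elim \<alpha>)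
      have "real n powr (- \<gamma>) * real n powr (\<gamma> - 1) = 1 / real n"
      proof -
        have "real n powr (- \<gamma>) * real n powr (\<gamma> - 1) = real n powr (- 1)" by (simp flip: powr_add)
        then show ?thesis by (simp add: powr_minus_divide)
      qed
      then have "w i * real n powr (- \<gamma>) * S (z \<alpha>) = ?t \<alpha> i"
        using elim by (simp add: mult_ac)
      then show ?case by simp
    qed
    ultimately have "((\<lambda>\<alpha>. ?t \<alpha> i / S (real n * z \<alpha>)) \<longlongrightarrow> w i * real n powr (- \<gamma>) / real n powr (- \<gamma>)) (at_right 0)"
      by (rule Lim_transform_eventually)
    then have "((\<lambda>\<alpha>. ?t \<alpha> i / S (real n * z \<alpha>)) \<longlongrightarrow> w i) (at_right 0)" using n_pos by simp
    then show "((\<lambda>\<alpha>. G i (?t \<alpha> i) / h (real n * z \<alpha>)) \<longlongrightarrow> a i) (at_right 0)"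
      unfolding a_def h_def using w_pos[OF i]
      by (intro G_ratio i filterlim_compose[OF S_at_right nz_at_top])
  qed
  have "eventually (\<lambda>\<alpha>::real. \<alpha> < 1) (at_right 0)"
    by (rule order_tendstoD[OF tendsto_ident_at]) simp
  then have "eventually (\<lambda>\<alpha>. D (\<lambda>i. G i (?t \<alpha> i)) / h (real n * z \<alpha>) =
      M.prob {\<omega> \<in> space M. p_bon n w (\<lambda>i. P i \<omega>) \<le> \<alpha>} / h (real n * z \<alpha>)) (at_right 0)"
  proof eventually_elim
    case (elim \<alpha>)
    have bon: "p_bon n w (\<lambda>i. P i \<omega>) \<le> \<alpha> \<longleftrightarrow> (\<exists>i\<in>{1..n}. P i \<omega> \<le> ?t \<alpha> i)" for \<omega>
    proof -
      have "p_bon n w (\<lambda>i. P i \<omega>) \<le> \<alpha> \<longleftrightarrow> (MIN i\<in>{1..n}. P i \<omega> / w i) \<le> \<alpha> / real n"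
        unfolding p_bon_def using elim n_pos by (auto simp: min_le_iff_disj field_simps)
      also have "\<dots> \<longleftrightarrow> (\<exists>i\<in>{1..n}. P i \<omega> / w i \<le> \<alpha> / real n)"
        using n_pos by (subst Min_le_iff) auto
      also have "\<dots> \<longleftrightarrow> (\<exists>i\<in>{1..n}. P i \<omega> \<le> ?t \<alpha> i)"
        using w_pos by (intro bex_cong refl) (auto simp: field_simps)
      finally show ?thesis .
    qed
    have na: "AE \<omega> in M. \<forall>i\<in>{1..n}. P i \<omega> \<noteq> ?t \<alpha> i"
      by (intro AE_finite_allI no_atom) auto
    have "M.prob {\<omega> \<in> space M. p_bon n w (\<lambda>i. P i \<omega>) \<le> \<alpha>} = M.prob {\<omega> \<in> space M. \<exists>i\<in>{1..n}. P i \<omega> < ?t \<alpha> i}"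
      unfolding bon
    proof (rule M.finite_measure_eq_AE)
      show "AE \<omega> in M. \<omega> \<in> {\<omega> \<in> space M. \<exists>i\<in>{1..n}. P i \<omega> \<le> ?t \<alpha> i} \<longleftrightarrow> \<omega> \<in> {\<omega> \<in> space M. \<exists>i\<in>{1..n}. P i \<omega> < ?t \<alpha> i}"
        using na by eventually_elim (fastforce simp: le_less)
    qed (intro sets.sets_Collect_finite_Ex; measurable)+
    then show ?case using prob_some_P_less[of "?t \<alpha>"] by simp
  qed
  with lim show ?thesis by (rule Lim_transform_eventually)
qed

lemma comb_eq_total:
  "eventually (\<lambda>\<alpha>. M.prob (T.total (real n * z \<alpha>)) = M.prob {\<omega> \<in> space M. p_comb n \<gamma> F w (\<lambda>i. P i \<omega>) \<le> \<alpha>}) (at_right 0)"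
proof -
  have "eventually (\<lambda>\<alpha>::real. \<alpha> < 1) (at_right 0)"
    by (rule order_tendstoD[OF tendsto_ident_at]) simp
  then show ?thesis using z_props
  proof eventually_elim
    case (elim \<alpha>)
    then have zp: "0 \<le> z \<alpha>" "S (z \<alpha>) = \<alpha> * real n powr (\<gamma> - 1)" by auto
    show ?case
    proof (rule M.finite_measure_eq_AE)
      show "AE \<omega> in M. \<omega> \<in> T.total (real n * z \<alpha>) \<longleftrightarrow> \<omega> \<in> {\<omega> \<in> space M. p_comb n \<gamma> F w (\<lambda>i. P i \<omega>) \<le> \<alpha>}"
        using AE_P_pos
      proof eventually_elim
        case (elim \<omega>)
        let ?X = "comb_stat n F w (\<lambda>i. P i \<omega>)"
        have pos: "\<not> P i \<omega> \<le> 0" if "i \<in> {1..n}" for i using bspec[OF elim that] by simp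
        have "(\<Sum>i=1..n. Y i \<omega>) = (\<Sum>i=1..n. quantile F (max 0 (1 - P i \<omega> / w i)) - e)"
          unfolding Y_def by (intro sum.cong refl) (use pos in simp)
        also have "\<dots> = real n * (?X - e)"
          unfolding comb_stat_def using n_pos by (simp add: sum_subtractf field_simps)
        finally have X: "(\<Sum>i=1..n. Y i \<omega>) = real n * (?X - e)" .
        have "0 \<le> (\<Sum>i=1..n. Y i \<omega>)" by (intro sum_nonneg Y_nonneg)
        then have X0: "0 \<le> ?X - e" unfolding X using n_pos by (simp add: zero_le_mult_iff)
        have "p_comb n \<gamma> F w (\<lambda>i. P i \<omega>) \<le> \<alpha> \<longleftrightarrow> real n powr (1 - \<gamma>) * S (?X - e) \<le> \<alpha>"
          unfolding p_comb_def S_def using \<open>\<alpha> < 1\<close> by (auto simp: min_le_iff_disj)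
        also have "\<dots> \<longleftrightarrow> S (?X - e) \<le> \<alpha> * real n powr (\<gamma> - 1)"
        proof -
          have ab: "real n powr (1 - \<gamma>) * real n powr (\<gamma> - 1) = 1" "0 < real n powr (1 - \<gamma>)"
            using n_pos by (simp_all flip: powr_add)
          have eq: "real n powr (1 - \<gamma>) * (\<alpha> * real n powr (\<gamma> - 1)) = \<alpha>"
            using ab(1) by (simp add: mult.left_commute)
          show ?thesis
            using mult_le_cancel_left_pos[OF ab(2), of "S (?X - e)" "\<alpha> * real n powr (\<gamma> - 1)"] unfolding eq .
        qed
        also have "\<dots> \<longleftrightarrow> S (?X - e) \<le> S (z \<alpha>)" using zp by simp
        also have "\<dots> \<longleftrightarrow> z \<alpha> \<le> ?X - e"
          using S_antimono[of "z \<alpha>" "?X - e"] S_strict[OF X0, of "z \<alpha>"] by linarith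
        also have "\<dots> \<longleftrightarrow> real n * z \<alpha> \<le> (\<Sum>i=1..n. Y i \<omega>)" unfolding X using n_pos by simp
        finally show ?case unfolding T.total_def by auto
      qed
      have [measurable]: "(\<lambda>\<omega>. comb_stat n F w (\<lambda>i. P i \<omega>)) \<in> borel_measurable M"
        unfolding comb_stat_def by measurable
      show "{\<omega> \<in> space M. p_comb n \<gamma> F w (\<lambda>i. P i \<omega>) \<le> \<alpha>} \<in> sets M"
        unfolding p_comb_def by measurable
    qed measurable
  qed
qed

text \<open>
  Both rejection probabilities are compared with \<open>h (n * z \<alpha>)\<close>: for the combination test the limit
  is that of the sum reaching a level, for the Bonferroni test that of the maximum exceeding it.
\<close>
lemma ratio_tendsto:
  "\<exists>L. ((\<lambda>\<alpha>. M.prob {\<omega> \<in> space M. p_comb n \<gamma> F w (\<lambda>i. P i \<omega>) \<le> \<alpha>} / M.prob {\<omega> \<in> space M. p_bon n w (\<lambda>i. P i \<omega>) \<le> \<alpha>})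
      \<longlongrightarrow> L) (at_right 0) \<and> 1 \<le> L \<and>
    (1 < L \<longleftrightarrow> (\<exists>i\<in>{1..n}. \<exists>j\<in>{1..n}. i \<noteq> j \<and> l (on_coords {i, j} a) < a i + a j))"
proof -
  obtain \<Lambda> where \<Lambda>: "T.has_tail T.total \<Lambda>" using T.total_has_tail by blast
  have a_on: "l (on_coords {1..n} a) = l a"
    by (rule tendsto_unique[OF trivial_limit_at_right_real D_lim_on[of "{1..n}" a]])
       (use a_nonneg in \<open>auto intro!: Lim_transform_eventually[OF D_lim[of a]] eventually_mono[OF scaled_01[of a]] D_cong simp: on_coords_def\<close>)
  have b: "T.has_tail (T.exceed ({1..n} \<times> {1})) (l a)"
    using has_tail_exceed_1[of "{1..n}"] unfolding a_on by simp
  obtain i0 where i0: "i0 \<in> {1..n}" "0 < c i0" using c_pos by blast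
  have "0 < a i0" unfolding a_def using i0(2) w_pos[OF i0(1)] by simp
  also have "a i0 \<le> l a" using a_nonneg i0 by (intro l_ge)
  finally have b0: "0 < l a" .
  have le: "l a \<le> \<Lambda>" by (rule T.has_tail_mono[OF b \<Lambda> T.exceed_subset_total T.total_events])
  have iff: "l a < \<Lambda> \<longleftrightarrow> (\<exists>i\<in>{1..n}. \<exists>j\<in>{1..n}. i \<noteq> j \<and> l (on_coords {i, j} a) < a i + a j)"
  proof
    assume less: "l a < \<Lambda>"
    show "\<exists>i\<in>{1..n}. \<exists>j\<in>{1..n}. i \<noteq> j \<and> l (on_coords {i, j} a) < a i + a j"
    proof (rule ccontr)
      assume neg: "\<not> ?thesis"
      have "T.has_tail (T.pair i j) 0" if "i \<in> {1..n}" "j \<in> {1..n}" "i \<noteq> j" for i j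
      proof -
        have "a i + a j - l (on_coords {i, j} a) \<le> 0" using neg that by force
        moreover have "0 \<le> a i + a j - l (on_coords {i, j} a)"
          using T.has_tail_nonneg[OF has_tail_pair[OF that]] .
        ultimately show ?thesis using has_tail_pair[OF that] by simp
      qed
      then have "\<Lambda> \<le> l a" by (intro T.total_le_if_pairs_negligible[OF \<Lambda> b])
      then show False using less by simp
    qed
  next
    assume "\<exists>i\<in>{1..n}. \<exists>j\<in>{1..n}. i \<noteq> j \<and> l (on_coords {i, j} a) < a i + a j"
    then obtain i j where ij: "i \<in> {1..n}" "j \<in> {1..n}" "i \<noteq> j" "l (on_coords {i, j} a) < a i + a j" by blast
    then show "l a < \<Lambda>"
      by (intro T.total_gt_if_pair_not_negligible[OF \<Lambda> b ij(1-3) has_tail_pair[OF ij(1-3)]]) simp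
  qed
  have "((\<lambda>\<alpha>. M.prob (T.total (real n * z \<alpha>)) / h (real n * z \<alpha>)) \<longlongrightarrow> \<Lambda>) (at_right 0)"
    using filterlim_compose[OF \<Lambda>[unfolded T.has_tail_def] nz_at_top] .
  then have 1: "((\<lambda>\<alpha>. M.prob {\<omega> \<in> space M. p_comb n \<gamma> F w (\<lambda>i. P i \<omega>) \<le> \<alpha>} / h (real n * z \<alpha>)) \<longlongrightarrow> \<Lambda>) (at_right 0)"
    by (rule Lim_transform_eventually) (use comb_eq_total in eventually_elim, simp)
  have "h x \<noteq> 0" for x using h_pos[of x] by simp
  then have lim: "((\<lambda>\<alpha>. M.prob {\<omega> \<in> space M. p_comb n \<gamma> F w (\<lambda>i. P i \<omega>) \<le> \<alpha>} / M.prob {\<omega> \<in> space M. p_bon n w (\<lambda>i. P i \<omega>) \<le> \<alpha>})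
      \<longlongrightarrow> \<Lambda> / l a) (at_right 0)"
    using tendsto_divide[OF 1 bon_tendsto] b0 by simp
  show ?thesis using le iff b0 by (intro exI[of _ "\<Lambda> / l a"] conjI lim) auto
qed

end


section \<open>Dominating signals and the comparison theorem\<close>

lemma (in prob_space) succ_signal_trans:
  assumes "succ_signal M X Y" "succ_signal M Y Z" shows "succ_signal M X Z"
proof -
  let ?G = "\<lambda>X t. prob {\<omega> \<in> space M. X \<omega> < t}"
  have lim: "((\<lambda>t. (?G X t / ?G Y t) * (?G Y t / ?G Z t)) \<longlongrightarrow> 0 * 0) (at_right 0)"
    using assms unfolding succ_signal_def by (intro tendsto_mult) auto
  have "eventually (\<lambda>t. (?G X t / ?G Y t) * (?G Y t / ?G Z t) = ?G X t / ?G Z t) (at_right 0)"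
    using eventually_at_right_less[of 0] by eventually_elim (use assms in \<open>simp add: succ_signal_def\<close>)
  from Lim_transform_eventually[OF lim this] show ?thesis
    using assms(2) unfolding succ_signal_def by simp
qed

lemma (in prob_space) not_succ_signal_refl: "\<not> succ_signal M X X"
proof
  let ?G = "\<lambda>t. prob {\<omega> \<in> space M. X \<omega> < t}"
  assume *: "succ_signal M X X"
  have "eventually (\<lambda>t. ?G t / ?G t = 1) (at_right 0)"
    using eventually_at_right_less[of 0] by eventually_elim (use * in \<open>simp add: succ_signal_def\<close>)
  then have "((\<lambda>t. ?G t / ?G t) \<longlongrightarrow> 1) (at_right 0)" by (rule tendsto_eventually)
  moreover have "((\<lambda>t. ?G t / ?G t) \<longlongrightarrow> 0) (at_right 0)" using * unfolding succ_signal_def by blast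
  ultimately show False using tendsto_unique[OF trivial_limit_at_right_real] by fastforce
qed

text \<open>
  Domination is a strict partial order on finitely many indices, so every index that is not maximal
  is dominated by a maximal one.
\<close>
lemma (in prob_space) dominated_by_dominating_signal:
  assumes "i \<in> {1..n}" "i \<notin> dominating_signals M n P"
  shows "\<exists>k\<in>dominating_signals M n P. succ_signal M (P i) (P k)"
proof -
  define r where "r = {(j, i). i \<in> {1..n} \<and> j \<in> {1..n} \<and> succ_signal M (P i) (P j)}"
  have "finite r" unfolding r_def by (rule finite_subset[of _ "{1..n} \<times> {1..n}"]) auto
  moreover have "trans r" unfolding r_def trans_def using succ_signal_trans by blast
  then have "acyclic r" using not_succ_signal_refl unfolding acyclic_def r_def by (simp add: trancl_id)
  ultimately have "wf r" by (rule finite_acyclic_wf)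
  then show ?thesis using assms
  proof (induction i)
    case (less i)
    then obtain j where j: "j \<in> {1..n}" "succ_signal M (P i) (P j)" unfolding dominating_signals_def by blast
    show ?case
    proof (cases "j \<in> dominating_signals M n P")
      case False
      have "(j, i) \<in> r" using less.prems j unfolding r_def by simp
      from less.IH[OF this j(1) False] show ?thesis using succ_signal_trans[OF j(2)] by blast
    qed (use j in blast)
  qed
qed

lemma (in prob_space) cdf_reflected_onto:
  assumes [measurable]: "X \<in> borel_measurable M" and range: "\<And>\<omega>. \<omega> \<in> space M \<Longrightarrow> X \<omega> \<in> {0..1}"
    and cont: "continuous_on UNIV (cdf (distr M borel X))" and u: "0 \<le> u" "u \<le> 1"
  shows "\<exists>x. cdf (distr M borel (\<lambda>\<omega>. 1 - X \<omega>)) x = u"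
proof -
  let ?F = "cdf (distr M borel (\<lambda>\<omega>. 1 - X \<omega>))"
  interpret D: real_distribution "distr M borel (\<lambda>\<omega>. 1 - X \<omega>)" by (rule real_distribution_distr) measurable
  have "measure (distr M borel (\<lambda>\<omega>. 1 - X \<omega>)) {x} = 0" for x
  proof -
    have "measure (distr M borel (\<lambda>\<omega>. 1 - X \<omega>)) {x} = prob {\<omega> \<in> space M. X \<omega> = 1 - x}"
      by (subst measure_distr) (auto intro!: arg_cong[of _ _ prob])
    then show ?thesis using no_atom_if_continuous_cdf(1)[OF assms(1) cont] by simp
  qed
  then have c: "continuous_on {-1..1} ?F"
    using D.isCont_cdf by (intro continuous_at_imp_continuous_on) auto
  have Feq: "?F x = prob {\<omega> \<in> space M. 1 - X \<omega> \<le> x}" for x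
    unfolding cdf_def by (subst measure_distr) (auto intro!: arg_cong[of _ _ prob])
  have e1: "{\<omega> \<in> space M. 1 - X \<omega> \<le> -1} = {}" using range by force
  have "?F (-1) = 0" unfolding Feq e1 by simp
  have e2: "{\<omega> \<in> space M. 1 - X \<omega> \<le> 1} = space M" using range by force
  have "?F 1 = 1" unfolding Feq e2 by (rule prob_space)
  then show ?thesis using IVT'[of ?F "-1" u 1] c u \<open>?F (-1) = 0\<close> by auto
qed

lemma (in prob_space) prob_less_tendsto_0:
  assumes [measurable]: "X \<in> borel_measurable M" and range: "\<And>\<omega>. \<omega> \<in> space M \<Longrightarrow> X \<omega> \<in> {0..1}"
    and cont: "continuous_on UNIV (cdf (distr M borel X))"
  shows "((\<lambda>t. prob {\<omega> \<in> space M. X \<omega> < t}) \<longlongrightarrow> 0) (at_right 0)"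
proof -
  let ?F = "cdf (distr M borel X)"
  have Feq: "?F x = prob {\<omega> \<in> space M. X \<omega> \<le> x}" for x
    unfolding cdf_def by (subst measure_distr) (auto intro!: arg_cong[of _ _ prob])
  have e: "{\<omega> \<in> space M. X \<omega> \<le> 0} = {\<omega> \<in> space M. X \<omega> = 0}" using range by force
  have "?F 0 = 0" unfolding Feq e by (rule no_atom_if_continuous_cdf(1)[OF assms(1) cont])
  moreover have "isCont ?F 0" using cont by (simp add: continuous_on_eq_continuous_at)
  ultimately have "(?F \<longlongrightarrow> 0) (at_right 0)" by (metis isCont_def filterlim_at_split)
  then show ?thesis
    by (rule Lim_null_comparison[rotated]) (auto intro!: always_eventually finite_measure_mono simp: Feq)
qed

text \<open>
  If \<open>l\<close> is not additive on \<open>J\<close>, some pair of coordinates has joint exceedances at some point \<open>v\<close>. By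
  homogeneity and monotonicity this holds at every point with positive coordinates; the factor \<open>k\<close>
  moves \<open>v\<close> below \<open>a\<close>.
\<close>
lemma (in mrv_space) pair_deficit_transfer:
  assumes J: "J \<subseteq> I" and a: "\<And>i. i \<in> J \<Longrightarrow> 0 < a i" and v: "\<And>i. i \<in> J \<Longrightarrow> 0 \<le> v i"
    and ne: "l (on_coords J v) \<noteq> (\<Sum>i\<in>J. v i)"
  shows "\<exists>i\<in>J. \<exists>j\<in>J. i \<noteq> j \<and> l (on_coords {i, j} a) < a i + a j"
proof -
  obtain i j where ij: "i \<in> J" "j \<in> J" "i \<noteq> j" "l (on_coords {i, j} v) < v i + v j"
    using l_sum_if_pairs[OF J v] ne by (meson not_le)
  define k where "k = min (a i / (v i + 1)) (a j / (v j + 1))"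
  have vi: "0 \<le> v i" "0 \<le> v j" using v ij by auto
  have k: "0 < k" unfolding k_def using a ij vi by simp
  have kv: "k * v m \<le> a m" if "m \<in> {i, j}" for m
  proof -
    have "0 \<le> v m" "0 < a m" using that vi a ij by auto
    have "k \<le> a m / (v m + 1)" unfolding k_def using that by auto
    then have "k * v m \<le> a m / (v m + 1) * v m" using \<open>0 \<le> v m\<close> by (rule mult_right_mono)
    also have "\<dots> \<le> a m" using \<open>0 \<le> v m\<close> \<open>0 < a m\<close> by (simp add: field_simps)
    finally show ?thesis .
  qed
  have "l (on_coords {i, j} (\<lambda>m. k * v m)) = k * l (on_coords {i, j} v)"
    unfolding on_coords_scale using vi by (intro l_scale k) (auto simp: on_coords_def)
  moreover have "k * l (on_coords {i, j} v) < k * (v i + v j)" using ij(4) k by simp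
  moreover have "k * v i + k * v j - l (on_coords {i, j} (\<lambda>m. k * v m)) \<le> a i + a j - l (on_coords {i, j} a)"
    using ij J vi k kv by (intro l_pair_mono) auto
  ultimately have "l (on_coords {i, j} a) < a i + a j" by (simp add: distrib_left)
  then show ?thesis using ij by blast
qed

theorem theorem4p4:
  fixes M :: "'a measure" and n :: nat and P :: "nat \<Rightarrow> 'a \<Rightarrow> real"
    and w :: "nat \<Rightarrow> real" and I :: "nat set" and \<gamma> :: real and F :: "real \<Rightarrow> real"
  assumes "prob_space M"
    and rv: "\<And>i. i \<in> {1..n} \<Longrightarrow> P i \<in> borel_measurable M"
    and range: "\<And>i x. i \<in> {1..n} \<Longrightarrow> x \<in> space M \<Longrightarrow> P i x \<in> {0..1}"
    and w_pos: "\<And>i. i \<in> {1..n} \<Longrightarrow> w i > 0"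
    and w_sum: "(\<Sum>i=1..n. w i) = real n"
    and I_def: "I = dominating_signals M n P"
    and cont: "\<And>i. i \<in> {1..n} \<Longrightarrow> continuous_on UNIV (cdf (distr M borel (P i)))"
    and mrv: "has_mrv_copula M {1..n} (\<lambda>i x. 1 - P i x)"
    and comparable: "\<And>i j. i \<in> I \<Longrightarrow> j \<in> I \<Longrightarrow> i \<noteq> j \<Longrightarrow>
      \<exists>L>0. ((\<lambda>t. \<P>(x in M. P i x < t) / \<P>(x in M. P j x < t)) \<longlongrightarrow> L) (at_right 0)"
    and heavy: "\<exists>i\<in>I. \<exists>F\<^sub>0\<in>RV 1. \<exists>\<beta>. 0 < \<beta> \<and> \<beta> \<le> 1 \<and>
      cdf (distr M borel (\<lambda>x. quantile F\<^sub>0 (1 - P i x))) \<in> RV \<beta>"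
    and "\<gamma> > 0"
    and "F \<in> RV_star \<gamma>"
  shows "\<exists>L::real.
    ((\<lambda>\<alpha>. \<P>(x in M. p_comb n \<gamma> F w (\<lambda>i. P i x) \<le> \<alpha>) / \<P>(x in M. p_bon n w (\<lambda>i. P i x) \<le> \<alpha>))
       \<longlongrightarrow> L) (at_right 0) \<and>
    L \<ge> 1 \<and>
    (L > 1 \<longleftrightarrow> card I \<ge> 2 \<and> \<not> asymptotically_independent M I (\<lambda>i x. 1 - P i x))"
proof -
  interpret M: prob_space M by fact
  have I_sub: "I \<subseteq> {1..n}" unfolding I_def dominating_signals_def by auto
  define G where "G i t = M.prob {\<omega> \<in> space M. P i \<omega> < t}" for i t
  obtain i0 F0 \<beta> where i0: "i0 \<in> I" and F0: "F0 \<in> RV 1" and \<beta>: "0 < \<beta>"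
    and heavy0: "cdf (distr M borel (\<lambda>x. quantile F0 (1 - P i0 x))) \<in> RV \<beta>" using heavy by blast
  have i0n: "i0 \<in> {1..n}" using i0 I_sub by blast
  have g: "rv_at_0 \<beta> (G i0)"
    unfolding G_def by (rule M.heavy_rv_at_0[OF rv[OF i0n] range[OF i0n] cont[OF i0n] F0 heavy0])
  have g_pos: "G i0 t \<noteq> 0" if "0 < t" for t using g that unfolding rv_at_0_def by (metis less_irrefl)
  \<comment> \<open>relative to \<open>i0\<close>, the dominating signals have positive tail constants and the others have none\<close>
  have pos_lim: "\<exists>c>0. ((\<lambda>t. G i t / G i0 t) \<longlongrightarrow> c) (at_right 0)" if "i \<in> I" for i
  proof (cases "i = i0")
    case True
    have "eventually (\<lambda>t. G i0 t / G i0 t = 1) (at_right 0)"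
      using eventually_at_right_less[of 0] by eventually_elim (use g_pos in simp)
    then show ?thesis unfolding True by (intro exI[of _ 1] conjI tendsto_eventually) auto
  next
    case False
    then show ?thesis using comparable[OF that i0] unfolding G_def by blast
  qed
  have zero_lim: "((\<lambda>t. G i t / G i0 t) \<longlongrightarrow> 0) (at_right 0)" if i: "i \<in> {1..n}" "i \<notin> I" for i
  proof -
    obtain k where k: "k \<in> I" "succ_signal M (P i) (P k)"
      using M.dominated_by_dominating_signal[of i n P] i unfolding I_def by blast
    obtain c where c: "((\<lambda>t. G k t / G i0 t) \<longlongrightarrow> c) (at_right 0)" using pos_lim[OF k(1)] by blast
    have k': "\<And>t. 0 < t \<Longrightarrow> G k t \<noteq> 0" "((\<lambda>t. G i t / G k t) \<longlongrightarrow> 0) (at_right 0)"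
      using k(2) unfolding succ_signal_def G_def by auto
    have lim: "((\<lambda>t. (G i t / G k t) * (G k t / G i0 t)) \<longlongrightarrow> 0 * c) (at_right 0)"
      by (intro tendsto_mult k' c)
    have "eventually (\<lambda>t. (G i t / G k t) * (G k t / G i0 t) = G i t / G i0 t) (at_right 0)"
      using eventually_at_right_less[of 0] by eventually_elim (use k' in simp)
    from Lim_transform_eventually[OF lim this] show ?thesis by simp
  qed
  have "\<forall>i\<in>{1..n}. \<exists>c. ((\<lambda>t. G i t / G i0 t) \<longlongrightarrow> c) (at_right 0) \<and> (if i \<in> I then 0 < c else c = 0)"
    using pos_lim zero_lim by metis
  from bchoice[OF this] obtain c where c: "\<And>i. i \<in> {1..n} \<Longrightarrow> ((\<lambda>t. G i t / G i0 t) \<longlongrightarrow> c i) (at_right 0)"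
    and c_I: "\<And>i. i \<in> {1..n} \<Longrightarrow> if i \<in> I then 0 < c i else c i = 0" by blast
  obtain C where C: "copula_of M {1..n} (\<lambda>i x. 1 - P i x) C" "mrv_copula {1..n} C"
    using mrv unfolding has_mrv_copula_def by blast
  then obtain l where copC: "copula {1..n} C" and l: "\<And>v. (\<forall>i\<in>{1..n}. 0 \<le> v i) \<Longrightarrow>
      ((\<lambda>s. (1 - C (\<lambda>i. 1 - s * v i)) / s) \<longlongrightarrow> l v) (at_right 0)"
    unfolding mrv_copula_def by blast
  obtain N where "copula_space N {1..n} C" using copula_space_exists[OF _ copC] by auto
  then interpret N: copula_space N "{1..n}" C .
  interpret N: mrv_space N "{1..n}" C l by unfold_locales (use l in blast)
  obtain e where e: "\<And>y. y < e \<Longrightarrow> F y = 0" "quantile F 0 = e" "continuous_on {e..} F" "strict_mono_on {e..} F"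
    using RV_starE[OF \<open>F \<in> RV_star \<gamma>\<close>] by blast
  interpret T: pvalue_tails M N n C l P w c "G i0" F \<beta> \<gamma> e
  proof unfold_locales
    show "AE \<omega> in M. P i \<omega> \<noteq> x" if "i \<in> {1..n}" for i x
      using M.no_atom_if_continuous_cdf(2)[OF rv[OF that] cont[OF that]] .
    show "(G i0 \<longlongrightarrow> 0) (at_right 0)"
      unfolding G_def by (rule M.prob_less_tendsto_0[OF rv[OF i0n] range[OF i0n] cont[OF i0n]])
    show "((\<lambda>t. M.prob {\<omega> \<in> space M. P i \<omega> < t} / G i0 t) \<longlongrightarrow> c i) (at_right 0)" if "i \<in> {1..n}" for i
      using c[OF that] unfolding G_def[of i] .
    show "\<exists>i\<in>{1..n}. 0 < c i" using c_I[OF i0n] i0 i0n by auto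
    show "F \<in> RV \<gamma>" using \<open>F \<in> RV_star \<gamma>\<close> unfolding RV_star_def by blast
  qed (fact rv range C(1) w_pos g \<beta> \<open>\<gamma> > 0\<close> e)+
  have a_I: "if i \<in> I then 0 < T.a i else T.a i = 0" if "i \<in> {1..n}" for i
    using c_I[OF that] w_pos[OF that] unfolding T.a_def by auto
  have AI: "asymptotically_independent M I (\<lambda>i x. 1 - P i x) \<longleftrightarrow>
    (\<forall>v. (\<forall>i\<in>I. 0 \<le> v i) \<longrightarrow> l (on_coords I v) = (\<Sum>i\<in>I. v i))"
  proof (rule N.asymptotically_independent_iff[OF I_sub \<open>prob_space M\<close> _ _ C(1)])
    fix i assume i: "i \<in> {1..n}"
    then have [measurable]: "P i \<in> borel_measurable M" by (rule rv)
    show "(\<lambda>x. 1 - P i x) \<in> borel_measurable M" by measurable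
    show "1 - P i x \<le> 1" if "x \<in> space M" for x using range[OF i that] by simp
  next
    fix i u assume "i \<in> I" and u: "0 \<le> u" "u \<le> (1::real)"
    then have i: "i \<in> {1..n}" using I_sub by blast
    show "\<exists>x. cdf (distr M borel (\<lambda>x. 1 - P i x)) x = u"
      by (rule M.cdf_reflected_onto[OF rv[OF i] range[OF i] cont[OF i] u])
  qed
  have "(\<exists>i\<in>{1..n}. \<exists>j\<in>{1..n}. i \<noteq> j \<and> l (on_coords {i, j} T.a) < T.a i + T.a j) \<longleftrightarrow>
      card I \<ge> 2 \<and> \<not> asymptotically_independent M I (\<lambda>i x. 1 - P i x)"
  proof
    assume "\<exists>i\<in>{1..n}. \<exists>j\<in>{1..n}. i \<noteq> j \<and> l (on_coords {i, j} T.a) < T.a i + T.a j"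
    then obtain i j where ij: "i \<in> {1..n}" "j \<in> {1..n}" "i \<noteq> j" "l (on_coords {i, j} T.a) < T.a i + T.a j" by blast
    \<comment> \<open>a coordinate with vanishing tail constant takes no part in joint exceedances\<close>
    have in_I: "i \<in> I" if ij: "i \<in> {1..n}" "j \<in> {1..n}" "i \<noteq> j" "l (on_coords {i, j} T.a) < T.a i + T.a j" for i j
    proof (rule ccontr)
      assume "i \<notin> I"
      then have "T.a i = 0" using a_I[OF ij(1)] by simp
      moreover from this have "on_coords {i, j} T.a = on_coords {j} T.a" by (auto simp: on_coords_def)
      ultimately show False using N.l_single[of j T.a, OF ij(2) T.a_nonneg[OF ij(2)]] ij(4) by simp
    qed
    have I2: "i \<in> I" "j \<in> I" using in_I[OF ij] in_I[of j i] ij by (auto simp: insert_commute add.commute)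
    have finI: "finite I" using I_sub finite_subset by blast
    have "card {i, j} \<le> card I" using I2 finI by (intro card_mono) auto
    then have "card I \<ge> 2" using ij(3) by simp
    moreover have "\<not> asymptotically_independent M I (\<lambda>i x. 1 - P i x)"
    proof
      let ?v = "on_coords {i, j} T.a"
      assume "asymptotically_independent M I (\<lambda>i x. 1 - P i x)"
      moreover have "\<forall>k\<in>I. 0 \<le> ?v k" using T.a_nonneg ij by (simp add: on_coords_def)
      ultimately have "l (on_coords I ?v) = (\<Sum>k\<in>I. ?v k)" unfolding AI by blast
      moreover have "on_coords I ?v = ?v" using I2 by (auto simp: on_coords_def)
      moreover have "(\<Sum>k\<in>I. ?v k) = (\<Sum>k\<in>{i, j}. T.a k)"
        using I2 finI unfolding on_coords_def by (subst sum.inter_restrict[symmetric]) (auto simp: Int_absorb1 Int_commute)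
      ultimately show False using ij by simp
    qed
    ultimately show "card I \<ge> 2 \<and> \<not> asymptotically_independent M I (\<lambda>i x. 1 - P i x)" ..
  next
    assume "card I \<ge> 2 \<and> \<not> asymptotically_independent M I (\<lambda>i x. 1 - P i x)"
    then obtain v where v: "\<forall>i\<in>I. 0 \<le> v i" "l (on_coords I v) \<noteq> (\<Sum>i\<in>I. v i)" unfolding AI by blast
    have "\<exists>i\<in>I. \<exists>j\<in>I. i \<noteq> j \<and> l (on_coords {i, j} T.a) < T.a i + T.a j"
      using v a_I I_sub by (intro N.pair_deficit_transfer[of I T.a v]) (auto simp: subset_iff)
    then show "\<exists>i\<in>{1..n}. \<exists>j\<in>{1..n}. i \<noteq> j \<and> l (on_coords {i, j} T.a) < T.a i + T.a j"
      using I_sub by blast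
  qed
  then show ?thesis using T.ratio_tendsto by simp
qed

end
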